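(* Let $(R,\mathfrak{m})$ be a local Noetherian ring and let $\mathfrak{p}\neq\mathfrak{m}$ be a prime ideal of $R$. Then $\tau_{\mathfrak{p}}=1$ if and only if $\dim R/\mathfrak{p}=1$ and $R/\mathfrak{p}$ is complete.
   Context: $E_R$ denotes the injective hull of the residue field $R/\mathfrak{m}$, and $E_R(R/\mathfrak{p})$ the injective hull of $R/\mathfrak{p}$. By a result of Enochs, $\operatorname{Hom}_R(E_R(R/\mathfrak{p}),E_R)$ is isomorphic to the completion $\widehat{R_{\mathfrak{p}}^{(X_{\mathfrak{p}})}}$ ($\mathfrak{p}R_{\mathfrak{p}}$-adic) of a free $R_{\mathfrak{p}}$-module with basis indexed by a set $X_{\mathfrak{p}}$; the cardinality $\tau_{\mathfrak{p}}=\operatorname{card} X_{\mathfrak{p}}$ is called the Enochs number of $\mathfrak{p}$. Equivalently, $\tau_{\mathfrak{p}}=\dim_{k(\mathfrak{p})}\operatorname{Hom}_R(k(\mathfrak{p}),E_R)$, where $k(\mathfrak{p})=R_{\mathfrak{p}}/\mathfrak{p}R_{\mathfrak{p}}$. "$R/\mathfrak{p}$ is complete" means complete in its $\mathfrak{m}$-adic topology. *)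

theory Defs
  imports "HOL-Algebra.Module" "HOL-Algebra.Ideal_Product" "HOL-Algebra.Ring_Divisibility"
    "HOL-Library.Extended_Nat"
begin

section \<open>Rings\<close>

definition local_noetherian_ring :: "('a, 'r) ring_scheme \<Rightarrow> 'a set \<Rightarrow> bool" where
  "local_noetherian_ring R \<mm> \<longleftrightarrow>
     cring R \<and> noetherian_ring R \<and> maximalideal \<mm> R \<and> (\<forall>J. maximalideal J R \<longrightarrow> J = \<mm>)"

text \<open>Supremum of the lengths of strict chains of prime ideals; it is \<open>0\<close>, not \<open>- \<infinity>\<close>, for the
  zero ring.\<close>

definition krull_dim :: "('a, 'r) ring_scheme \<Rightarrow> enat" where
  "krull_dim R = Sup {enat n | n. \<exists>P :: nat \<Rightarrow> 'a set.
     (\<forall>i\<le>n. primeideal (P i) R) \<and> (\<forall>i<n. P i \<subset> P (Suc i))}"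

text \<open>The fraction \<open>a / s\<close>: the class of \<open>(a, s)\<close> under
  \<open>(a, s) \<sim> (b, t) \<longleftrightarrow> u (t a - s b) = 0\<close> for some \<open>u \<in> S\<close>.\<close>

definition frac :: "('a, 'r) ring_scheme \<Rightarrow> 'a set \<Rightarrow> 'a \<Rightarrow> 'a \<Rightarrow> ('a \<times> 'a) set" where
  "frac R S a s = {(b, t). b \<in> carrier R \<and> t \<in> S \<and>
     (\<exists>u\<in>S. u \<otimes>\<^bsub>R\<^esub> (t \<otimes>\<^bsub>R\<^esub> a) = u \<otimes>\<^bsub>R\<^esub> (s \<otimes>\<^bsub>R\<^esub> b))}"

definition localization :: "('a, 'r) ring_scheme \<Rightarrow> 'a set \<Rightarrow> ('a \<times> 'a) set ring" where
  "localization R S =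
    \<lparr>carrier = {frac R S a s | a s. a \<in> carrier R \<and> s \<in> S},
     monoid.mult = (\<lambda>A B. \<Union>x\<in>A. \<Union>y\<in>B.
               frac R S (fst x \<otimes>\<^bsub>R\<^esub> fst y) (snd x \<otimes>\<^bsub>R\<^esub> snd y)),
     one = frac R S \<one>\<^bsub>R\<^esub> \<one>\<^bsub>R\<^esub>,
     zero = frac R S \<zero>\<^bsub>R\<^esub> \<one>\<^bsub>R\<^esub>,
     add = (\<lambda>A B. \<Union>x\<in>A. \<Union>y\<in>B.
              frac R S (snd y \<otimes>\<^bsub>R\<^esub> fst x \<oplus>\<^bsub>R\<^esub> snd x \<otimes>\<^bsub>R\<^esub> fst y) (snd x \<otimes>\<^bsub>R\<^esub> snd y))\<rparr>"

definition localization_at :: "('a, 'r) ring_scheme \<Rightarrow> 'a set \<Rightarrow> ('a \<times> 'a) set ring" where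
  "localization_at R \<pp> = localization R (carrier R - \<pp>)"

definition localization_map :: "('a, 'r) ring_scheme \<Rightarrow> 'a set \<Rightarrow> 'a \<Rightarrow> ('a \<times> 'a) set" where
  "localization_map R \<pp> a = frac R (carrier R - \<pp>) a \<one>\<^bsub>R\<^esub>"

text \<open>The ideal \<open>\<pp>R\<^sub>\<pp>\<close> of \<open>R\<^sub>\<pp>\<close>.\<close>

definition extended_prime :: "('a, 'r) ring_scheme \<Rightarrow> 'a set \<Rightarrow> ('a \<times> 'a) set set" where
  "extended_prime R \<pp> = Idl\<^bsub>localization_at R \<pp>\<^esub> (localization_map R \<pp> ` \<pp>)"


section \<open>Modules\<close>

text \<open>The record type of modules extends that of rings, so it has fields \<open>mult\<close> and \<open>one\<close> that play
  no role for modules; they are left \<open>undefined\<close> below.\<close>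

definition ring_as_module :: "('a, 'r) ring_scheme \<Rightarrow> ('a, 'a) module" where
  "ring_as_module R =
    \<lparr>carrier = carrier R, monoid.mult = undefined, one = undefined,
     zero = \<zero>\<^bsub>R\<^esub>, add = add R, smult = monoid.mult R\<rparr>"

definition quot_module :: "('a, 'b, 'm) module_scheme \<Rightarrow> 'b set \<Rightarrow> ('a, 'b set) module" where
  "quot_module M N =
    \<lparr>carrier = a_rcosets\<^bsub>M\<^esub> N, monoid.mult = undefined, one = undefined,
     zero = N, add = set_add M, smult = (\<lambda>r A. \<Union>x\<in>A. N +>\<^bsub>M\<^esub> (r \<odot>\<^bsub>M\<^esub> x))\<rparr>"

definition free_module :: "('a, 'r) ring_scheme \<Rightarrow> 'x set \<Rightarrow> ('a, 'x \<Rightarrow> 'a) module" where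
  "free_module A B =
    \<lparr>carrier = {f \<in> B \<rightarrow>\<^sub>E carrier A. finite {x \<in> B. f x \<noteq> \<zero>\<^bsub>A\<^esub>}},
     monoid.mult = undefined, one = undefined,
     zero = (\<lambda>x\<in>B. \<zero>\<^bsub>A\<^esub>),
     add = (\<lambda>f g. \<lambda>x\<in>B. f x \<oplus>\<^bsub>A\<^esub> g x),
     smult = (\<lambda>a f. \<lambda>x\<in>B. a \<otimes>\<^bsub>A\<^esub> f x)\<rparr>"

definition restrict_scalars :: "('a \<Rightarrow> 'c) \<Rightarrow> ('c, 'b, 'm) module_scheme \<Rightarrow> ('a, 'b) module" where
  "restrict_scalars h M =
    \<lparr>carrier = carrier M, monoid.mult = undefined, one = undefined,
     zero = \<zero>\<^bsub>M\<^esub>, add = add M, smult = (\<lambda>r x. h r \<odot>\<^bsub>M\<^esub> x)\<rparr>"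

definition linear_maps ::
  "('a, 'r) ring_scheme \<Rightarrow> ('a, 'b, 'm) module_scheme \<Rightarrow> ('a, 'c, 'n) module_scheme \<Rightarrow> ('b \<Rightarrow> 'c) set"
  where
  "linear_maps R M N = {f \<in> carrier M \<rightarrow>\<^sub>E carrier N.
     (\<forall>x\<in>carrier M. \<forall>y\<in>carrier M. f (x \<oplus>\<^bsub>M\<^esub> y) = f x \<oplus>\<^bsub>N\<^esub> f y) \<and>
     (\<forall>r\<in>carrier R. \<forall>x\<in>carrier M. f (r \<odot>\<^bsub>M\<^esub> x) = r \<odot>\<^bsub>N\<^esub> f x)}"

definition Hom_module ::
  "('a, 'r) ring_scheme \<Rightarrow> ('a, 'b, 'm) module_scheme \<Rightarrow> ('a, 'c, 'n) module_scheme \<Rightarrow> ('a, 'b \<Rightarrow> 'c) module"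
  where
  "Hom_module R M N =
    \<lparr>carrier = linear_maps R M N, monoid.mult = undefined, one = undefined,
     zero = (\<lambda>x\<in>carrier M. \<zero>\<^bsub>N\<^esub>),
     add = (\<lambda>f g. \<lambda>x\<in>carrier M. f x \<oplus>\<^bsub>N\<^esub> g x),
     smult = (\<lambda>r f. \<lambda>x\<in>carrier M. r \<odot>\<^bsub>N\<^esub> f x)\<rparr>"

definition isomorphic_modules ::
  "('a, 'r) ring_scheme \<Rightarrow> ('a, 'b, 'm) module_scheme \<Rightarrow> ('a, 'c, 'n) module_scheme \<Rightarrow> bool" where
  "isomorphic_modules R M N \<longleftrightarrow> (\<exists>f\<in>linear_maps R M N. bij_betw f (carrier M) (carrier N))"


section \<open>Adic completion\<close>

text \<open>The submodule \<open>IM\<close> of \<open>M\<close>.\<close>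

definition ideal_smult ::
  "('a, 'r) ring_scheme \<Rightarrow> 'a set \<Rightarrow> ('a, 'b, 'm) module_scheme \<Rightarrow> 'b set" where
  "ideal_smult R I M =
     \<Inter>{N. submodule N R M \<and> (\<forall>a\<in>I. \<forall>x\<in>carrier M. a \<odot>\<^bsub>M\<^esub> x \<in> N)}"

definition adic_submodule ::
  "('a, 'r) ring_scheme \<Rightarrow> 'a set \<Rightarrow> ('a, 'b, 'm) module_scheme \<Rightarrow> nat \<Rightarrow> 'b set" where
  "adic_submodule R I M n = ideal_smult R (I [^]\<^bsub>ideals_set R\<^esub> n) M"

text \<open>The inverse limit of the modules \<open>M / I\<^sup>nM\<close>. The transition map sends a coset of \<open>I\<^sup>n\<^sup>+\<^sup>1M\<close> to
  the coset of \<open>I\<^sup>nM\<close> containing it.\<close>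

definition adic_completion ::
  "('a, 'r) ring_scheme \<Rightarrow> 'a set \<Rightarrow> ('a, 'b, 'm) module_scheme \<Rightarrow> ('a, nat \<Rightarrow> 'b set) module" where
  "adic_completion R I M = (let Q = (\<lambda>n. quot_module M (adic_submodule R I M n)) in
    \<lparr>carrier = {x. (\<forall>n. x n \<in> carrier (Q n)) \<and> (\<forall>n. x (Suc n) \<subseteq> x n)},
     monoid.mult = undefined, one = undefined,
     zero = (\<lambda>n. \<zero>\<^bsub>Q n\<^esub>),
     add = (\<lambda>x y n. x n \<oplus>\<^bsub>Q n\<^esub> y n),
     smult = (\<lambda>r x n. r \<odot>\<^bsub>Q n\<^esub> x n)\<rparr>)"

text \<open>Complete in the \<open>I\<close>-adic topology (in particular separated).\<close>

definition adically_complete ::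
  "('a, 'r) ring_scheme \<Rightarrow> 'a set \<Rightarrow> ('a, 'b, 'm) module_scheme \<Rightarrow> bool" where
  "adically_complete R I M \<longleftrightarrow>
     bij_betw (\<lambda>x n. adic_submodule R I M n +>\<^bsub>M\<^esub> x) (carrier M) (carrier (adic_completion R I M))"


section \<open>Injective hulls\<close>

text \<open>HOL cannot quantify over modules of all types, so the test modules have their carriers in the
  type of the ring elements. This loses nothing: it covers the inclusions of ideals into the ring, and
  Baer's criterion applies; see \<open>injective_module_extend\<close> below.\<close>

definition injective_module :: "('a, 'r) ring_scheme \<Rightarrow> ('a, 'e, 'm) module_scheme \<Rightarrow> bool" where
  "injective_module R E \<longleftrightarrow> module R E \<and>
     (\<forall>(M :: ('a, 'a) module) (N :: ('a, 'a) module). \<forall>i\<in>linear_maps R M N. \<forall>f\<in>linear_maps R M E.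
        module R M \<and> module R N \<and> inj_on i (carrier M) \<longrightarrow>
        (\<exists>g\<in>linear_maps R N E. \<forall>x\<in>carrier M. g (i x) = f x))"

definition injective_hull ::
  "('a, 'r) ring_scheme \<Rightarrow> ('a, 'b, 'm) module_scheme \<Rightarrow> ('a, 'e, 'n) module_scheme \<Rightarrow> bool" where
  "injective_hull R M E \<longleftrightarrow> injective_module R E \<and>
     (\<exists>i\<in>linear_maps R M E. inj_on i (carrier M) \<and>
        (\<forall>N. submodule N R E \<and> N \<noteq> {\<zero>\<^bsub>E\<^esub>} \<longrightarrow> N \<inter> i ` carrier M \<noteq> {\<zero>\<^bsub>E\<^esub>}))"

text \<open>Injectivity with respect to test modules of an arbitrary type.\<close>

lemma injective_module_extend:
  fixes R :: "('a, 'r) ring_scheme" and E :: "('a, 'e, 'k) module_scheme"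
    and M :: "('a, 'b, 'm) module_scheme" and N :: "('a, 'c, 'n) module_scheme"
  assumes E: "injective_module R E" and "module R M" and "module R N"
    and i: "i \<in> linear_maps R M N" and inj: "inj_on i (carrier M)" and f: "f \<in> linear_maps R M E"
  shows "\<exists>g\<in>linear_maps R N E. \<forall>x\<in>carrier M. g (i x) = f x"
proof -
  interpret E: module R E using E by (simp add: injective_module_def)
  interpret M: module R M by fact
  interpret N: module R N by fact
  define ext where "ext G \<longleftrightarrow> G \<subseteq> carrier N \<times> carrier E
    \<and> (\<forall>x y x' y'. (x, y) \<in> G \<longrightarrow> (x', y') \<in> G \<longrightarrow> (x \<oplus>\<^bsub>N\<^esub> x', y \<oplus>\<^bsub>E\<^esub> y') \<in> G)
    \<and> (\<forall>r\<in>carrier R. \<forall>x y. (x, y) \<in> G \<longrightarrow> (r \<odot>\<^bsub>N\<^esub> x, r \<odot>\<^bsub>E\<^esub> y) \<in> G)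
    \<and> (\<forall>x\<in>carrier M. (i x, f x) \<in> G) \<and> (\<forall>y. (\<zero>\<^bsub>N\<^esub>, y) \<in> G \<longrightarrow> y = \<zero>\<^bsub>E\<^esub>)" for G
  have iM: "i x \<in> carrier N" if "x \<in> carrier M" for x using i that by (auto simp: linear_maps_def)
  have fM: "f x \<in> carrier E" if "x \<in> carrier M" for x using f that by (auto simp: linear_maps_def)
  have i0: "i \<zero>\<^bsub>M\<^esub> = \<zero>\<^bsub>N\<^esub>" 
  proof -
    have "i (\<zero>\<^bsub>R\<^esub> \<odot>\<^bsub>M\<^esub> \<zero>\<^bsub>M\<^esub>) = \<zero>\<^bsub>R\<^esub> \<odot>\<^bsub>N\<^esub> i \<zero>\<^bsub>M\<^esub>" using i unfolding linear_maps_def by blast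
    then show ?thesis using iM by simp
  qed
  have f0: "f \<zero>\<^bsub>M\<^esub> = \<zero>\<^bsub>E\<^esub>" 
  proof -
    have "f (\<zero>\<^bsub>R\<^esub> \<odot>\<^bsub>M\<^esub> \<zero>\<^bsub>M\<^esub>) = \<zero>\<^bsub>R\<^esub> \<odot>\<^bsub>E\<^esub> f \<zero>\<^bsub>M\<^esub>" using f unfolding linear_maps_def by blast
    then show ?thesis using fM by simp
  qed
  have ex0: "ext ((\<lambda>x. (i x, f x)) ` carrier M)"
    unfolding ext_def
  proof (intro conjI allI impI ballI)
    show "(\<lambda>x. (i x, f x)) ` carrier M \<subseteq> carrier N \<times> carrier E" using iM fM by auto
  next
    fix x y x' y' assume "(x, y) \<in> (\<lambda>x. (i x, f x)) ` carrier M" "(x', y') \<in> (\<lambda>x. (i x, f x)) ` carrier M"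
    then obtain u u' where u: "u \<in> carrier M" "u' \<in> carrier M" "x = i u" "y = f u" "x' = i u'" "y' = f u'" by auto
    moreover from u have "i (u \<oplus>\<^bsub>M\<^esub> u') = i u \<oplus>\<^bsub>N\<^esub> i u'" "f (u \<oplus>\<^bsub>M\<^esub> u') = f u \<oplus>\<^bsub>E\<^esub> f u'"
      using i f unfolding linear_maps_def by blast+
    ultimately show "(x \<oplus>\<^bsub>N\<^esub> x', y \<oplus>\<^bsub>E\<^esub> y') \<in> (\<lambda>x. (i x, f x)) ` carrier M"
      by (intro image_eqI[of _ _ "u \<oplus>\<^bsub>M\<^esub> u'"]) simp_all
  next
    fix r x y assume "r \<in> carrier R" "(x, y) \<in> (\<lambda>x. (i x, f x)) ` carrier M"
    then obtain u where u: "r \<in> carrier R" "u \<in> carrier M" "x = i u" "y = f u" by auto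
    moreover from u have "i (r \<odot>\<^bsub>M\<^esub> u) = r \<odot>\<^bsub>N\<^esub> i u" "f (r \<odot>\<^bsub>M\<^esub> u) = r \<odot>\<^bsub>E\<^esub> f u"
      using i f unfolding linear_maps_def by blast+
    ultimately show "(r \<odot>\<^bsub>N\<^esub> x, r \<odot>\<^bsub>E\<^esub> y) \<in> (\<lambda>x. (i x, f x)) ` carrier M"
      by (intro image_eqI[of _ _ "r \<odot>\<^bsub>M\<^esub> u"]) simp_all
  next
    fix y assume "(\<zero>\<^bsub>N\<^esub>, y) \<in> (\<lambda>x. (i x, f x)) ` carrier M"
    then obtain u where "u \<in> carrier M" "i u = \<zero>\<^bsub>N\<^esub>" "y = f u" by auto
    then show "y = \<zero>\<^bsub>E\<^esub>" using inj i0 f0 by (metis M.M.zero_closed inj_onD)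
  qed auto
  have chain: "\<Union>C \<in> Collect ext" if ne: "C \<noteq> {}" and C: "subset.chain (Collect ext) C" for C
  proof -
    have ce: "ext G" if "G \<in> C" for G using C that by (auto simp: subset.chain_def)
    have add: "(x \<oplus>\<^bsub>N\<^esub> x', y \<oplus>\<^bsub>E\<^esub> y') \<in> \<Union>C" if xy: "(x, y) \<in> \<Union>C" "(x', y') \<in> \<Union>C" for x y x' y'
    proof -
      obtain G G' where G: "G \<in> C" "(x, y) \<in> G" "G' \<in> C" "(x', y') \<in> G'" using xy by auto
      then have "G \<subseteq> G' \<or> G' \<subseteq> G" using C unfolding subset_chain_def by blast
      then obtain H where "H \<in> C" "(x, y) \<in> H" "(x', y') \<in> H" using G by auto
      moreover have "ext H" using ce calculation by auto
      ultimately show ?thesis unfolding ext_def by blast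
    qed
    have "ext (\<Union>C)"
      unfolding ext_def
    proof (intro conjI)
      show "\<Union>C \<subseteq> carrier N \<times> carrier E" using ce unfolding ext_def by blast
      show "\<forall>r\<in>carrier R. \<forall>x y. (x, y) \<in> \<Union>C \<longrightarrow> (r \<odot>\<^bsub>N\<^esub> x, r \<odot>\<^bsub>E\<^esub> y) \<in> \<Union>C"
        using ce unfolding ext_def by blast
      show "\<forall>x\<in>carrier M. (i x, f x) \<in> \<Union>C" using ce ne unfolding ext_def by blast
      show "\<forall>y. (\<zero>\<^bsub>N\<^esub>, y) \<in> \<Union>C \<longrightarrow> y = \<zero>\<^bsub>E\<^esub>" using ce unfolding ext_def by blast
    qed (use add in blast)
    then show ?thesis by simp
  qed
  obtain G where G: "ext G" and max: "\<And>H. ext H \<Longrightarrow> G \<subseteq> H \<Longrightarrow> H = G"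
    using subset_Zorn_nonempty[of "Collect ext", OF _ chain] ex0 by blast
  have GS: "x \<in> carrier N" "y \<in> carrier E" if "(x, y) \<in> G" for x y
    using G that unfolding ext_def by auto
  have Gadd: "(x \<oplus>\<^bsub>N\<^esub> x', y \<oplus>\<^bsub>E\<^esub> y') \<in> G" if "(x, y) \<in> G" "(x', y') \<in> G" for x y x' y'
    using G that unfolding ext_def by auto
  have Gsm: "(r \<odot>\<^bsub>N\<^esub> x, r \<odot>\<^bsub>E\<^esub> y) \<in> G" if "r \<in> carrier R" "(x, y) \<in> G" for r x y
    using G that unfolding ext_def by auto
  have Gneg: "(\<ominus>\<^bsub>N\<^esub> x, \<ominus>\<^bsub>E\<^esub> y) \<in> G" if "(x, y) \<in> G" for x y
    using Gsm[of "\<ominus>\<^bsub>R\<^esub> \<one>\<^bsub>R\<^esub>" x y] that GS[OF that] by (simp add: N.smult_l_minus E.smult_l_minus)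
  have Gz: "y = \<zero>\<^bsub>E\<^esub>" if "(\<zero>\<^bsub>N\<^esub>, y) \<in> G" for y using G that unfolding ext_def by auto
  have GM: "(i x, f x) \<in> G" if "x \<in> carrier M" for x using G that unfolding ext_def by auto
  have G0: "(\<zero>\<^bsub>N\<^esub>, \<zero>\<^bsub>E\<^esub>) \<in> G" using GM[of "\<zero>\<^bsub>M\<^esub>"] i0 f0 by simp
  have Gun: "y = y'" if "(x, y) \<in> G" "(x, y') \<in> G" for x y y'
  proof -
    have "(\<zero>\<^bsub>N\<^esub>, y \<oplus>\<^bsub>E\<^esub> \<ominus>\<^bsub>E\<^esub> y') \<in> G" using Gadd[OF that(1) Gneg[OF that(2)]] GS that by (simp add: N.M.r_neg)
    then have *: "y \<oplus>\<^bsub>E\<^esub> \<ominus>\<^bsub>E\<^esub> y' = \<zero>\<^bsub>E\<^esub>" by (rule Gz)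
    have c: "y \<in> carrier E" "y' \<in> carrier E" using GS that by blast+
    have "y = (y \<oplus>\<^bsub>E\<^esub> \<ominus>\<^bsub>E\<^esub> y') \<oplus>\<^bsub>E\<^esub> y'" using c by (simp add: E.M.a_assoc E.M.l_neg)
    then show ?thesis using * c by simp
  qed
  have total: "\<exists>y. (x, y) \<in> G" if x: "x \<in> carrier N" for x
  proof -
    define J where "J = {r \<in> carrier R. \<exists>y. (r \<odot>\<^bsub>N\<^esub> x, y) \<in> G}"
    define \<phi> where "\<phi> = (\<lambda>r\<in>J. THE y. (r \<odot>\<^bsub>N\<^esub> x, y) \<in> G)"
    have \<phi>I: "\<phi> r = y" if "r \<in> carrier R" "(r \<odot>\<^bsub>N\<^esub> x, y) \<in> G" for r y
      using that Gun by (auto simp: \<phi>_def J_def)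
    have \<phi>G: "(r \<odot>\<^bsub>N\<^esub> x, \<phi> r) \<in> G" if "r \<in> J" for r
      using that \<phi>I by (auto simp: J_def)
    define RM where "RM = ring_as_module R"
    have RM: "module R RM"
      unfolding RM_def
    proof (intro moduleI abelian_groupI)
      show "cring R" by (rule E.R.cring_axioms)
    qed (auto simp: ring_as_module_def E.R.a_ac E.R.m_assoc E.R.l_distr E.R.r_distr
          intro!: bexI[of _ "\<ominus>\<^bsub>R\<^esub> _"] E.R.l_neg)
    have RMs: "carrier RM = carrier R" "x \<oplus>\<^bsub>RM\<^esub> y = x \<oplus>\<^bsub>R\<^esub> y" "\<zero>\<^bsub>RM\<^esub> = \<zero>\<^bsub>R\<^esub>"
      "x \<odot>\<^bsub>RM\<^esub> y = x \<otimes>\<^bsub>R\<^esub> y" for x y by (auto simp: RM_def ring_as_module_def)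
    interpret RM: module R RM by (rule RM)
    have Jadd: "a \<oplus>\<^bsub>R\<^esub> b \<in> J \<and> \<phi> (a \<oplus>\<^bsub>R\<^esub> b) = \<phi> a \<oplus>\<^bsub>E\<^esub> \<phi> b" if "a \<in> J" "b \<in> J" for a b
    proof -
      have c: "a \<in> carrier R" "b \<in> carrier R" using that by (auto simp: J_def)
      have "((a \<oplus>\<^bsub>R\<^esub> b) \<odot>\<^bsub>N\<^esub> x, \<phi> a \<oplus>\<^bsub>E\<^esub> \<phi> b) \<in> G"
        using Gadd[OF \<phi>G[OF that(1)] \<phi>G[OF that(2)]] c x by (simp add: N.smult_l_distr)
      then show ?thesis using c \<phi>I by (auto simp: J_def)
    qed
    have Jsm: "a \<otimes>\<^bsub>R\<^esub> b \<in> J \<and> \<phi> (a \<otimes>\<^bsub>R\<^esub> b) = a \<odot>\<^bsub>E\<^esub> \<phi> b" if "a \<in> carrier R" "b \<in> J" for a b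
    proof -
      have c: "b \<in> carrier R" using that by (auto simp: J_def)
      have "((a \<otimes>\<^bsub>R\<^esub> b) \<odot>\<^bsub>N\<^esub> x, a \<odot>\<^bsub>E\<^esub> \<phi> b) \<in> G"
        using Gsm[OF that(1) \<phi>G[OF that(2)]] c that x by (simp add: N.smult_assoc1)
      then show ?thesis using c that \<phi>I by (auto simp: J_def)
    qed
    have J0: "\<zero>\<^bsub>R\<^esub> \<in> J" using G0 x by (auto simp: J_def)
    have "submodule J R RM"
    proof (rule RM.submoduleI)
      show "J \<subseteq> carrier RM" by (auto simp: J_def RMs)
      show "\<ominus>\<^bsub>RM\<^esub> a \<in> J" if "a \<in> J" for a
      proof -
        have "a \<in> carrier R" using that by (auto simp: J_def)
        then have "\<ominus>\<^bsub>RM\<^esub> a = (\<ominus>\<^bsub>R\<^esub> \<one>\<^bsub>R\<^esub>) \<otimes>\<^bsub>R\<^esub> a"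
          using RM.smult_l_minus[of "\<one>\<^bsub>R\<^esub>" a] by (simp add: RMs)
        then show ?thesis using Jsm that by simp
      qed
    qed (auto simp: RMs Jadd Jsm J0)
    then have JM: "module R (RM\<lparr>carrier := J\<rparr>)" using RM by (rule submodule.submodule_is_module)
    have "restrict id J \<in> linear_maps R (RM\<lparr>carrier := J\<rparr>) RM"
      by (auto simp: linear_maps_def RMs Jadd Jsm) (auto simp: J_def)
    moreover have "\<phi> \<in> linear_maps R (RM\<lparr>carrier := J\<rparr>) E"
    proof -
      have "\<phi> r \<in> carrier E" if "r \<in> J" for r using \<phi>G[OF that] GS by blast
      moreover have "\<phi> \<in> extensional J" by (simp add: \<phi>_def)
      ultimately show ?thesis by (simp add: linear_maps_def RMs Jadd Jsm PiE_def)
    qed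
    moreover have "inj_on (restrict id J) (carrier (RM\<lparr>carrier := J\<rparr>))" by (simp add: inj_on_def)
    ultimately obtain \<psi> where \<psi>: "\<psi> \<in> linear_maps R RM E" "\<forall>r\<in>J. \<psi> r = \<phi> r"
      using E JM RM unfolding injective_module_def by fastforce
    define e where "e = \<psi> \<one>\<^bsub>R\<^esub>"
    have e: "e \<in> carrier E" using \<psi> by (auto simp: e_def linear_maps_def RMs)
    have \<phi>e: "\<phi> r = r \<odot>\<^bsub>E\<^esub> e" if "r \<in> J" for r
    proof -
      have r: "r \<in> carrier R" using that by (auto simp: J_def)
      have "\<psi> (r \<odot>\<^bsub>RM\<^esub> \<one>\<^bsub>R\<^esub>) = r \<odot>\<^bsub>E\<^esub> \<psi> \<one>\<^bsub>R\<^esub>" 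
        using \<psi>(1) r E.R.one_closed unfolding linear_maps_def RMs(1) by blast
      then show ?thesis using \<psi> that r by (simp add: RMs e_def)
    qed
    define H where "H = {(d \<oplus>\<^bsub>N\<^esub> r \<odot>\<^bsub>N\<^esub> x, y \<oplus>\<^bsub>E\<^esub> r \<odot>\<^bsub>E\<^esub> e) | d y r. (d, y) \<in> G \<and> r \<in> carrier R}"
    have HI: "(d \<oplus>\<^bsub>N\<^esub> r \<odot>\<^bsub>N\<^esub> x, y \<oplus>\<^bsub>E\<^esub> r \<odot>\<^bsub>E\<^esub> e) \<in> H" if "(d, y) \<in> G" "r \<in> carrier R" for d y r
      using that by (auto simp: H_def)
    have GH: "G \<subseteq> H"
    proof
      fix z assume "z \<in> G"
      then obtain d y where z: "z = (d, y)" "(d, y) \<in> G" by (cases z) auto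
      then show "z \<in> H" using HI[of d y "\<zero>\<^bsub>R\<^esub>"] GS[of d y] x e by simp
    qed
    have "ext H"
      unfolding ext_def
    proof (intro conjI allI impI ballI)
      show "H \<subseteq> carrier N \<times> carrier E" using GS x e by (auto simp: H_def)
      show "(i u, f u) \<in> H" if "u \<in> carrier M" for u using GM GH that by auto
    next
      fix a b a' b' assume "(a, b) \<in> H" "(a', b') \<in> H"
      then obtain d y r d' y' r' where *: "(d, y) \<in> G" "r \<in> carrier R" "(d', y') \<in> G" "r' \<in> carrier R"
        "a = d \<oplus>\<^bsub>N\<^esub> r \<odot>\<^bsub>N\<^esub> x" "b = y \<oplus>\<^bsub>E\<^esub> r \<odot>\<^bsub>E\<^esub> e" "a' = d' \<oplus>\<^bsub>N\<^esub> r' \<odot>\<^bsub>N\<^esub> x" "b' = y' \<oplus>\<^bsub>E\<^esub> r' \<odot>\<^bsub>E\<^esub> e"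
        by (auto simp: H_def)
      have "a \<oplus>\<^bsub>N\<^esub> a' = (d \<oplus>\<^bsub>N\<^esub> d') \<oplus>\<^bsub>N\<^esub> (r \<oplus>\<^bsub>R\<^esub> r') \<odot>\<^bsub>N\<^esub> x"
        using * GS x by (simp add: N.smult_l_distr N.M.add.m_ac)
      moreover have "b \<oplus>\<^bsub>E\<^esub> b' = (y \<oplus>\<^bsub>E\<^esub> y') \<oplus>\<^bsub>E\<^esub> (r \<oplus>\<^bsub>R\<^esub> r') \<odot>\<^bsub>E\<^esub> e"
        using * GS e by (simp add: E.smult_l_distr E.M.add.m_ac)
      ultimately show "(a \<oplus>\<^bsub>N\<^esub> a', b \<oplus>\<^bsub>E\<^esub> b') \<in> H" using * Gadd HI by simp
    next
      fix s a b assume s: "s \<in> carrier R" and "(a, b) \<in> H"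
      then obtain d y r where *: "(d, y) \<in> G" "r \<in> carrier R"
        "a = d \<oplus>\<^bsub>N\<^esub> r \<odot>\<^bsub>N\<^esub> x" "b = y \<oplus>\<^bsub>E\<^esub> r \<odot>\<^bsub>E\<^esub> e" by (auto simp: H_def)
      have "s \<odot>\<^bsub>N\<^esub> a = s \<odot>\<^bsub>N\<^esub> d \<oplus>\<^bsub>N\<^esub> (s \<otimes>\<^bsub>R\<^esub> r) \<odot>\<^bsub>N\<^esub> x"
        using * GS s x by (simp add: N.smult_r_distr N.smult_assoc1)
      moreover have "s \<odot>\<^bsub>E\<^esub> b = s \<odot>\<^bsub>E\<^esub> y \<oplus>\<^bsub>E\<^esub> (s \<otimes>\<^bsub>R\<^esub> r) \<odot>\<^bsub>E\<^esub> e"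
        using * GS s e by (simp add: E.smult_r_distr E.smult_assoc1)
      ultimately show "(s \<odot>\<^bsub>N\<^esub> a, s \<odot>\<^bsub>E\<^esub> b) \<in> H" using * Gsm s HI by simp
    next
      fix b assume "(\<zero>\<^bsub>N\<^esub>, b) \<in> H"
      then obtain d y r where *: "(d, y) \<in> G" "r \<in> carrier R"
        "\<zero>\<^bsub>N\<^esub> = d \<oplus>\<^bsub>N\<^esub> r \<odot>\<^bsub>N\<^esub> x" "b = y \<oplus>\<^bsub>E\<^esub> r \<odot>\<^bsub>E\<^esub> e" by (auto simp: H_def)
      have "\<ominus>\<^bsub>N\<^esub> d = r \<odot>\<^bsub>N\<^esub> x"
        using * GS[OF *(1)] x by (intro N.M.minus_equality) (simp_all add: N.M.a_comm)
      then have "(r \<odot>\<^bsub>N\<^esub> x, \<ominus>\<^bsub>E\<^esub> y) \<in> G" using Gneg[OF *(1)] by simp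
      then have "r \<in> J" "\<phi> r = \<ominus>\<^bsub>E\<^esub> y" using * \<phi>I by (auto simp: J_def)
      then show "b = \<zero>\<^bsub>E\<^esub>" using \<phi>e[of r] * GS by (simp add: E.M.r_neg)
    qed
    then have "H = G" using max GH by blast
    moreover have "(x, e) \<in> H" using HI[OF G0, of "\<one>\<^bsub>R\<^esub>"] x e by simp
    ultimately show ?thesis by auto
  qed
  define g where "g = (\<lambda>x\<in>carrier N. THE y. (x, y) \<in> G)"
  have gI: "g x = y" if "(x, y) \<in> G" for x y using that Gun GS by (auto simp: g_def)
  have gG: "(x, g x) \<in> G" if "x \<in> carrier N" for x using total[OF that] gI by auto
  have "g \<in> linear_maps R N E"
    unfolding linear_maps_def
  proof (intro CollectI conjI ballI)
    have "g x \<in> carrier E" if "x \<in> carrier N" for x using gG[OF that] GS by blast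
    moreover have "g \<in> extensional (carrier N)" by (simp add: g_def)
    ultimately show "g \<in> carrier N \<rightarrow>\<^sub>E carrier E" by (simp add: PiE_def)
  qed (auto intro!: gI Gadd Gsm gG)
  moreover have "\<forall>x\<in>carrier M. g (i x) = f x" using GM gI by auto
  ultimately show ?thesis by blast
qed

section \<open>Enochs numbers\<close>

text \<open>\<open>B\<close> is a set as in Enochs's theorem: for \<open>E = E\<^sub>R\<close> and \<open>E\<^sub>\<pp> = E\<^sub>R(R/\<pp>)\<close>, the module
  \<open>Hom\<^sub>R(E\<^sub>\<pp>, E)\<close> is isomorphic to the \<open>\<pp>R\<^sub>\<pp>\<close>-adic completion of the free \<open>R\<^sub>\<pp>\<close>-module on \<open>B\<close>.
  The cardinality of \<open>B\<close> is the Enochs number \<open>\<tau>\<^sub>\<pp>\<close>; \<open>card B = 1\<close> says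
  that it is \<open>1\<close>, since \<open>card\<close> is \<open>0\<close> on infinite sets. Requiring \<open>R\<close>-linearity of the isomorphism is
  the same as requiring \<open>R\<^sub>\<pp>\<close>-linearity, as the elements outside \<open>\<pp>\<close> act bijectively on both sides.\<close>

definition enochs_index_set ::
  "('a, 'r) ring_scheme \<Rightarrow> 'a set \<Rightarrow> ('a, 'f, 'm) module_scheme \<Rightarrow> ('a, 'e, 'n) module_scheme \<Rightarrow> 'x set \<Rightarrow> bool"
  where
  "enochs_index_set R \<pp> E\<^sub>\<pp> E B \<longleftrightarrow>
     isomorphic_modules R (Hom_module R E\<^sub>\<pp> E)
       (restrict_scalars (localization_map R \<pp>)
         (adic_completion (localization_at R \<pp>) (extended_prime R \<pp>)
           (free_module (localization_at R \<pp>) B)))"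

end

theory Submission
  imports Defs
begin

text \<open>Let \<open>K\<close> be the residue field of \<open>\<pp>\<close>, that is, the set of elements of \<open>E\<^sub>\<pp>\<close> killed by \<open>\<pp>\<close>. A map
  \<open>E\<^sub>\<pp> \<rightarrow> E\<close> vanishing on \<open>K\<close> lies in \<open>\<pp> Hom(E\<^sub>\<pp>, E)\<close>, and in the completion of a free module \<open>C\<close> the part
  over \<open>\<pp>C\<close> is \<open>\<pp>\<close> times the completion. Hence the Enochs number is \<open>1\<close> iff \<open>Hom(K, E)\<close> is a
  one-dimensional vector space over \<open>K\<close>.

  Suppose that \<open>R/\<pp>\<close> is complete of dimension one, and let \<open>x \<in> \<mm> - \<pp>\<close>, so that \<open>K = (R/\<pp>)[1/x]\<close>.
  Completeness makes every endomorphism of \<open>E\<close> act on the annihilator \<open>W\<close> of \<open>\<pp>\<close> in \<open>E\<close> as a scalar, so a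
  submodule of \<open>W\<close> with annihilator \<open>\<pp>\<close> is all of \<open>W\<close>. Therefore a map \<open>f : K \<rightarrow> E\<close> that is not zero maps
  onto \<open>W\<close>, and a chain condition in \<open>E\<close> gives \<open>x\<^sup>N ker f \<subseteq> R/\<pp>\<close> for some \<open>N\<close>. For any other \<open>g\<close>, a
  multiple of \<open>g\<close> by a power of \<open>x\<close> vanishes on \<open>ker f\<close>, so it is the composition of \<open>f\<close> with an
  endomorphism of \<open>E\<close>, which is a scalar.

  Conversely, let \<open>f\<close> span \<open>Hom(K, E)\<close>. It maps onto \<open>W\<close>. A Cauchy sequence in \<open>R\<close> acts on \<open>W\<close>, and
  composing this action with \<open>f\<close> shows that it is multiplication by a fraction, which lies in \<open>R/\<pp>\<close> by
  Krull's intersection theorem; so \<open>R/\<pp>\<close> is complete. Moreover \<open>(c, y) \<mapsto> f(cy)\<close> is a symmetric pairing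
  by which \<open>K\<close> represents every map \<open>K \<rightarrow> E\<close>. If \<open>\<pp> \<subset> \<qq> \<subset> \<mm>\<close> with \<open>\<qq>\<close> prime, choose
  \<open>x \<in> \<mm> - \<qq>\<close> and \<open>y \<in> \<qq> - \<pp>\<close>, and let \<open>S = (R/\<pp>)[1/x]\<close>. As the \<open>y\<^sup>jS\<close> have intersection zero,
  duality shows that every map \<open>K \<rightarrow> E\<close> kills one of them. So the sums of \<open>y\<^sup>n/x^(k n)\<close> converge against
  all maps, hence to an element of \<open>S\<close>, and this is impossible if \<open>k\<close> grows fast enough.\<close>


section \<open>Ideals of noetherian rings\<close>

text \<open>Since \<open>R\<close> is not assumed complete, full Matlis duality cannot be invoked.
  Its role is taken by two facts: \<open>separation\<close>, by which an element outside a submodule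
  is detected by a map to \<open>E\<close>, and \<open>killed_separates\<close>, by which an ideal
  is recovered from the elements of \<open>E\<close> that it kills. An endomorphism of
  \<open>E\<close> need not be a scalar, but it is one on the elements killed by \<mm>^n, and the
  scalars for different n fit into a sequence that converges in R/\<pp> when that ring is complete.
  The field K is handled as an \<open>R\<close>-module on which elements outside \<pp> act
  bijectively: fractions are equations with cleared denominators, and 1/x^n is a term of the
  sequence from \<open>roots\<close>. The growth of k is dictated by the wish that y^n/x^(k n)
  should not have denominator x^(k (n-1)) modulo y^(n+1) S. Were this impossible for all exponents,
  Krull's theorem would place y^n in y^(n+1) S and make y a unit of S, whereas y lies in \<qq> and
  no power of x does.\<close>

lemma (in noetherian_ring) noetherian_induct [consumes 1, case_names step]:
  assumes "ideal I R"
    and step: "\<And>I. ideal I R \<Longrightarrow> (\<And>J. ideal J R \<Longrightarrow> I \<subset> J \<Longrightarrow> P J) \<Longrightarrow> P I"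
  shows "P I"
proof (rule ccontr)
  assume "\<not> P I"
  define S where "S = {J. ideal J R \<and> \<not> P J}"
  have "S \<noteq> {}" using assms(1) \<open>\<not> P I\<close> by (auto simp: S_def)
  have "\<Union>C \<in> S" if "C \<noteq> {}" "subset.chain S C" for C
  proof -
    have "subset.chain {I. ideal I R} C" using that(2) by (auto simp: S_def pred_on.chain_def)
    with that(1) have "\<Union>C \<in> C" by (rule ideal_chain_is_trivial)
    moreover have "C \<subseteq> S" using that(2) by (simp add: pred_on.chain_def)
    ultimately show ?thesis by (rule rev_subsetD)
  qed
  with \<open>S \<noteq> {}\<close> have "\<exists>M\<in>S. \<forall>X\<in>S. M \<subseteq> X \<longrightarrow> X = M" by (rule subset_Zorn_nonempty)
  then obtain M where M: "M \<in> S" "\<forall>X\<in>S. M \<subseteq> X \<longrightarrow> X = M" ..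
  have "P M" by (rule step) (use M in \<open>auto simp: S_def\<close>)
  then show False using M(1) by (simp add: S_def)
qed

lemma (in noetherian_ring) ideal_sequence_stable:
  assumes "\<And>n. ideal (A n) R" and "\<And>n. A n \<subseteq> A (Suc n)"
  obtains n where "\<And>k. n \<le> k \<Longrightarrow> A k = A n"
proof -
  have mono: "A i \<subseteq> A j" if "i \<le> j" for i j :: nat
    using lift_Suc_mono_le[of A, OF assms(2) that] .
  then have "A i \<subseteq> A j \<or> A j \<subseteq> A i" for i j using mono[of i j] mono[of j i] by linarith
  then have "subset.chain {I. ideal I R} (range A)" using assms(1) by (auto simp: subset_chain_def)
  then have "\<Union>(range A) \<in> range A" by (intro ideal_chain_is_trivial) simp_all
  then obtain n where n: "\<Union>(range A) = A n" by blast
  have "A k = A n" if "n \<le> k" for k using mono[OF that] n by blast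
  then show ?thesis by (rule that)
qed

section \<open>Powers of ideals and the radical\<close>

definition ideal_pow :: "('a, 'r) ring_scheme \<Rightarrow> 'a set \<Rightarrow> nat \<Rightarrow> 'a set" where
  "ideal_pow R I n = I [^]\<^bsub>ideals_set R\<^esub> n"

context cring
begin

lemma ideal_pow_0 [simp]: "ideal_pow R I 0 = carrier R"
  by (simp add: ideal_pow_def ideals_set_def)

lemma ideal_pow_Suc: "ideal_pow R I (Suc n) = ideal_prod R (ideal_pow R I n) I"
  by (simp add: ideal_pow_def ideals_set_def)

lemma ideal_ideal_pow: "ideal I R \<Longrightarrow> ideal (ideal_pow R I n) R"
  by (induction n) (simp_all only: ideal_pow_0 ideal_pow_Suc oneideal ideal_prod_is_ideal)

lemma ideal_pow_decreasing:
  assumes "ideal I R" "m \<le> n" shows "ideal_pow R I n \<subseteq> ideal_pow R I m"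
proof -
  have "ideal_pow R I (Suc k) \<subseteq> ideal_pow R I k" for k
    unfolding ideal_pow_Suc using ideal_prod_inter[OF ideal_ideal_pow[OF assms(1)] assms(1)] by blast
  then show ?thesis using assms(2) by (rule lift_Suc_antimono_le)
qed

lemma ideal_pow_add:
  assumes "ideal I R" shows "ideal_pow R I (m + n) = ideal_prod R (ideal_pow R I m) (ideal_pow R I n)"
proof -
  interpret comm_monoid "ideals_set R" by (rule ideals_set_is_comm_monoid)
  show ?thesis using nat_pow_mult[of I m n] assms by (simp add: ideal_pow_def ideals_set_def)
qed

lemma ideal_pow_1: "ideal I R \<Longrightarrow> ideal_pow R I (Suc 0) = I"
  using ideal_pow_Suc[of I 0] ideal_prod_commute[OF oneideal] ideal_prod_one
  by (simp only: ideal_pow_0)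

lemma ideal_prod_subset:
  assumes "ideal J R" and "\<And>a b. a \<in> I \<Longrightarrow> b \<in> I' \<Longrightarrow> a \<otimes> b \<in> J"
  shows "ideal_prod R I I' \<subseteq> J"
proof
  fix s assume "s \<in> ideal_prod R I I'"
  then show "s \<in> J"
    by induction (use assms in \<open>auto intro: additive_subgroup.a_closed ideal.axioms(1)\<close>)
qed

lemma mem_ideal_add_PIdl:
  "x \<in> J <+>\<^bsub>R\<^esub> PIdl a \<longleftrightarrow> (\<exists>j\<in>J. \<exists>r\<in>carrier R. x = j \<oplus> r \<otimes> a)"
  by (auto simp: set_add_def' cgenideal_def)

lemma ideal_add_PIdl:
  assumes "ideal J R" "a \<in> carrier R"
  shows "ideal (J <+>\<^bsub>R\<^esub> PIdl a) R" "J \<subseteq> J <+>\<^bsub>R\<^esub> PIdl a" "a \<in> J <+>\<^bsub>R\<^esub> PIdl a"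
proof -
  interpret J: ideal J R by fact
  show "ideal (J <+>\<^bsub>R\<^esub> PIdl a) R" using assms by (simp add: add_ideals cgenideal_ideal)
  show "J \<subseteq> J <+>\<^bsub>R\<^esub> PIdl a"
  proof
    fix j assume "j \<in> J"
    then show "j \<in> J <+>\<^bsub>R\<^esub> PIdl a"
      unfolding mem_ideal_add_PIdl using assms J.Icarr by (intro bexI[of _ j] bexI[of _ \<zero>]) auto
  qed
  show "a \<in> J <+>\<^bsub>R\<^esub> PIdl a"
    unfolding mem_ideal_add_PIdl using assms by (intro bexI[of _ \<zero>] bexI[of _ \<one>]) auto
qed

end

text \<open>If \<open>J\<close> is proper and not prime, it contains the product of the strictly
  larger ideals J + (a) and J + (b), so the powers found for these combine to one for
  \<open>J\<close>. The condition on primes says that \<open>I\<close> lies in the radical of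
  \<open>J\<close>.\<close>

lemma (in cring) ideal_pow_subset_of_primes:
  assumes "noetherian_ring R" and I: "ideal I R" and "ideal J R"
    and "\<And>q. primeideal q R \<Longrightarrow> J \<subseteq> q \<Longrightarrow> I \<subseteq> q"
  shows "\<exists>n. ideal_pow R I n \<subseteq> J"
proof -
  interpret noetherian_ring R by fact
  show ?thesis using assms(3,4)
  proof (induction J rule: noetherian_induct)
    case (step J)
    interpret J: ideal J R by fact
    consider "J = carrier R" | "primeideal J R" | "J \<noteq> carrier R" "\<not> primeideal J R" by blast
    then show ?case
    proof cases
      case 1 then show ?thesis by (metis ideal_pow_0 order_refl)
    next
      case 2
      then have "I \<subseteq> J" using step by blast
      then show ?thesis using ideal_pow_1[OF I] by metis
    next
      case 3
      then obtain a b where ab: "a \<in> carrier R" "b \<in> carrier R" "a \<otimes> b \<in> J" "a \<notin> J" "b \<notin> J"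
        by (metis J.ideal_axioms is_cring primeidealI)
      let ?A = "J <+>\<^bsub>R\<^esub> PIdl a" and ?B = "J <+>\<^bsub>R\<^esub> PIdl b"
      have s: "ideal ?A R" "J \<subset> ?A" "ideal ?B R" "J \<subset> ?B"
        using ideal_add_PIdl[OF step(1)] ab by auto
      have "I \<subseteq> q" if "primeideal q R" "?A \<subseteq> q \<or> ?B \<subseteq> q" for q
        using step(3)[OF that(1)] that(2) s by blast
      then have "\<exists>n. ideal_pow R I n \<subseteq> ?A" "\<exists>n. ideal_pow R I n \<subseteq> ?B"
        using step(2)[OF s(1,2)] step(2)[OF s(3,4)] by simp_all
      then obtain k l where kl: "ideal_pow R I k \<subseteq> ?A" "ideal_pow R I l \<subseteq> ?B" by blast
      have "c \<otimes> d \<in> J" if cd: "c \<in> ideal_pow R I k" "d \<in> ideal_pow R I l" for c d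
      proof -
        obtain j r where c: "j \<in> J" "r \<in> carrier R" "c = j \<oplus> r \<otimes> a" using cd kl mem_ideal_add_PIdl by blast
        obtain i t where d: "i \<in> J" "t \<in> carrier R" "d = i \<oplus> t \<otimes> b" using cd kl mem_ideal_add_PIdl by blast
        have ji: "j \<in> carrier R" "i \<in> carrier R" using c d by auto
        have "c \<otimes> d = j \<otimes> d \<oplus> ((r \<otimes> a) \<otimes> i \<oplus> (r \<otimes> t) \<otimes> (a \<otimes> b))"
          using c(2,3) d(2,3) ji ab(1,2) by simp algebra
        moreover have "d \<in> carrier R" using d ji ab by simp
        ultimately show ?thesis using c d ab ji by (simp add: J.I_l_closed J.I_r_closed)
      qed
      then show ?thesis using ideal_pow_add[OF I] ideal_prod_subset[OF J.ideal_axioms] by metis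
    qed
  qed
qed

section \<open>Proper ideals and units of a local ring\<close>

lemma local_noetherian_ring_prime:
  assumes "local_noetherian_ring R \<mm>" shows "primeideal \<mm> R"
  using assms cring.maximalideal_prime by (auto simp: local_noetherian_ring_def)

text \<open>A proper ideal that is not maximal lies strictly inside another proper ideal, to which
  noetherian induction applies.\<close>

lemma local_noetherian_ring_proper:
  assumes "local_noetherian_ring R \<mm>" and "ideal I R" and "I \<noteq> carrier R"
  shows "I \<subseteq> \<mm>"
proof -
  interpret cring R using assms by (simp add: local_noetherian_ring_def)
  interpret noetherian_ring R using assms by (simp add: local_noetherian_ring_def)
  show ?thesis using assms(2,3)
  proof (induction I rule: noetherian_induct)
    case (step I)
    interpret I: ideal I R by fact
    show ?case
    proof (cases "maximalideal I R")
      case True then show ?thesis using assms(1) by (auto simp: local_noetherian_ring_def)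
    next
      case False
      then obtain J where "ideal J R" "I \<subset> J" "J \<noteq> carrier R"
        using maximalidealI[OF step(1)] step(3) by blast
      then show ?thesis using step(2) by blast
    qed
  qed
qed

lemma local_noetherian_ring_unit:
  assumes "local_noetherian_ring R \<mm>" and a: "a \<in> carrier R" "a \<notin> \<mm>"
  obtains b where "b \<in> carrier R" "b \<otimes>\<^bsub>R\<^esub> a = \<one>\<^bsub>R\<^esub>"
proof -
  interpret cring R using assms by (simp add: local_noetherian_ring_def)
  have "PIdl\<^bsub>R\<^esub> a = carrier R"
    using local_noetherian_ring_proper[OF assms(1) cgenideal_ideal[OF a(1)]] a cgenideal_self by blast
  then have "\<one>\<^bsub>R\<^esub> \<in> PIdl\<^bsub>R\<^esub> a" by simp
  then show ?thesis using that by (auto simp: cgenideal_def)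
qed

section \<open>Linear maps and injective modules\<close>

lemma (in module) submoduleI2:
  assumes "H \<subseteq> carrier M" and "\<zero>\<^bsub>M\<^esub> \<in> H"
    and "\<And>x y. x \<in> H \<Longrightarrow> y \<in> H \<Longrightarrow> x \<oplus>\<^bsub>M\<^esub> y \<in> H"
    and "\<And>r x. r \<in> carrier R \<Longrightarrow> x \<in> H \<Longrightarrow> r \<odot>\<^bsub>M\<^esub> x \<in> H"
  shows "submodule H R M"
proof (rule submoduleI)
  fix x assume "x \<in> H"
  moreover have "\<ominus>\<^bsub>M\<^esub> x = (\<ominus>\<^bsub>R\<^esub> \<one>\<^bsub>R\<^esub>) \<odot>\<^bsub>M\<^esub> x" using calculation assms(1) by (subst smult_l_minus) auto
  ultimately show "\<ominus>\<^bsub>M\<^esub> x \<in> H" using assms(4) by simp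
qed (use assms in auto)

lemma (in module) submoduleD:
  assumes "submodule H R M"
  shows submodule_carrier: "x \<in> H \<Longrightarrow> x \<in> carrier M"
    and submodule_zero: "\<zero>\<^bsub>M\<^esub> \<in> H"
    and submodule_add: "x \<in> H \<Longrightarrow> y \<in> H \<Longrightarrow> x \<oplus>\<^bsub>M\<^esub> y \<in> H"
    and submodule_smult: "r \<in> carrier R \<Longrightarrow> x \<in> H \<Longrightarrow> r \<odot>\<^bsub>M\<^esub> x \<in> H"
    and submodule_minus: "x \<in> H \<Longrightarrow> y \<in> H \<Longrightarrow> x \<ominus>\<^bsub>M\<^esub> y \<in> H"
proof -
  note * = submoduleE[OF assms]
  show 0: "x \<in> H \<Longrightarrow> x \<in> carrier M" for x using *(1) by auto
  obtain h where "h \<in> H" using *(2) by auto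
  then show "\<zero>\<^bsub>M\<^esub> \<in> H" using *(4)[of "\<zero>\<^bsub>R\<^esub>" h] 0 by simp
qed (use submoduleE[OF assms] in \<open>auto simp: M.minus_eq\<close>)

lemma (in abelian_group) minus_eq_zero:
  assumes "x \<in> carrier G" "y \<in> carrier G" shows "x \<ominus> y = \<zero> \<longleftrightarrow> x = y"
  using assms by (metis a_minus_def add.inv_closed add.inv_equality local.minus_minus r_neg)

lemma (in module) smult_r_diff:
  "a \<in> carrier R \<Longrightarrow> x \<in> carrier M \<Longrightarrow> y \<in> carrier M \<Longrightarrow>
    a \<odot>\<^bsub>M\<^esub> (x \<ominus>\<^bsub>M\<^esub> y) = a \<odot>\<^bsub>M\<^esub> x \<ominus>\<^bsub>M\<^esub> a \<odot>\<^bsub>M\<^esub> y"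
  by (simp add: M.minus_eq smult_r_distr smult_r_minus)

lemma (in module) smult_l_diff:
  "a \<in> carrier R \<Longrightarrow> b \<in> carrier R \<Longrightarrow> x \<in> carrier M \<Longrightarrow>
    (a \<ominus>\<^bsub>R\<^esub> b) \<odot>\<^bsub>M\<^esub> x = a \<odot>\<^bsub>M\<^esub> x \<ominus>\<^bsub>M\<^esub> b \<odot>\<^bsub>M\<^esub> x"
  by (simp add: M.minus_eq R.minus_eq smult_l_distr smult_l_minus)

lemma (in module) smult_swap:
  "a \<in> carrier R \<Longrightarrow> b \<in> carrier R \<Longrightarrow> x \<in> carrier M \<Longrightarrow>
    a \<odot>\<^bsub>M\<^esub> (b \<odot>\<^bsub>M\<^esub> x) = b \<odot>\<^bsub>M\<^esub> (a \<odot>\<^bsub>M\<^esub> x)"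
  by (simp flip: smult_assoc1 add: R.m_comm)

lemma (in module) ideal_annihilator:
  assumes "U \<subseteq> carrier M" shows "ideal {r \<in> carrier R. \<forall>x\<in>U. r \<odot>\<^bsub>M\<^esub> x = \<zero>\<^bsub>M\<^esub>} R"
proof -
  let ?A = "{r \<in> carrier R. \<forall>x\<in>U. r \<odot>\<^bsub>M\<^esub> x = \<zero>\<^bsub>M\<^esub>}"
  have ann: "r \<otimes> a \<in> ?A" if "r \<in> carrier R" "a \<in> ?A" for r a
    using that assms by (auto simp: smult_assoc1)
  have ann': "a \<otimes> r \<in> ?A" if "r \<in> carrier R" "a \<in> ?A" for r a
    using ann[OF that] m_comm[of a r] that by simp
  show ?thesis
  proof (rule idealI[OF ring_axioms _ ann ann'])
    show "subgroup ?A (add_monoid R)"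
    proof (rule R.add.subgroupI)
      show "?A \<noteq> {}" using assms by (auto intro!: exI[of _ "\<zero>\<^bsub>R\<^esub>"])
      show "\<ominus> a \<in> ?A" if "a \<in> ?A" for a
        using ann[of "\<ominus> \<one>" a] that by (simp add: l_minus)
    qed (use assms in \<open>auto simp: smult_l_distr\<close>)
  qed
qed

text \<open>Unlike \<open>linear_maps\<close>, no default value outside the carrier is demanded, so
  that lambda terms and restrictions of maps to submodules qualify as they stand.\<close>

definition linear_map ::
  "('a, 'r) ring_scheme \<Rightarrow> ('a, 'b, 'm) module_scheme \<Rightarrow> ('a, 'c, 'n) module_scheme \<Rightarrow> ('b \<Rightarrow> 'c) \<Rightarrow> bool"
  where
  "linear_map R M N f \<longleftrightarrow> (\<forall>x\<in>carrier M. f x \<in> carrier N) \<and>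
     (\<forall>x\<in>carrier M. \<forall>y\<in>carrier M. f (x \<oplus>\<^bsub>M\<^esub> y) = f x \<oplus>\<^bsub>N\<^esub> f y) \<and>
     (\<forall>r\<in>carrier R. \<forall>x\<in>carrier M. f (r \<odot>\<^bsub>M\<^esub> x) = r \<odot>\<^bsub>N\<^esub> f x)"

lemma linear_mapD:
  assumes "linear_map R M N f"
  shows linear_map_closed: "x \<in> carrier M \<Longrightarrow> f x \<in> carrier N"
    and linear_map_add: "x \<in> carrier M \<Longrightarrow> y \<in> carrier M \<Longrightarrow> f (x \<oplus>\<^bsub>M\<^esub> y) = f x \<oplus>\<^bsub>N\<^esub> f y"
    and linear_map_smult: "r \<in> carrier R \<Longrightarrow> x \<in> carrier M \<Longrightarrow> f (r \<odot>\<^bsub>M\<^esub> x) = r \<odot>\<^bsub>N\<^esub> f x"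
  using assms by (auto simp: linear_map_def)

lemma linear_map_restrict:
  "linear_map R M N f \<Longrightarrow> module R M \<Longrightarrow> restrict f (carrier M) \<in> linear_maps R M N"
  using module.smult_closed abelian_monoid.a_closed[OF abelian_group.axioms(1)[OF module.axioms(2)]]
  by (fastforce simp: linear_map_def linear_maps_def)

lemma linear_maps_imp_linear_map: "f \<in> linear_maps R M N \<Longrightarrow> linear_map R M N f"
  by (auto simp: linear_map_def linear_maps_def)

lemma linear_map_zero:
  assumes "linear_map R M N f" "module R M" "module R N"
  shows "f \<zero>\<^bsub>M\<^esub> = \<zero>\<^bsub>N\<^esub>"
proof -
  interpret M: module R M by fact
  interpret N: module R N by fact
  show ?thesis
    using linear_map_smult[OF assms(1), of "\<zero>\<^bsub>R\<^esub>" "\<zero>\<^bsub>M\<^esub>"] linear_map_closed[OF assms(1), of "\<zero>\<^bsub>M\<^esub>"] by simp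
qed

lemma linear_map_diff:
  assumes "linear_map R M N f" "module R M" "module R N" "x \<in> carrier M" "y \<in> carrier M"
  shows "f (x \<ominus>\<^bsub>M\<^esub> y) = f x \<ominus>\<^bsub>N\<^esub> f y"
proof -
  interpret M: module R M by fact
  interpret N: module R N by fact
  have "f (\<ominus>\<^bsub>M\<^esub> y) = f ((\<ominus>\<^bsub>R\<^esub> \<one>\<^bsub>R\<^esub>) \<odot>\<^bsub>M\<^esub> y)" using assms by (subst M.smult_l_minus) auto
  also have "\<dots> = (\<ominus>\<^bsub>R\<^esub> \<one>\<^bsub>R\<^esub>) \<odot>\<^bsub>N\<^esub> f y" using assms by (simp add: linear_map_smult)
  also have "\<dots> = \<ominus>\<^bsub>N\<^esub> f y" using assms linear_map_closed[OF assms(1)] by (subst N.smult_l_minus) auto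
  finally show ?thesis using assms by (simp add: M.minus_eq N.minus_eq linear_map_add[OF assms(1)])
qed

lemma linear_map_smult_map:
  assumes "linear_map R M N f" "module R N" "a \<in> carrier R"
  shows "linear_map R M N (\<lambda>x. a \<odot>\<^bsub>N\<^esub> f x)"
proof -
  interpret N: module R N by fact
  show ?thesis using assms by (auto simp: linear_map_def N.smult_r_distr N.smult_swap)
qed

lemma linear_map_diff_map:
  assumes "linear_map R M N f" "linear_map R M N g" "module R N"
  shows "linear_map R M N (\<lambda>x. f x \<ominus>\<^bsub>N\<^esub> g x)"
proof -
  interpret N: module R N by fact
  show ?thesis using assms by (auto simp: linear_map_def N.minus_eq N.smult_r_distr N.M.minus_add N.M.a_ac N.smult_r_minus)
qed

lemma submodule_image:
  assumes "linear_map R M N f" "module R M" "module R N"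
  shows "submodule (f ` carrier M) R N"
proof -
  interpret M: module R M by fact
  interpret N: module R N by fact
  show ?thesis
  proof (rule N.submoduleI2)
    show "\<zero>\<^bsub>N\<^esub> \<in> f ` carrier M" using linear_map_zero[OF assms] by (metis M.zero_closed imageI)
    show "x \<oplus>\<^bsub>N\<^esub> y \<in> f ` carrier M" if "x \<in> f ` carrier M" "y \<in> f ` carrier M" for x y
      using that by (auto simp flip: linear_map_add[OF assms(1)])
    show "r \<odot>\<^bsub>N\<^esub> x \<in> f ` carrier M" if "r \<in> carrier R" "x \<in> f ` carrier M" for r x
      using that by (auto simp flip: linear_map_smult[OF assms(1)])
  qed (use linear_map_closed[OF assms(1)] in auto)
qed

text \<open>Maps such as u + r y \<mapsto> r e are most easily given by their graph. Since
  \<open>G\<close> is closed under the operations, the difference of two values at one point is a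
  value at zero, so single-valuedness has to be tested over zero only.\<close>

lemma injective_extend_graph:
  fixes R :: "('a, 'r) ring_scheme" and E :: "('a, 'e, 'k) module_scheme" and N :: "('a, 'c, 'n) module_scheme"
  assumes E: "injective_module R E" and N: "module R N"
    and G: "G \<subseteq> carrier N \<times> carrier E" "(\<zero>\<^bsub>N\<^esub>, \<zero>\<^bsub>E\<^esub>) \<in> G"
    and add: "\<And>x y x' y'. (x, y) \<in> G \<Longrightarrow> (x', y') \<in> G \<Longrightarrow> (x \<oplus>\<^bsub>N\<^esub> x', y \<oplus>\<^bsub>E\<^esub> y') \<in> G"
    and sm: "\<And>r x y. r \<in> carrier R \<Longrightarrow> (x, y) \<in> G \<Longrightarrow> (r \<odot>\<^bsub>N\<^esub> x, r \<odot>\<^bsub>E\<^esub> y) \<in> G"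
    and single: "\<And>y. (\<zero>\<^bsub>N\<^esub>, y) \<in> G \<Longrightarrow> y = \<zero>\<^bsub>E\<^esub>"
  obtains g where "linear_map R N E g" "\<And>x y. (x, y) \<in> G \<Longrightarrow> g x = y"
proof -
  interpret E: module R E using E by (simp add: injective_module_def)
  interpret N: module R N by fact
  have c: "x \<in> carrier N" "y \<in> carrier E" if "(x, y) \<in> G" for x y using G that by auto
  have fn: "y = y'" if "(x, y) \<in> G" "(x, y') \<in> G" for x y y'
  proof -
    have "(x \<oplus>\<^bsub>N\<^esub> (\<ominus>\<^bsub>R\<^esub> \<one>\<^bsub>R\<^esub>) \<odot>\<^bsub>N\<^esub> x, y \<oplus>\<^bsub>E\<^esub> (\<ominus>\<^bsub>R\<^esub> \<one>\<^bsub>R\<^esub>) \<odot>\<^bsub>E\<^esub> y') \<in> G" using that by (intro add sm) auto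
    then have "y \<ominus>\<^bsub>E\<^esub> y' = \<zero>\<^bsub>E\<^esub>"
      using c[OF that(1)] c[OF that(2)]
      by (simp add: N.smult_l_minus E.smult_l_minus N.M.r_neg E.M.minus_eq single)
    then show ?thesis using c[OF that(1)] c[OF that(2)] by (simp add: E.M.minus_eq_zero)
  qed
  define U where "U = fst ` G"
  define f where "f = (\<lambda>x\<in>U. THE y. (x, y) \<in> G)"
  have UI: "x \<in> U" if "(x, y) \<in> G" for x y using that imageI[of "(x, y)" G fst] by (simp add: U_def)
  have f: "f x = y" if "(x, y) \<in> G" for x y using that fn UI by (auto simp: f_def)
  have fG: "(x, f x) \<in> G" if "x \<in> U" for x using that f by (auto simp: U_def)
  have "submodule U R N"
  proof (rule N.submoduleI2)
    show "\<zero>\<^bsub>N\<^esub> \<in> U" using G(2) by (rule UI)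
    show "x \<oplus>\<^bsub>N\<^esub> y \<in> U" if "x \<in> U" "y \<in> U" for x y using add[OF fG[OF that(1)] fG[OF that(2)]] by (rule UI)
    show "r \<odot>\<^bsub>N\<^esub> x \<in> U" if "r \<in> carrier R" "x \<in> U" for r x using sm[OF that(1) fG[OF that(2)]] by (rule UI)
  qed (use c in \<open>auto simp: U_def\<close>)
  then have U: "module R (N\<lparr>carrier := U\<rparr>)" by (rule submodule.submodule_is_module) (rule N)
  have Uc: "x \<in> carrier N" if "x \<in> U" for x using that c by (auto simp: U_def)
  have "linear_map R (N\<lparr>carrier := U\<rparr>) N (\<lambda>x. x)" using Uc by (auto simp: linear_map_def)
  then have i: "restrict (\<lambda>x. x) U \<in> linear_maps R (N\<lparr>carrier := U\<rparr>) N"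
    using linear_map_restrict[OF _ U] by simp
  have "linear_map R (N\<lparr>carrier := U\<rparr>) E f"
    using f[OF add[OF fG fG]] f[OF sm[OF _ fG]] c[OF fG] by (auto simp: linear_map_def)
  then have "restrict f U \<in> linear_maps R (N\<lparr>carrier := U\<rparr>) E"
    using linear_map_restrict[OF _ U] by simp
  from injective_module_extend[OF E U N i _ this]
  obtain g where g: "g \<in> linear_maps R N E" "\<forall>x\<in>U. g x = f x" by (auto simp: inj_on_def)
  show ?thesis
  proof (rule that)
    show "linear_map R N E g" using g(1) by (rule linear_maps_imp_linear_map)
    show "g x = y" if "(x, y) \<in> G" for x y
    proof -
      have "x \<in> U" using that by (rule UI)
      then show ?thesis using g(2) f[OF that] by simp
    qed
  qed
qed

section \<open>The ring as a module over itself\<close>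

lemma (in cring) ring_as_module: "module R (ring_as_module R)"
  by (intro moduleI abelian_groupI cring_axioms)
    (auto simp: ring_as_module_def a_ac m_assoc l_distr r_distr intro!: bexI[of _ "\<ominus> _"] l_neg)

lemma ring_as_module_simps [simp]:
  "carrier (ring_as_module R) = carrier R" "x \<oplus>\<^bsub>ring_as_module R\<^esub> y = x \<oplus>\<^bsub>R\<^esub> y"
  "\<zero>\<^bsub>ring_as_module R\<^esub> = \<zero>\<^bsub>R\<^esub>" "x \<odot>\<^bsub>ring_as_module R\<^esub> y = x \<otimes>\<^bsub>R\<^esub> y"
  by (auto simp: ring_as_module_def)

lemma (in cring) submodule_ring_as_module:
  assumes "ideal I R" shows "submodule I R (ring_as_module R)"
proof -
  interpret M: module R "ring_as_module R" by (rule ring_as_module)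
  interpret I: ideal I R by fact
  show ?thesis by (rule M.submoduleI2) (auto intro: I.I_l_closed)
qed

section \<open>The injective hull of the residue field\<close>

definition (in module) killed :: "'a set \<Rightarrow> 'c set" where
  "killed I = {x \<in> carrier M. \<forall>a\<in>I. a \<odot>\<^bsub>M\<^esub> x = \<zero>\<^bsub>M\<^esub>}"

lemma (in module) submodule_killed:
  assumes "I \<subseteq> carrier R" shows "submodule (killed I) R M"
proof (rule submoduleI2)
  show "r \<odot>\<^bsub>M\<^esub> x \<in> killed I" if "r \<in> carrier R" "x \<in> killed I" for r x
    using that assms smult_swap[of _ r x] by (auto simp: killed_def)
  show "x \<oplus>\<^bsub>M\<^esub> y \<in> killed I" if "x \<in> killed I" "y \<in> killed I" for x y
    using that assms smult_r_distr[of _ x y] by (auto simp: killed_def)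
qed (use assms in \<open>auto simp: killed_def\<close>)

text \<open>Existence of limits in \<open>R/J\<close> for the \<open>I\<close>-adic topology, expressed by sequences in \<open>R\<close>.\<close>

definition adic_limits :: "('a, 'r) ring_scheme \<Rightarrow> 'a set \<Rightarrow> 'a set \<Rightarrow> bool" where
  "adic_limits R I J \<longleftrightarrow> (\<forall>a.
     (\<forall>n. a n \<in> carrier R \<and> a (Suc n) \<ominus>\<^bsub>R\<^esub> a n \<in> J <+>\<^bsub>R\<^esub> ideal_pow R I n) \<longrightarrow>
     (\<exists>d\<in>carrier R. \<forall>n. a n \<ominus>\<^bsub>R\<^esub> d \<in> J <+>\<^bsub>R\<^esub> ideal_pow R I n))"

lemma (in primeideal) prime_pow:
  assumes "x \<in> carrier R" "x [^] (n::nat) \<in> I" shows "x \<in> I"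
  using assms(2)
proof (induction n)
  case 0
  then show ?case using one_imp_carrier I_notcarr by auto
next
  case (Suc n)
  then show ?case using I_prime[of "x [^] n" x] assms(1) by auto
qed

text \<open>\<open>E\<close> is an injective hull of \<open>R/\<mm>\<close>, and \<open>e0\<close> generates the image of \<open>R/\<mm>\<close>.\<close>

locale residue_hull = module R E for R (structure) and E (structure) +
  fixes \<mm> e0
  assumes local_ring: "local_noetherian_ring R \<mm>"
    and injective: "injective_module R E"
    and e0: "e0 \<in> carrier E" "e0 \<noteq> \<zero>\<^bsub>E\<^esub>" "\<And>a. a \<in> \<mm> \<Longrightarrow> a \<odot>\<^bsub>E\<^esub> e0 = \<zero>\<^bsub>E\<^esub>"
    and essential: "\<And>e. e \<in> carrier E \<Longrightarrow> e \<noteq> \<zero>\<^bsub>E\<^esub> \<Longrightarrow> \<exists>r\<in>carrier R. r \<odot>\<^bsub>E\<^esub> e = e0"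
begin

lemma noetherian: "noetherian_ring R"
  using local_ring by (simp add: local_noetherian_ring_def)

lemma prime_max: "primeideal \<mm> R"
  using local_ring by (rule local_noetherian_ring_prime)

lemma ideal_max: "ideal \<mm> R"
  using prime_max by (simp add: primeideal_def)

lemma max_carrier: "a \<in> \<mm> \<Longrightarrow> a \<in> carrier R"
  using ideal_max ideal.Icarr by metis

lemma ideal_max_pow: "ideal (ideal_pow R \<mm> n) R"
  by (rule ideal_ideal_pow[OF ideal_max])

lemma max_pow_carrier: "a \<in> ideal_pow R \<mm> n \<Longrightarrow> a \<in> carrier R"
  using ideal_max_pow ideal.Icarr by metis

text \<open>A nonzero \<open>e\<close> has \<open>e0\<close> as a multiple; the coefficient cannot
  lie in \<mm>, which kills \<open>e\<close>, so it is a unit and can be moved to the other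
  side.\<close>

lemma socle:
  assumes "e \<in> killed \<mm>"
  shows "\<exists>r\<in>carrier R. e = r \<odot>\<^bsub>E\<^esub> e0"
proof (cases "e = \<zero>\<^bsub>E\<^esub>")
  case True
  then show ?thesis using e0 by (auto intro: bexI[of _ "\<zero>\<^bsub>R\<^esub>"])
next
  case False
  have e: "e \<in> carrier E" "\<And>a. a \<in> \<mm> \<Longrightarrow> a \<odot>\<^bsub>E\<^esub> e = \<zero>\<^bsub>E\<^esub>" using assms by (auto simp: killed_def)
  obtain r where r: "r \<in> carrier R" "r \<odot>\<^bsub>E\<^esub> e = e0" using essential e False by blast
  then have "r \<notin> \<mm>" using e e0 by auto
  then obtain b where b: "b \<in> carrier R" "b \<otimes>\<^bsub>R\<^esub> r = \<one>\<^bsub>R\<^esub>"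
    using local_noetherian_ring_unit[OF local_ring r(1)] by blast
  then have "b \<odot>\<^bsub>E\<^esub> e0 = e" using r e by (simp flip: smult_assoc1 r(2))
  then show ?thesis using b by blast
qed

text \<open>By \<open>ideal_pow_subset_of_primes\<close> it suffices that each x in \<mm> has a
  power in the annihilator of \<open>e\<close>. The annihilators of x^n e increase and become
  stationary. If x^n e were nonzero, it would have \<open>e0\<close> as its multiple by some r, and
  as x kills \<open>e0\<close>, this r would kill x^(n+1) e but not x^n e.\<close>

lemma torsion:
  assumes "e \<in> carrier E"
  shows "\<exists>n. e \<in> killed (ideal_pow R \<mm> n)"
proof -
  interpret noetherian_ring R by (rule noetherian)
  define J where "J = {r \<in> carrier R. \<forall>x\<in>{e}. r \<odot>\<^bsub>E\<^esub> x = \<zero>\<^bsub>E\<^esub>}"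
  have J: "ideal J R" unfolding J_def using assms by (intro ideal_annihilator) simp
  have "\<mm> \<subseteq> q" if q: "primeideal q R" "J \<subseteq> q" for q
  proof
    fix x assume "x \<in> \<mm>"
    then have x: "x \<in> carrier R" by (rule max_carrier)
    define A where "A n = {r \<in> carrier R. \<forall>y\<in>{x [^]\<^bsub>R\<^esub> n \<odot>\<^bsub>E\<^esub> e}. r \<odot>\<^bsub>E\<^esub> y = \<zero>\<^bsub>E\<^esub>}" for n :: nat
    have A: "r \<in> A n \<longleftrightarrow> r \<in> carrier R \<and> r \<odot>\<^bsub>E\<^esub> (x [^]\<^bsub>R\<^esub> n \<odot>\<^bsub>E\<^esub> e) = \<zero>\<^bsub>E\<^esub>" for r n by (simp add: A_def)
    have S: "r \<odot>\<^bsub>E\<^esub> (x [^]\<^bsub>R\<^esub> Suc n \<odot>\<^bsub>E\<^esub> e) = x \<odot>\<^bsub>E\<^esub> (r \<odot>\<^bsub>E\<^esub> (x [^]\<^bsub>R\<^esub> n \<odot>\<^bsub>E\<^esub> e))"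
      if "r \<in> carrier R" for r n
      using that x assms by (simp add: smult_assoc1[symmetric] m_ac)
    have "ideal (A n) R" for n unfolding A_def using assms x by (intro ideal_annihilator) simp
    moreover have "A n \<subseteq> A (Suc n)" for n
      using S x by (auto simp: A simp del: nat_pow_Suc)
    ultimately obtain n where n: "\<And>k. n \<le> k \<Longrightarrow> A k = A n" using ideal_sequence_stable by blast
    have "x [^]\<^bsub>R\<^esub> n \<odot>\<^bsub>E\<^esub> e = \<zero>\<^bsub>E\<^esub>"
    proof (rule ccontr)
      assume "x [^]\<^bsub>R\<^esub> n \<odot>\<^bsub>E\<^esub> e \<noteq> \<zero>\<^bsub>E\<^esub>"
      then obtain r where r: "r \<in> carrier R" "r \<odot>\<^bsub>E\<^esub> (x [^]\<^bsub>R\<^esub> n \<odot>\<^bsub>E\<^esub> e) = e0"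
        using essential[of "x [^]\<^bsub>R\<^esub> n \<odot>\<^bsub>E\<^esub> e"] x assms by auto
      then have "r \<in> A (Suc n)" using S[OF r(1), of n] e0(3) \<open>x \<in> \<mm>\<close> by (simp add: A del: nat_pow_Suc)
      then have "r \<in> A n" using n[of "Suc n"] by simp
      then show False using r e0 by (simp add: A)
    qed
    then have "x [^]\<^bsub>R\<^esub> n \<in> J" using x by (simp add: J_def)
    then show "x \<in> q" using primeideal.prime_pow[OF q(1) x] q(2) by blast
  qed
  then obtain n where "ideal_pow R \<mm> n \<subseteq> J"
    using ideal_pow_subset_of_primes[OF noetherian ideal_max J] by blast
  then show ?thesis using assms by (auto simp: J_def killed_def)
qed

text \<open>The assignment u + r y \<mapsto> r e0 is well defined: if r y lies in \<open>U\<close>,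
  then r is not a unit since y is outside \<open>U\<close>, hence r is in \<mm> and kills
  \<open>e0\<close>. Injectivity extends it to \<open>N\<close>. In other words, \<open>E\<close> is
  a cogenerator.\<close>

lemma separation:
  assumes N: "module R N" and U: "submodule U R N" and y: "y \<in> carrier N" "y \<notin> U"
  obtains h where "linear_map R N E h" "\<And>u. u \<in> U \<Longrightarrow> h u = \<zero>\<^bsub>E\<^esub>" "h y = e0"
proof -
  interpret N: module R N by fact
  note UD = N.submoduleD[OF U]
  define G where "G = {(u \<oplus>\<^bsub>N\<^esub> r \<odot>\<^bsub>N\<^esub> y, r \<odot>\<^bsub>E\<^esub> e0) | u r. u \<in> U \<and> r \<in> carrier R}"
  have GI: "(u \<oplus>\<^bsub>N\<^esub> r \<odot>\<^bsub>N\<^esub> y, r \<odot>\<^bsub>E\<^esub> e0) \<in> G" if "u \<in> U" "r \<in> carrier R" for u r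
    using that by (auto simp: G_def)
  obtain h where h: "linear_map R N E h" "\<And>x y. (x, y) \<in> G \<Longrightarrow> h x = y"
  proof (rule injective_extend_graph[OF injective N, of G])
    show "G \<subseteq> carrier N \<times> carrier E" using UD(1) y e0 by (auto simp: G_def)
    show "(\<zero>\<^bsub>N\<^esub>, \<zero>\<^bsub>E\<^esub>) \<in> G" using GI[OF UD(2) R.zero_closed] y e0 by simp
  next
    fix a b a' b' assume "(a, b) \<in> G" "(a', b') \<in> G"
    then obtain u r u' r' where *: "u \<in> U" "r \<in> carrier R" "u' \<in> U" "r' \<in> carrier R"
      "a = u \<oplus>\<^bsub>N\<^esub> r \<odot>\<^bsub>N\<^esub> y" "b = r \<odot>\<^bsub>E\<^esub> e0" "a' = u' \<oplus>\<^bsub>N\<^esub> r' \<odot>\<^bsub>N\<^esub> y" "b' = r' \<odot>\<^bsub>E\<^esub> e0"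
      by (auto simp: G_def)
    have "a \<oplus>\<^bsub>N\<^esub> a' = (u \<oplus>\<^bsub>N\<^esub> u') \<oplus>\<^bsub>N\<^esub> (r \<oplus>\<^bsub>R\<^esub> r') \<odot>\<^bsub>N\<^esub> y"
      using * UD(1) y by (simp add: N.smult_l_distr N.M.a_ac)
    moreover have "b \<oplus>\<^bsub>E\<^esub> b' = (r \<oplus>\<^bsub>R\<^esub> r') \<odot>\<^bsub>E\<^esub> e0" using * e0 by (simp add: smult_l_distr)
    ultimately show "(a \<oplus>\<^bsub>N\<^esub> a', b \<oplus>\<^bsub>E\<^esub> b') \<in> G" using GI UD(3) * by simp
  next
    fix s a b assume s: "s \<in> carrier R" and "(a, b) \<in> G"
    then obtain u r where *: "u \<in> U" "r \<in> carrier R" "a = u \<oplus>\<^bsub>N\<^esub> r \<odot>\<^bsub>N\<^esub> y" "b = r \<odot>\<^bsub>E\<^esub> e0"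
      by (auto simp: G_def)
    have "s \<odot>\<^bsub>N\<^esub> a = s \<odot>\<^bsub>N\<^esub> u \<oplus>\<^bsub>N\<^esub> (s \<otimes>\<^bsub>R\<^esub> r) \<odot>\<^bsub>N\<^esub> y" "s \<odot>\<^bsub>E\<^esub> b = (s \<otimes>\<^bsub>R\<^esub> r) \<odot>\<^bsub>E\<^esub> e0"
      using * s UD(1) y e0 by (simp_all add: N.smult_r_distr N.smult_assoc1 smult_assoc1)
    then show "(s \<odot>\<^bsub>N\<^esub> a, s \<odot>\<^bsub>E\<^esub> b) \<in> G" using GI UD(4) * s by simp
  next
    fix b assume "(\<zero>\<^bsub>N\<^esub>, b) \<in> G"
    then obtain u r where *: "u \<in> U" "r \<in> carrier R" "\<zero>\<^bsub>N\<^esub> = u \<oplus>\<^bsub>N\<^esub> r \<odot>\<^bsub>N\<^esub> y" "b = r \<odot>\<^bsub>E\<^esub> e0"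
      by (auto simp: G_def)
    have "\<ominus>\<^bsub>N\<^esub> u = r \<odot>\<^bsub>N\<^esub> y"
      using * UD(1) y by (intro N.M.minus_equality) (simp_all add: N.M.a_comm)
    moreover have "\<ominus>\<^bsub>N\<^esub> u \<in> U" using UD(5)[OF UD(2) *(1)] UD(1)[OF *(1)] by (simp add: N.M.minus_eq)
    ultimately have ry: "r \<odot>\<^bsub>N\<^esub> y \<in> U" by simp
    have "r \<in> \<mm>"
    proof (rule ccontr)
      assume "r \<notin> \<mm>"
      then obtain b where b: "b \<in> carrier R" "b \<otimes>\<^bsub>R\<^esub> r = \<one>\<^bsub>R\<^esub>"
        using local_noetherian_ring_unit[OF local_ring *(2)] by blast
      then have "b \<odot>\<^bsub>N\<^esub> (r \<odot>\<^bsub>N\<^esub> y) = y" using * y by (simp flip: N.smult_assoc1)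
      then show False using UD(4)[OF b(1) ry] y by simp
    qed
    then show "b = \<zero>\<^bsub>E\<^esub>" using * e0 by simp
  qed (rule that)
  show ?thesis
  proof (rule that[OF h(1)])
    show "h u = \<zero>\<^bsub>E\<^esub>" if "u \<in> U" for u using h(2)[OF GI[OF that R.zero_closed]] UD(1)[OF that] y e0 by simp
    show "h y = e0" using h(2)[OF GI[OF UD(2) R.one_closed]] y e0 by simp
  qed
qed

text \<open>A map from \<open>R\<close> to \<open>E\<close> that kills \<open>I\<close> and not
  \<open>a\<close> is multiplication into the image of 1, and this image is the required element.
  Consequently an ideal is determined by the elements of \<open>E\<close> that it kills.\<close>

lemma killed_separates:
  assumes "ideal I R" "a \<in> carrier R" "a \<notin> I"
  shows "\<exists>e\<in>killed I. a \<odot>\<^bsub>E\<^esub> e \<noteq> \<zero>\<^bsub>E\<^esub>"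
proof -
  interpret I: ideal I R by fact
  obtain h where h: "linear_map R (ring_as_module R) E h" "\<And>u. u \<in> I \<Longrightarrow> h u = \<zero>\<^bsub>E\<^esub>" "h a = e0"
    using separation[OF ring_as_module submodule_ring_as_module[OF assms(1)]] assms by auto
  have *: "r \<odot>\<^bsub>E\<^esub> h \<one>\<^bsub>R\<^esub> = h r" if "r \<in> carrier R" for r
    using linear_map_smult[OF h(1), of r "\<one>\<^bsub>R\<^esub>"] that by simp
  have "h \<one>\<^bsub>R\<^esub> \<in> carrier E" using linear_map_closed[OF h(1), of "\<one>\<^bsub>R\<^esub>"] by simp
  then have "h \<one>\<^bsub>R\<^esub> \<in> killed I" using * h(2) I.Icarr by (auto simp: killed_def)
  then show ?thesis using * assms(2) h(3) e0 by metis
qed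

text \<open>An element of \<open>E\<close> that separates \<open>a\<close> from \<open>I\<close> is
  killed by some power of \<mm>, so \<open>a\<close> is already outside \<open>I\<close> plus that
  power.\<close>

lemma Krull_intersection:
  assumes I: "ideal I R" and a: "a \<in> carrier R" and "\<And>n. a \<in> I <+>\<^bsub>R\<^esub> ideal_pow R \<mm> n"
  shows "a \<in> I"
proof (rule ccontr)
  assume "a \<notin> I"
  then obtain e where e: "e \<in> killed I" "a \<odot>\<^bsub>E\<^esub> e \<noteq> \<zero>\<^bsub>E\<^esub>" using killed_separates[OF I a] by blast
  have ec: "e \<in> carrier E" using e by (simp add: killed_def)
  obtain n where n: "e \<in> killed (ideal_pow R \<mm> n)" using torsion[OF ec] by blast
  obtain i j where "i \<in> I" "j \<in> ideal_pow R \<mm> n" "a = i \<oplus>\<^bsub>R\<^esub> j"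
    using assms(3)[of n] unfolding set_add_def' by auto
  then have "a \<odot>\<^bsub>E\<^esub> e = \<zero>\<^bsub>E\<^esub>"
    using e(1) n ideal.Icarr[OF I] max_pow_carrier by (auto simp: killed_def smult_l_distr)
  then show False using e by simp
qed

text \<open>Elements of \<open>J\<close> act on \<open>U\<close> as functionals into the socle,
  which is one-dimensional over the residue field, and a functional vanishing on the common kernel
  of finitely many others is a combination of them. The induction splits off \<open>b\<close>: the
  claim on the kernel of \<open>b\<close> gives \<open>c\<close>, and what remains of \<psi>
  vanishes there, hence is a multiple of \<open>b\<close>.\<close>

lemma functional_combination:
  assumes U: "submodule U R E" and J: "ideal J R" and bs: "set bs \<subseteq> J"
    and soc: "\<And>j u. j \<in> J \<Longrightarrow> u \<in> U \<Longrightarrow> j \<odot>\<^bsub>E\<^esub> u \<in> killed \<mm>"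
    and \<psi>: "linear_map R E E \<psi>" "\<And>u. u \<in> U \<Longrightarrow> \<psi> u \<in> killed \<mm>"
    and ker: "\<And>u. u \<in> U \<Longrightarrow> \<forall>b\<in>set bs. b \<odot>\<^bsub>E\<^esub> u = \<zero>\<^bsub>E\<^esub> \<Longrightarrow> \<psi> u = \<zero>\<^bsub>E\<^esub>"
  shows "\<exists>c\<in>J. \<forall>u\<in>U. \<psi> u = c \<odot>\<^bsub>E\<^esub> u"
  using assms
proof (induction bs arbitrary: U)
  case Nil
  interpret J: ideal J R by fact
  show ?case using Nil submoduleD(1)[OF Nil(1)] by (intro bexI[of _ "\<zero>\<^bsub>R\<^esub>"]) auto
next
  case (Cons b bs)
  interpret J: ideal J R by fact
  note UD = submoduleD[OF Cons.prems(1)]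
  have b: "b \<in> J" "b \<in> carrier R" using Cons.prems by auto
  have mc: "\<mm> \<subseteq> carrier R" using max_carrier by blast
  note KD = submoduleD[OF submodule_killed[OF mc]]
  define U' where "U' = {u \<in> U. b \<odot>\<^bsub>E\<^esub> u = \<zero>\<^bsub>E\<^esub>}"
  have "submodule U' R E"
    using UD b by (intro submoduleI2) (auto simp: U'_def smult_r_distr smult_swap[of b])
  then have "\<exists>c\<in>J. \<forall>u\<in>U'. \<psi> u = c \<odot>\<^bsub>E\<^esub> u"
    by (rule Cons.IH) (use Cons.prems in \<open>auto simp: U'_def\<close>)
  then obtain c where c: "c \<in> J" "\<And>u. u \<in> U' \<Longrightarrow> \<psi> u = c \<odot>\<^bsub>E\<^esub> u" by blast
  have cc: "c \<in> carrier R" using c by auto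
  define \<psi>' where "\<psi>' u = \<psi> u \<ominus>\<^bsub>E\<^esub> c \<odot>\<^bsub>E\<^esub> u" for u
  have \<psi>c: "\<psi> u \<in> carrier E" if "u \<in> carrier E" for u using linear_map_closed[OF \<psi>(1) that] .
  have "linear_map R E E (\<lambda>x. c \<odot>\<^bsub>E\<^esub> x)"
    using cc by (simp add: linear_map_def smult_r_distr smult_swap[of c])
  then have lin: "linear_map R E E \<psi>'"
    unfolding \<psi>'_def by (rule linear_map_diff_map[OF \<psi>(1) _ module_axioms])
  have \<psi>'soc: "\<psi>' u \<in> killed \<mm>" if "u \<in> U" for u
    unfolding \<psi>'_def using that Cons.prems(4)[OF c(1)] Cons.prems(6) KD(5) by blast
  have \<psi>'0: "\<psi>' u = \<zero>\<^bsub>E\<^esub>" if "u \<in> U'" for u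
    using c(2)[OF that] that UD(1) cc \<psi>c by (auto simp: \<psi>'_def U'_def M.minus_eq M.r_neg)
  have "\<exists>d\<in>J. \<forall>u\<in>U. \<psi>' u = d \<odot>\<^bsub>E\<^esub> u"
  proof (cases "U' = U")
    case True
    then show ?thesis using \<psi>'0 UD(1) by (intro bexI[of _ "\<zero>\<^bsub>R\<^esub>"]) auto
  next
    case False
    then obtain u1 where "u1 \<in> U" "b \<odot>\<^bsub>E\<^esub> u1 \<noteq> \<zero>\<^bsub>E\<^esub>" by (auto simp: U'_def)
    then obtain s where s: "s \<in> carrier R" "s \<odot>\<^bsub>E\<^esub> (b \<odot>\<^bsub>E\<^esub> u1) = e0"
      using essential[of "b \<odot>\<^bsub>E\<^esub> u1"] b UD(1) by auto
    \<comment> \<open>Normalized so that \<open>b\<close> takes the value \<open>e0\<close> at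
      \<open>u2\<close>. Every u in \<open>U\<close> is then a multiple of \<open>u2\<close> up to
      the kernel \<open>U'\<close>, and the value of \<open>\<psi>'\<close> at \<open>u2\<close> is
      the coefficient of \<open>b\<close>.\<close>
    define u2 where "u2 = s \<odot>\<^bsub>E\<^esub> u1"
    have u2: "u2 \<in> U" "u2 \<in> carrier E" "b \<odot>\<^bsub>E\<^esub> u2 = e0"
      using s \<open>u1 \<in> U\<close> UD(1,4) b smult_swap[of b s u1] by (auto simp: u2_def)
    obtain r where r: "r \<in> carrier R" "\<psi>' u2 = r \<odot>\<^bsub>E\<^esub> e0" using socle[OF \<psi>'soc[OF u2(1)]] by blast
    have "\<psi>' u = (r \<otimes>\<^bsub>R\<^esub> b) \<odot>\<^bsub>E\<^esub> u" if u: "u \<in> U" for u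
    proof -
      have uc: "u \<in> carrier E" using UD(1) u by blast
      obtain t where t: "t \<in> carrier R" "b \<odot>\<^bsub>E\<^esub> u = t \<odot>\<^bsub>E\<^esub> e0"
        using socle[OF Cons.prems(4)[OF b(1) u]] by blast
      have "u \<ominus>\<^bsub>E\<^esub> t \<odot>\<^bsub>E\<^esub> u2 \<in> U'"
        using t u2 uc b UD(5)[OF u UD(4)[OF t(1) u2(1)]] e0(1)
        by (simp add: U'_def smult_r_diff smult_swap[of b t] M.minus_eq_zero)
      then have "\<psi>' (u \<ominus>\<^bsub>E\<^esub> t \<odot>\<^bsub>E\<^esub> u2) = \<zero>\<^bsub>E\<^esub>" by (rule \<psi>'0)
      then have "\<psi>' u \<ominus>\<^bsub>E\<^esub> t \<odot>\<^bsub>E\<^esub> \<psi>' u2 = \<zero>\<^bsub>E\<^esub>"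
        using linear_map_diff[OF lin module_axioms module_axioms uc, of "t \<odot>\<^bsub>E\<^esub> u2"]
          linear_map_smult[OF lin t(1) u2(2)] t u2 by simp
      then have "\<psi>' u = t \<odot>\<^bsub>E\<^esub> \<psi>' u2"
        using M.minus_eq_zero linear_map_closed[OF lin] uc u2 t by simp
      then show ?thesis using t r e0 b uc smult_swap[of t r e0] by (simp add: smult_assoc1)
    qed
    then show ?thesis using r b J.I_l_closed by blast
  qed
  then obtain d where d: "d \<in> J" "\<And>u. u \<in> U \<Longrightarrow> \<psi>' u = d \<odot>\<^bsub>E\<^esub> u" by blast
  have "\<psi> u = (d \<oplus>\<^bsub>R\<^esub> c) \<odot>\<^bsub>E\<^esub> u" if "u \<in> U" for u
  proof -
    have uc: "u \<in> carrier E" using UD(1) that by blast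
    have "\<psi> u = \<psi>' u \<oplus>\<^bsub>E\<^esub> c \<odot>\<^bsub>E\<^esub> u"
      using uc \<psi>c[OF uc] cc by (simp add: \<psi>'_def M.minus_eq M.a_assoc M.l_neg)
    then show ?thesis using d that uc cc by (simp add: smult_l_distr)
  qed
  then show ?case using c(1) d(1) by blast
qed

text \<open>After subtraction of \<open>a\<close> the map vanishes on the elements killed by
  \<mm>^n. So on those killed by \<mm>^(n+1) its values lie in the socle, and it vanishes wherever
  generators of \<mm>^n do. By \<open>functional_combination\<close> it is there a scalar from
  \<mm>^n, which keeps successive scalars coherent.\<close>

lemma endomorphism_step:
  assumes \<phi>: "linear_map R E E \<phi>" and a: "a \<in> carrier R"
    and eq: "\<And>e. e \<in> killed (ideal_pow R \<mm> n) \<Longrightarrow> \<phi> e = a \<odot>\<^bsub>E\<^esub> e"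
  shows "\<exists>b\<in>carrier R. b \<ominus>\<^bsub>R\<^esub> a \<in> ideal_pow R \<mm> n \<and> (\<forall>e\<in>killed (ideal_pow R \<mm> (Suc n)). \<phi> e = b \<odot>\<^bsub>E\<^esub> e)"
proof -
  interpret noetherian_ring R by (rule noetherian)
  obtain B where B: "B \<subseteq> carrier R" "finite B" "ideal_pow R \<mm> n = Idl\<^bsub>R\<^esub> B"
    using finetely_gen[OF ideal_max_pow] by blast
  obtain bs where bs: "set bs = B" using finite_list[OF B(2)] by blast
  define \<psi> where "\<psi> u = \<phi> u \<ominus>\<^bsub>E\<^esub> a \<odot>\<^bsub>E\<^esub> u" for u
  have lina: "linear_map R E E (\<lambda>x. a \<odot>\<^bsub>E\<^esub> x)"
    using a by (simp add: linear_map_def smult_r_distr smult_swap[of a])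
  then have lin: "linear_map R E E \<psi>"
    unfolding \<psi>_def by (rule linear_map_diff_map[OF \<phi> _ module_axioms])
  let ?U = "killed (ideal_pow R \<mm> (Suc n))"
  have U: "submodule ?U R E" using max_pow_carrier by (intro submodule_killed) blast
  have Uc: "u \<in> carrier E" if "u \<in> ?U" for u using that by (simp add: killed_def)
  have down: "x \<odot>\<^bsub>E\<^esub> u \<in> killed (ideal_pow R \<mm> n)" if "u \<in> ?U" "x \<in> \<mm>" for u x
  proof -
    have "j \<odot>\<^bsub>E\<^esub> (x \<odot>\<^bsub>E\<^esub> u) = \<zero>\<^bsub>E\<^esub>" if j: "j \<in> ideal_pow R \<mm> n" for j
    proof -
      have "j \<otimes>\<^bsub>R\<^esub> x \<in> ideal_pow R \<mm> (Suc n)"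
        unfolding ideal_pow_Suc using j \<open>x \<in> \<mm>\<close> by (rule ideal_prod.prod)
      then have "(j \<otimes>\<^bsub>R\<^esub> x) \<odot>\<^bsub>E\<^esub> u = \<zero>\<^bsub>E\<^esub>" using \<open>u \<in> ?U\<close> by (simp add: killed_def)
      then show ?thesis using \<open>u \<in> ?U\<close> max_pow_carrier[OF j] max_carrier[OF \<open>x \<in> \<mm>\<close>] Uc
        by (simp add: smult_assoc1)
    qed
    then show ?thesis
      unfolding killed_def using max_carrier[OF that(2)] Uc[OF that(1)] by simp
  qed
  have zero: "\<psi> e = \<zero>\<^bsub>E\<^esub>" if "e \<in> killed (ideal_pow R \<mm> n)" for e
    using that eq a by (auto simp: killed_def \<psi>_def M.minus_eq M.r_neg)
  have "\<exists>c\<in>ideal_pow R \<mm> n. \<forall>u\<in>?U. \<psi> u = c \<odot>\<^bsub>E\<^esub> u"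
  proof (rule functional_combination[OF U ideal_max_pow _ _ lin])
    show "set bs \<subseteq> ideal_pow R \<mm> n" using bs B genideal_self by blast
    show "j \<odot>\<^bsub>E\<^esub> u \<in> killed \<mm>" if ju: "j \<in> ideal_pow R \<mm> n" "u \<in> ?U" for j u
    proof -
      have "x \<odot>\<^bsub>E\<^esub> (j \<odot>\<^bsub>E\<^esub> u) = \<zero>\<^bsub>E\<^esub>" if "x \<in> \<mm>" for x
      proof -
        have "j \<odot>\<^bsub>E\<^esub> (x \<odot>\<^bsub>E\<^esub> u) = \<zero>\<^bsub>E\<^esub>" using down[OF ju(2) that] ju(1) unfolding killed_def by blast
        then show ?thesis using smult_swap[OF max_carrier[OF that] max_pow_carrier[OF ju(1)] Uc[OF ju(2)]] by simp
      qed
      then show ?thesis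
        unfolding killed_def using max_pow_carrier[OF ju(1)] Uc[OF ju(2)] by simp
    qed
    show "\<psi> u \<in> killed \<mm>" if "u \<in> ?U" for u
    proof -
      have "x \<odot>\<^bsub>E\<^esub> \<psi> u = \<zero>\<^bsub>E\<^esub>" if "x \<in> \<mm>" for x
        using zero[OF down[OF \<open>u \<in> ?U\<close> that]] linear_map_smult[OF lin max_carrier[OF that] Uc[OF \<open>u \<in> ?U\<close>]] by simp
      then show ?thesis unfolding killed_def using linear_map_closed[OF lin Uc[OF that]] by simp
    qed
    show "\<psi> u = \<zero>\<^bsub>E\<^esub>" if u: "u \<in> ?U" "\<forall>b\<in>set bs. b \<odot>\<^bsub>E\<^esub> u = \<zero>\<^bsub>E\<^esub>" for u
    proof (rule zero)
      let ?A = "{r \<in> carrier R. \<forall>x\<in>{u}. r \<odot>\<^bsub>E\<^esub> x = \<zero>\<^bsub>E\<^esub>}"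
      have "ideal ?A R" using Uc[OF u(1)] by (intro ideal_annihilator) simp
      then have "ideal_pow R \<mm> n \<subseteq> ?A" unfolding B(3) using u bs B(1) by (intro genideal_minimal) auto
      then show "u \<in> killed (ideal_pow R \<mm> n)" using Uc[OF u(1)] by (auto simp: killed_def)
    qed
  qed
  then obtain c where c: "c \<in> ideal_pow R \<mm> n" "\<And>u. u \<in> ?U \<Longrightarrow> \<psi> u = c \<odot>\<^bsub>E\<^esub> u" by blast
  have cc: "c \<in> carrier R" using max_pow_carrier c(1) .
  show ?thesis
  proof (intro bexI[of _ "c \<oplus>\<^bsub>R\<^esub> a"] conjI ballI)
    show "c \<oplus>\<^bsub>R\<^esub> a \<ominus>\<^bsub>R\<^esub> a \<in> ideal_pow R \<mm> n" using c cc a by (simp add: R.minus_eq R.a_assoc R.r_neg)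
    show "\<phi> u = (c \<oplus>\<^bsub>R\<^esub> a) \<odot>\<^bsub>E\<^esub> u" if "u \<in> ?U" for u
    proof -
      have "\<phi> u = \<psi> u \<oplus>\<^bsub>E\<^esub> a \<odot>\<^bsub>E\<^esub> u"
        using Uc[OF that] linear_map_closed[OF \<phi>] a by (simp add: \<psi>_def M.minus_eq M.a_assoc M.l_neg)
      then show ?thesis using c(2)[OF that] Uc[OF that] cc a by (simp add: smult_l_distr)
    qed
  qed (use cc a in simp)
qed

text \<open>Every element of \<open>E\<close> is killed by a power of \<mm>, so the scalars built
  level by level describe \<phi> completely. On elements killed by \<pp> only their classes modulo
  \<pp> count, and there the limit exists.\<close>

lemma endomorphism_scalar:
  assumes p: "ideal \<pp> R" and lim: "adic_limits R \<mm> \<pp>" and \<phi>: "linear_map R E E \<phi>"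
  shows "\<exists>d\<in>carrier R. \<forall>e\<in>killed \<pp>. \<phi> e = d \<odot>\<^bsub>E\<^esub> e"
proof -
  interpret p: ideal \<pp> R by fact
  have "\<exists>a. \<forall>n. (a n \<in> carrier R \<and> (\<forall>e\<in>killed (ideal_pow R \<mm> n). \<phi> e = a n \<odot>\<^bsub>E\<^esub> e)) \<and>
    a (Suc n) \<ominus>\<^bsub>R\<^esub> a n \<in> ideal_pow R \<mm> n"
  proof (rule dependent_nat_choice)
    \<comment> \<open>Level zero: only 0 is killed by the unit ideal, so any scalar serves as a
      start.\<close>
    have "e = \<zero>\<^bsub>E\<^esub>" if "e \<in> killed (carrier R)" for e
      using that smult_one[of e] by (auto simp: killed_def simp del: smult_one)
    then show "\<exists>x. x \<in> carrier R \<and> (\<forall>e\<in>killed (ideal_pow R \<mm> 0). \<phi> e = x \<odot>\<^bsub>E\<^esub> e)"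
      using linear_map_zero[OF \<phi> module_axioms module_axioms]
      by (intro exI[of _ "\<zero>\<^bsub>R\<^esub>"]) force
    show "\<exists>y. (y \<in> carrier R \<and> (\<forall>e\<in>killed (ideal_pow R \<mm> (Suc n)). \<phi> e = y \<odot>\<^bsub>E\<^esub> e)) \<and> y \<ominus>\<^bsub>R\<^esub> x \<in> ideal_pow R \<mm> n"
      if "x \<in> carrier R \<and> (\<forall>e\<in>killed (ideal_pow R \<mm> n). \<phi> e = x \<odot>\<^bsub>E\<^esub> e)" for x n
      using endomorphism_step[OF \<phi>, of x n] that by blast
  qed
  then obtain a where a: "\<And>n. a n \<in> carrier R" "\<And>n e. e \<in> killed (ideal_pow R \<mm> n) \<Longrightarrow> \<phi> e = a n \<odot>\<^bsub>E\<^esub> e"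
    "\<And>n. a (Suc n) \<ominus>\<^bsub>R\<^esub> a n \<in> ideal_pow R \<mm> n" by blast
  have "a (Suc n) \<ominus>\<^bsub>R\<^esub> a n \<in> \<pp> <+>\<^bsub>R\<^esub> ideal_pow R \<mm> n" for n
    unfolding set_add_def' using a(1,3) by (auto intro!: bexI[of _ "\<zero>\<^bsub>R\<^esub>"] bexI[OF _ a(3)])
  then obtain d where d: "d \<in> carrier R" "\<And>n. a n \<ominus>\<^bsub>R\<^esub> d \<in> \<pp> <+>\<^bsub>R\<^esub> ideal_pow R \<mm> n"
    using lim a(1) unfolding adic_limits_def by blast
  have "\<phi> e = d \<odot>\<^bsub>E\<^esub> e" if e: "e \<in> killed \<pp>" for e
  proof -
    have ec: "e \<in> carrier E" using e by (simp add: killed_def)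
    obtain n where n: "e \<in> killed (ideal_pow R \<mm> n)" using torsion[OF ec] by blast
    obtain i j where ij: "i \<in> \<pp>" "j \<in> ideal_pow R \<mm> n" "a n \<ominus>\<^bsub>R\<^esub> d = i \<oplus>\<^bsub>R\<^esub> j"
      using d(2)[of n] unfolding set_add_def' by auto
    have "a n \<odot>\<^bsub>E\<^esub> e \<ominus>\<^bsub>E\<^esub> d \<odot>\<^bsub>E\<^esub> e = (i \<oplus>\<^bsub>R\<^esub> j) \<odot>\<^bsub>E\<^esub> e" using a d ec ij by (simp flip: smult_l_diff)
    also have "\<dots> = \<zero>\<^bsub>E\<^esub>" using ij e n p.Icarr max_pow_carrier by (simp add: killed_def smult_l_distr)
    finally show ?thesis using a(1) a(2)[OF n] d ec M.minus_eq_zero by simp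
  qed
  then show ?thesis using d(1) by blast
qed

text \<open>The point is that \<open>killed I\<close> has finite length. Instead of measuring it,
  noetherian induction enlarges \<open>I\<close> by some w with \<mm> w inside \<open>I\<close>:
  then w maps \<open>killed I\<close> to the socle, so beyond the elements also killed by w there
  are at most the multiples of a single one.\<close>

lemma killed_subset_chain:
  assumes I: "ideal I R" and t: "ideal_pow R \<mm> t \<subseteq> I"
    and W: "\<And>n. submodule (W n) R E" "\<And>n. W n \<subseteq> W (Suc n)"
    and sub: "killed I \<subseteq> (\<Union>n. W n)"
  shows "\<exists>n. killed I \<subseteq> W n"
proof -
  interpret noetherian_ring R by (rule noetherian)
  have mono: "W i \<subseteq> W j" if "i \<le> j" for i j :: nat
    using lift_Suc_mono_le[of W, OF W(2) that] .
  show ?thesis using I t sub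
  proof (induction I rule: noetherian_induct)
    case (step I)
    interpret I: ideal I R by fact
    show ?case
    proof (cases "I = carrier R")
      case True
      have "e = \<zero>\<^bsub>E\<^esub>" if "e \<in> killed (carrier R)" for e
        using that smult_one[of e] by (auto simp: killed_def simp del: smult_one)
      then have "killed I \<subseteq> W 0" using True submodule_zero[OF W(1)] by auto
      then show ?thesis by blast
    next
      case False
      \<comment> \<open>The least power inside \<open>I\<close> has a predecessor that is not
        inside; this yields w with w \<mm> contained in \<open>I\<close>.\<close>
      define k where "k = (LEAST k. ideal_pow R \<mm> k \<subseteq> I)"
      have k: "ideal_pow R \<mm> k \<subseteq> I" unfolding k_def using step(3) by (rule LeastI)
      then have "k \<noteq> 0" using False I.a_subset by auto
      then obtain l where l: "k = Suc l" using not0_implies_Suc by blast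
      have "\<not> ideal_pow R \<mm> l \<subseteq> I" using not_less_Least[of l "\<lambda>k. ideal_pow R \<mm> k \<subseteq> I"] l by (simp add: k_def)
      then obtain w where w: "w \<in> ideal_pow R \<mm> l" "w \<notin> I" by blast
      have wc: "w \<in> carrier R" using w max_pow_carrier by blast
      have wI: "w \<otimes>\<^bsub>R\<^esub> x \<in> I" if "x \<in> \<mm>" for x
        using ideal_prod.prod[OF w(1) that] k unfolding l ideal_pow_Suc by blast
      let ?I = "I <+>\<^bsub>R\<^esub> PIdl\<^bsub>R\<^esub> w"
      note I' = ideal_add_PIdl[OF step(1) wc]
      have kI: "e \<in> killed ?I \<longleftrightarrow> e \<in> killed I \<and> w \<odot>\<^bsub>E\<^esub> e = \<zero>\<^bsub>E\<^esub>" for e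
      proof
        assume "e \<in> killed ?I" then show "e \<in> killed I \<and> w \<odot>\<^bsub>E\<^esub> e = \<zero>\<^bsub>E\<^esub>" using I' by (auto simp: killed_def)
      next
        assume "e \<in> killed I \<and> w \<odot>\<^bsub>E\<^esub> e = \<zero>\<^bsub>E\<^esub>"
        then show "e \<in> killed ?I" using I.Icarr wc
          by (auto simp: killed_def mem_ideal_add_PIdl smult_l_distr smult_assoc1)
      qed
      have "\<exists>n. killed ?I \<subseteq> W n"
        by (rule step(2)) (use I' w step(3,4) kI in blast)+
      then obtain n1 where n1: "killed ?I \<subseteq> W n1" by blast
      show ?thesis
      proof (cases "killed I \<subseteq> killed ?I")
        case True then show ?thesis using n1 by blast
      next
        case False
        then obtain e where e: "e \<in> killed I" "w \<odot>\<^bsub>E\<^esub> e \<noteq> \<zero>\<^bsub>E\<^esub>" using kI by blast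
        have KD: "submodule (killed I) R E" using I.Icarr by (intro submodule_killed) blast
        note KD = submoduleD[OF KD]
        obtain s where s: "s \<in> carrier R" "s \<odot>\<^bsub>E\<^esub> (w \<odot>\<^bsub>E\<^esub> e) = e0"
          using essential[of "w \<odot>\<^bsub>E\<^esub> e"] e wc KD(1) by auto
        \<comment> \<open>Scaled so that w takes \<open>e1\<close> to \<open>e0\<close>; subtracting
          a multiple of \<open>e1\<close> then moves any element of \<open>killed I\<close> into the
          kernel of w.\<close>
        define e1 where "e1 = s \<odot>\<^bsub>E\<^esub> e"
        have e1: "e1 \<in> killed I" "e1 \<in> carrier E" "w \<odot>\<^bsub>E\<^esub> e1 = e0"
          using e s KD(1,4) wc smult_swap[of w s e] by (auto simp: e1_def)
        obtain n2 where n2: "e1 \<in> W n2" using step(4) e1 by blast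
        define n where "n = max n1 n2"
        have n: "killed ?I \<subseteq> W n" "e1 \<in> W n" using n1 n2 mono[of n1 n] mono[of n2 n] by (auto simp: n_def)
        have "e \<in> W n" if e: "e \<in> killed I" for e
        proof -
          have ec: "e \<in> carrier E" using KD(1) e .
          have "x \<odot>\<^bsub>E\<^esub> (w \<odot>\<^bsub>E\<^esub> e) = \<zero>\<^bsub>E\<^esub>" if "x \<in> \<mm>" for x
            using wI[OF that] e max_carrier[OF that] wc m_comm[of w x] ec
            by (simp add: killed_def smult_assoc1[symmetric])
          then have "w \<odot>\<^bsub>E\<^esub> e \<in> killed \<mm>" using ec wc by (simp add: killed_def)
          then obtain r where r: "r \<in> carrier R" "w \<odot>\<^bsub>E\<^esub> e = r \<odot>\<^bsub>E\<^esub> e0" using socle by blast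
          have "w \<odot>\<^bsub>E\<^esub> (e \<ominus>\<^bsub>E\<^esub> r \<odot>\<^bsub>E\<^esub> e1) = \<zero>\<^bsub>E\<^esub>"
            using r e1 ec wc by (simp add: smult_r_diff smult_swap[of w r] e0 M.minus_eq_zero)
          moreover have "e \<ominus>\<^bsub>E\<^esub> r \<odot>\<^bsub>E\<^esub> e1 \<in> killed I" using KD(4,5) e e1 r by blast
          ultimately have *: "e \<ominus>\<^bsub>E\<^esub> r \<odot>\<^bsub>E\<^esub> e1 \<in> W n" using kI n by blast
          have "e = (e \<ominus>\<^bsub>E\<^esub> r \<odot>\<^bsub>E\<^esub> e1) \<oplus>\<^bsub>E\<^esub> r \<odot>\<^bsub>E\<^esub> e1"
            using ec e1 r by (simp add: M.minus_eq M.a_assoc M.l_neg)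
          then show ?thesis using submodule_add[OF W(1) * submodule_smult[OF W(1) r(1) n(2)]] by simp
        qed
        then show ?thesis by blast
      qed
    qed
  qed
qed

end

section \<open>Maps from the residue field of a prime ideal\<close>

lemma (in cring) pow_mem_ideal_pow:
  assumes "ideal I R" "x \<in> I" shows "x [^] n \<in> ideal_pow R I n"
proof (induction n)
  case (Suc n)
  then show ?case unfolding ideal_pow_Suc nat_pow_Suc using assms(2) by (rule ideal_prod.prod)
qed simp

lemma (in abelian_group) add_minus_cancel:
  assumes "x \<in> carrier G" "y \<in> carrier G" shows "(x \<ominus> y) \<oplus> y = x"
  using assms by (simp add: minus_eq a_assoc l_neg)

text \<open>The assumptions characterize the residue field of \<open>\<pp>\<close> as an \<open>R\<close>-module \<open>K\<close>, with \<open>u\<close> as its unit.\<close>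

locale residue_field_module = residue_hull R E \<mm> e0 + K: module R K
  for R (structure) and E (structure) and \<mm> e0 and K (structure) +
  fixes \<pp> u
  assumes prime: "primeideal \<pp> R" and ne: "\<pp> \<noteq> \<mm>"
    and u: "u \<in> carrier K" "u \<noteq> \<zero>\<^bsub>K\<^esub>"
    and kill: "\<And>a y. a \<in> \<pp> \<Longrightarrow> y \<in> carrier K \<Longrightarrow> a \<odot>\<^bsub>K\<^esub> y = \<zero>\<^bsub>K\<^esub>"
    and fraction: "\<And>y. y \<in> carrier K \<Longrightarrow> \<exists>s\<in>carrier R - \<pp>. \<exists>a\<in>carrier R. s \<odot>\<^bsub>K\<^esub> y = a \<odot>\<^bsub>K\<^esub> u"
    and div: "\<And>s y. s \<in> carrier R - \<pp> \<Longrightarrow> y \<in> carrier K \<Longrightarrow> \<exists>z\<in>carrier K. s \<odot>\<^bsub>K\<^esub> z = y"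
    and inj0: "\<And>s y. s \<in> carrier R - \<pp> \<Longrightarrow> y \<in> carrier K \<Longrightarrow> s \<odot>\<^bsub>K\<^esub> y = \<zero>\<^bsub>K\<^esub> \<Longrightarrow> y = \<zero>\<^bsub>K\<^esub>"
begin

text \<open>\<open>f\<close> spans the vector space of all maps from \<open>K\<close> to \<open>E\<close>; the coefficient \<open>a / s\<close> of \<open>g\<close> appears with its
  denominator cleared.\<close>

definition dual_generator :: "('e \<Rightarrow> 'c) \<Rightarrow> bool" where
  "dual_generator f \<longleftrightarrow> linear_map R K E f \<and> (\<exists>y\<in>carrier K. f y \<noteq> \<zero>\<^bsub>E\<^esub>) \<and>
     (\<forall>g. linear_map R K E g \<longrightarrow> (\<exists>s\<in>carrier R - \<pp>. \<exists>a\<in>carrier R. \<forall>y\<in>carrier K. s \<odot>\<^bsub>E\<^esub> g y = a \<odot>\<^bsub>E\<^esub> f y))"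

lemma p_ideal: "ideal \<pp> R"
  using prime by (simp add: primeideal_def)

lemma p_carrier: "a \<in> \<pp> \<Longrightarrow> a \<in> carrier R"
  using ideal.Icarr[OF p_ideal] .

lemma p_subset_max: "\<pp> \<subseteq> \<mm>"
  using local_noetherian_ring_proper[OF local_ring p_ideal] primeideal.I_notcarr[OF prime] by blast

lemma inj:
  assumes "s \<in> carrier R - \<pp>" "y \<in> carrier K" "z \<in> carrier K" "s \<odot>\<^bsub>K\<^esub> y = s \<odot>\<^bsub>K\<^esub> z" shows "y = z"
proof -
  have "s \<odot>\<^bsub>K\<^esub> (y \<ominus>\<^bsub>K\<^esub> z) = \<zero>\<^bsub>K\<^esub>" using assms by (simp add: K.smult_r_diff K.M.minus_eq_zero)
  then show ?thesis using inj0[OF assms(1), of "y \<ominus>\<^bsub>K\<^esub> z"] assms K.M.minus_eq_zero by simp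
qed

lemma smult_eq_0: "a \<in> carrier R \<Longrightarrow> y \<in> carrier K \<Longrightarrow> y \<noteq> \<zero>\<^bsub>K\<^esub> \<Longrightarrow> a \<odot>\<^bsub>K\<^esub> y = \<zero>\<^bsub>K\<^esub> \<longleftrightarrow> a \<in> \<pp>"
  using inj0 kill by blast

lemma smult_eq:
  assumes "a \<in> carrier R" "b \<in> carrier R" "y \<in> carrier K" "y \<noteq> \<zero>\<^bsub>K\<^esub>"
  shows "a \<odot>\<^bsub>K\<^esub> y = b \<odot>\<^bsub>K\<^esub> y \<longleftrightarrow> a \<ominus>\<^bsub>R\<^esub> b \<in> \<pp>"
  using assms smult_eq_0[of "a \<ominus>\<^bsub>R\<^esub> b" y] by (simp add: K.smult_l_diff K.M.minus_eq_zero)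

lemma notin_p_mult: "s \<in> carrier R - \<pp> \<Longrightarrow> t \<in> carrier R - \<pp> \<Longrightarrow> s \<otimes>\<^bsub>R\<^esub> t \<in> carrier R - \<pp>"
  using primeideal.I_prime[OF prime] by auto

lemma notin_p_pow: "s \<in> carrier R - \<pp> \<Longrightarrow> s [^]\<^bsub>R\<^esub> (n::nat) \<in> carrier R - \<pp>"
  using primeideal.prime_pow[OF prime] by auto

text \<open>The sequence stands for u/x^n. It comes from dependent choice, since \<open>div\<close>
  provides one quotient at a time.\<close>

lemma roots:
  assumes "x \<in> carrier R - \<pp>"
  obtains w where "\<And>n. w n \<in> carrier K" "w 0 = u" "\<And>n. x \<odot>\<^bsub>K\<^esub> w (Suc n) = w n"
    "\<And>n k. x [^]\<^bsub>R\<^esub> k \<odot>\<^bsub>K\<^esub> w (n + k) = w n"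
proof -
  have "\<exists>w. \<forall>n. (w n \<in> carrier K \<and> (n = 0 \<longrightarrow> w n = u)) \<and> x \<odot>\<^bsub>K\<^esub> w (Suc n) = w n"
    by (rule dependent_nat_choice) (use u div[OF assms] in auto)
  then obtain w where w: "\<And>n. w n \<in> carrier K" "w 0 = u" "\<And>n. x \<odot>\<^bsub>K\<^esub> w (Suc n) = w n" by blast
  have "x [^]\<^bsub>R\<^esub> k \<odot>\<^bsub>K\<^esub> w (n + k) = w n" for n k
    by (induction k) (use w assms in \<open>simp_all add: K.smult_assoc1\<close>)
  with w show ?thesis by (rule that)
qed

lemma image_killed:
  assumes "linear_map R K E f" "y \<in> carrier K" shows "f y \<in> killed \<pp>"
  using assms linear_map_smult[OF assms(1), of _ y] kill p_carrier
    linear_map_zero[OF assms(1) K.module_axioms module_axioms] linear_map_closed[OF assms(1)]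
  by (auto simp: killed_def) metis

lemma dual_nonzero: "\<exists>f. linear_map R K E f \<and> f u = e0"
proof -
  have "submodule {\<zero>\<^bsub>K\<^esub>} R K" by (rule K.submoduleI2) auto
  then show ?thesis using separation[OF K.module_axioms, of "{\<zero>\<^bsub>K\<^esub>}" u] u by blast
qed

subsection \<open>One-dimensional complete residue rings\<close>

text \<open>\<open>K\<close> is divisible by everything outside \<pp>: for such a \<open>d\<close>,
  the value of f at \<open>y0\<close> would be \<open>d\<close> times its value at y0/d, hence
  zero.\<close>

lemma kernel_zero_of_scalar:
  assumes f: "linear_map R K E f" "y0 \<in> carrier K" "f y0 \<noteq> \<zero>\<^bsub>E\<^esub>"
    and d: "d \<in> carrier R" "\<And>y. y \<in> carrier K \<Longrightarrow> d \<odot>\<^bsub>E\<^esub> f y = \<zero>\<^bsub>E\<^esub>"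
  shows "d \<in> \<pp>"
proof (rule ccontr)
  assume "d \<notin> \<pp>"
  then obtain z where "z \<in> carrier K" "d \<odot>\<^bsub>K\<^esub> z = y0" using div[of d y0] d f(2) by blast
  then show False using linear_map_smult[OF f(1) d(1)] d(2) f(3) by metis
qed

text \<open>An endomorphism that separates \<open>e\<close> from the image is a scalar on the
  annihilator of \<pp>; a scalar that kills the image lies in \<pp>, hence kills \<open>e\<close> as
  well.\<close>

lemma surjective_of_adic_limits:
  assumes lim: "adic_limits R \<mm> \<pp>" and f: "linear_map R K E f" "y0 \<in> carrier K" "f y0 \<noteq> \<zero>\<^bsub>E\<^esub>"
    and e: "e \<in> killed \<pp>"
  shows "e \<in> f ` carrier K"
proof (rule ccontr)
  assume "e \<notin> f ` carrier K"
  moreover have "e \<in> carrier E" using e by (simp add: killed_def)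
  ultimately obtain \<phi> where \<phi>: "linear_map R E E \<phi>" "\<And>v. v \<in> f ` carrier K \<Longrightarrow> \<phi> v = \<zero>\<^bsub>E\<^esub>" "\<phi> e = e0"
    using separation[OF module_axioms submodule_image[OF f(1) K.module_axioms module_axioms]] by blast
  obtain d where d: "d \<in> carrier R" "\<And>e. e \<in> killed \<pp> \<Longrightarrow> \<phi> e = d \<odot>\<^bsub>E\<^esub> e"
    using endomorphism_scalar[OF p_ideal lim \<phi>(1)] by blast
  have "d \<in> \<pp>" using d \<phi>(2) image_killed[OF f(1)] by (intro kernel_zero_of_scalar[OF f d(1)]) (metis imageI)
  then have "\<phi> e = \<zero>\<^bsub>E\<^esub>" using d(2)[OF e] e by (simp add: killed_def)
  then show False using \<phi>(3) e0 by simp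
qed

lemma dual_generator_of_adic_limits:
  assumes dim: "\<And>q. primeideal q R \<Longrightarrow> \<pp> \<subseteq> q \<Longrightarrow> q = \<pp> \<or> q = \<mm>"
    and lim: "adic_limits R \<mm> \<pp>"
    and f: "linear_map R K E f" "y0 \<in> carrier K" "f y0 \<noteq> \<zero>\<^bsub>E\<^esub>"
  shows "dual_generator f"
proof -
  interpret p: ideal \<pp> R by (rule p_ideal)
  obtain x where x: "x \<in> \<mm>" "x \<notin> \<pp>" using p_subset_max ne by blast
  have xc: "x \<in> carrier R" using x max_carrier by blast
  then have xp: "x \<in> carrier R - \<pp>" using x by simp
  obtain w where w: "\<And>n. w n \<in> carrier K" "w 0 = u" "\<And>n. x \<odot>\<^bsub>K\<^esub> w (Suc n) = w n"
    "\<And>n k. x [^]\<^bsub>R\<^esub> k \<odot>\<^bsub>K\<^esub> w (n + k) = w n" using roots[OF xp] by blast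
  have fK: "f y \<in> carrier E" if "y \<in> carrier K" for y using linear_map_closed[OF f(1) that] .
  have fs: "f (r \<odot>\<^bsub>K\<^esub> y) = r \<odot>\<^bsub>E\<^esub> f y" if "r \<in> carrier R" "y \<in> carrier K" for r y
    using linear_map_smult[OF f(1) that] .
  \<comment> \<open>No prime lies strictly between \<pp> and \<mm>, so \<mm> is the only prime over
    \<pp> + (s).\<close>
  have pow: "\<exists>t. ideal_pow R \<mm> t \<subseteq> \<pp> <+>\<^bsub>R\<^esub> PIdl\<^bsub>R\<^esub> s" if s: "s \<in> carrier R - \<pp>" for s
  proof (rule ideal_pow_subset_of_primes[OF noetherian ideal_max])
    show "ideal (\<pp> <+>\<^bsub>R\<^esub> PIdl\<^bsub>R\<^esub> s) R" using ideal_add_PIdl[OF p_ideal] s by blast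
    show "\<mm> \<subseteq> q" if "primeideal q R" "\<pp> <+>\<^bsub>R\<^esub> PIdl\<^bsub>R\<^esub> s \<subseteq> q" for q
      using ideal_add_PIdl[OF p_ideal, of s] s dim[OF that(1)] that(2) by blast
  qed
  \<comment> \<open>Modulo \<pp> some power of x is a multiple of the denominator s, so every
    fraction can be written with a power of x as denominator.\<close>
  have gen: "\<exists>n. \<exists>r\<in>carrier R. y = r \<odot>\<^bsub>K\<^esub> w n" if y: "y \<in> carrier K" for y
  proof -
    obtain s a where sa: "s \<in> carrier R - \<pp>" "a \<in> carrier R" "s \<odot>\<^bsub>K\<^esub> y = a \<odot>\<^bsub>K\<^esub> u" using fraction[OF y] by blast
    obtain t where t: "ideal_pow R \<mm> t \<subseteq> \<pp> <+>\<^bsub>R\<^esub> PIdl\<^bsub>R\<^esub> s" using pow[OF sa(1)] by blast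
    have "x [^]\<^bsub>R\<^esub> t \<in> \<pp> <+>\<^bsub>R\<^esub> PIdl\<^bsub>R\<^esub> s" using pow_mem_ideal_pow[OF ideal_max x(1)] t by blast
    then obtain i r where ir: "i \<in> \<pp>" "r \<in> carrier R" "x [^]\<^bsub>R\<^esub> t = i \<oplus>\<^bsub>R\<^esub> r \<otimes>\<^bsub>R\<^esub> s"
      unfolding mem_ideal_add_PIdl by blast
    have "x [^]\<^bsub>R\<^esub> t \<odot>\<^bsub>K\<^esub> y = i \<odot>\<^bsub>K\<^esub> y \<oplus>\<^bsub>K\<^esub> r \<odot>\<^bsub>K\<^esub> (s \<odot>\<^bsub>K\<^esub> y)"
      unfolding ir(3) using ir sa y p.Icarr by (simp add: K.smult_l_distr K.smult_assoc1)
    also have "\<dots> = (r \<otimes>\<^bsub>R\<^esub> a) \<odot>\<^bsub>K\<^esub> u" using ir sa y u by (simp add: kill K.smult_assoc1)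
    also have "\<dots> = x [^]\<^bsub>R\<^esub> t \<odot>\<^bsub>K\<^esub> ((r \<otimes>\<^bsub>R\<^esub> a) \<odot>\<^bsub>K\<^esub> w t)"
      using w(4)[of t 0] w(2) ir sa xc w(1) K.smult_swap[of "x [^]\<^bsub>R\<^esub> t" "r \<otimes>\<^bsub>R\<^esub> a" "w t"] by simp
    finally have eq: "x [^]\<^bsub>R\<^esub> t \<odot>\<^bsub>K\<^esub> y = x [^]\<^bsub>R\<^esub> t \<odot>\<^bsub>K\<^esub> ((r \<otimes>\<^bsub>R\<^esub> a) \<odot>\<^bsub>K\<^esub> w t)" .
    have "(r \<otimes>\<^bsub>R\<^esub> a) \<odot>\<^bsub>K\<^esub> w t \<in> carrier K" using ir sa w(1) by simp
    with y have "y = (r \<otimes>\<^bsub>R\<^esub> a) \<odot>\<^bsub>K\<^esub> w t" using eq by (rule inj[OF notin_p_pow[OF xp]])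
    then show ?thesis using ir sa by blast
  qed
  \<comment> \<open>The increasing cyclic submodules generated by f(u/x^n). By \<open>gen\<close>
    and surjectivity they exhaust the annihilator of \<pp>, and \<open>killed_subset_chain\<close>
    will place all elements killed by \<pp> + (x) in one of them.\<close>
  define W where "W n = (\<lambda>r. r \<odot>\<^bsub>E\<^esub> f (w n)) ` carrier R" for n
  have Wsub: "submodule (W n) R E" for n
  proof -
    have "linear_map R (ring_as_module R) E (\<lambda>r. r \<odot>\<^bsub>E\<^esub> f (w n))"
      using fK w(1) by (simp add: linear_map_def smult_l_distr smult_assoc1)
    from submodule_image[OF this ring_as_module module_axioms] show ?thesis by (simp add: W_def)
  qed
  have Winc: "W n \<subseteq> W (Suc n)" for n
  proof
    fix e assume "e \<in> W n"
    then obtain r where r: "r \<in> carrier R" "e = r \<odot>\<^bsub>E\<^esub> f (w n)" by (auto simp: W_def)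
    then have "e = (r \<otimes>\<^bsub>R\<^esub> x) \<odot>\<^bsub>E\<^esub> f (w (Suc n))"
      using fs[OF xc w(1), of "Suc n"] w(1,3) xc fK by (simp add: smult_assoc1)
    then show "e \<in> W (Suc n)" using r xc by (auto simp: W_def)
  qed
  let ?I = "\<pp> <+>\<^bsub>R\<^esub> PIdl\<^bsub>R\<^esub> x"
  have I: "ideal ?I R" "\<pp> \<subseteq> ?I" using ideal_add_PIdl[OF p_ideal xc] by auto
  have cover: "killed ?I \<subseteq> (\<Union>n. W n)"
  proof
    fix e assume "e \<in> killed ?I"
    then have "e \<in> killed \<pp>" using I(2) by (auto simp: killed_def)
    then obtain y where y: "y \<in> carrier K" "e = f y" using surjective_of_adic_limits[OF lim f] by blast
    obtain n r where "r \<in> carrier R" "y = r \<odot>\<^bsub>K\<^esub> w n" using gen[OF y(1)] by blast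
    then have "e \<in> W n" using y fs w(1) by (auto simp: W_def)
    then show "e \<in> (\<Union>n. W n)" by blast
  qed
  obtain t where t: "ideal_pow R \<mm> t \<subseteq> ?I" using pow[OF xp] by blast
  obtain N where N: "killed ?I \<subseteq> W N"
    using killed_subset_chain[OF I(1) t Wsub Winc cover] by blast
  \<comment> \<open>An r killing f(u/x^N) kills \<open>W N\<close>, hence everything killed by
    \<open>?I\<close>; by \<open>killed_separates\<close> it lies in \<open>?I\<close>.\<close>
  have JN: "r \<in> ?I" if r: "r \<in> carrier R" "r \<odot>\<^bsub>E\<^esub> f (w N) = \<zero>\<^bsub>E\<^esub>" for r
  proof (rule ccontr)
    assume "r \<notin> ?I"
    then obtain e where e: "e \<in> killed ?I" "r \<odot>\<^bsub>E\<^esub> e \<noteq> \<zero>\<^bsub>E\<^esub>" using killed_separates[OF I(1) r(1)] by blast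
    then obtain b where "b \<in> carrier R" "e = b \<odot>\<^bsub>E\<^esub> f (w N)" using N by (auto simp: W_def)
    then show False using e r smult_swap[of r b] fK w(1) by simp
  qed
  \<comment> \<open>If r u/x^(N+k) with k > 0 is in the kernel, its numerator kills f(u/x^N). So r
    is a multiple of x modulo \<pp>, and the exponent drops by one.\<close>
  have desc: "\<exists>b\<in>carrier R. y = b \<odot>\<^bsub>K\<^esub> w N" if "r \<in> carrier R" "y = r \<odot>\<^bsub>K\<^esub> w (N + k)" "f y = \<zero>\<^bsub>E\<^esub>" for y r k
    using that
  proof (induction k arbitrary: r)
    case 0 then show ?case by auto
  next
    case (Suc k)
    have "r \<odot>\<^bsub>E\<^esub> f (w N) = r \<odot>\<^bsub>E\<^esub> (x [^]\<^bsub>R\<^esub> Suc k \<odot>\<^bsub>E\<^esub> f (w (N + Suc k)))"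
      using w(4)[of "Suc k" N] fs[of "x [^]\<^bsub>R\<^esub> Suc k" "w (N + Suc k)"] w(1) xc by (simp del: nat_pow_Suc)
    also have "\<dots> = x [^]\<^bsub>R\<^esub> Suc k \<odot>\<^bsub>E\<^esub> f y"
      using fs[OF Suc.prems(1) w(1), of "N + Suc k"] Suc.prems(2) xc fK[OF w(1)]
        smult_swap[OF Suc.prems(1), of "x [^]\<^bsub>R\<^esub> Suc k" "f (w (N + Suc k))"]
      by (simp del: nat_pow_Suc)
    also have "\<dots> = \<zero>\<^bsub>E\<^esub>" using Suc.prems(3) xc by (simp del: nat_pow_Suc)
    finally have "r \<in> ?I" using JN Suc.prems(1) by blast
    then obtain i b where ib: "i \<in> \<pp>" "b \<in> carrier R" "r = i \<oplus>\<^bsub>R\<^esub> b \<otimes>\<^bsub>R\<^esub> x" unfolding mem_ideal_add_PIdl by blast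
    have "y = b \<odot>\<^bsub>K\<^esub> (x \<odot>\<^bsub>K\<^esub> w (N + Suc k))"
      unfolding Suc.prems(2) ib(3) using ib p.Icarr w(1) xc
      by (simp add: K.smult_l_distr K.smult_assoc1 kill)
    then have "y = b \<odot>\<^bsub>K\<^esub> w (N + k)" using w(3)[of "N + k"] by simp
    then show ?case using Suc.IH ib(2) Suc.prems(3) by blast
  qed
  have kernel: "\<exists>b\<in>carrier R. y = b \<odot>\<^bsub>K\<^esub> w N" if y: "y \<in> carrier K" "f y = \<zero>\<^bsub>E\<^esub>" for y
  proof -
    obtain n r where r: "r \<in> carrier R" "y = r \<odot>\<^bsub>K\<^esub> w n" using gen[OF y(1)] by blast
    have "y = (r \<otimes>\<^bsub>R\<^esub> x [^]\<^bsub>R\<^esub> N) \<odot>\<^bsub>K\<^esub> w (n + N)" using r w(1) w(4)[of N n] xc by (simp add: K.smult_assoc1)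
    then have "y = (r \<otimes>\<^bsub>R\<^esub> x [^]\<^bsub>R\<^esub> N) \<odot>\<^bsub>K\<^esub> w (N + n)" by (simp add: add.commute)
    then show ?thesis using desc[OF _ _ y(2)] r xc by blast
  qed
  show ?thesis
    unfolding dual_generator_def
  proof (intro conjI allI impI)
    show "linear_map R K E f" "\<exists>y\<in>carrier K. f y \<noteq> \<zero>\<^bsub>E\<^esub>" using f by blast+
    fix g assume g: "linear_map R K E g"
    have gK: "g y \<in> carrier E" if "y \<in> carrier K" for y using linear_map_closed[OF g that] .
    obtain l where l: "g u \<in> killed (ideal_pow R \<mm> l)" using torsion[OF gK[OF u(1)]] by blast
    then have gl: "x [^]\<^bsub>R\<^esub> l \<odot>\<^bsub>E\<^esub> g u = \<zero>\<^bsub>E\<^esub>"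
      using pow_mem_ideal_pow[OF ideal_max x(1), of l] by (simp add: killed_def)
    \<comment> \<open>The factor x^N carries the kernel of f into multiples of u, and x^l kills g u;
      together they make s g vanish on the kernel of f.\<close>
    define s where "s = x [^]\<^bsub>R\<^esub> l \<otimes>\<^bsub>R\<^esub> x [^]\<^bsub>R\<^esub> N"
    have s: "s \<in> carrier R - \<pp>" unfolding s_def using notin_p_mult notin_p_pow xp by blast
    \<comment> \<open>The graph of f y \<mapsto> s g y. Its extension to \<open>E\<close> is a
      scalar on the image of f by \<open>endomorphism_scalar\<close>.\<close>
    define G where "G = (\<lambda>y. (f y, s \<odot>\<^bsub>E\<^esub> g y)) ` carrier K"
    have GI: "(f y, s \<odot>\<^bsub>E\<^esub> g y) \<in> G" if "y \<in> carrier K" for y using that by (auto simp: G_def)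
    obtain \<phi> where \<phi>: "linear_map R E E \<phi>" "\<And>x y. (x, y) \<in> G \<Longrightarrow> \<phi> x = y"
    proof (rule injective_extend_graph[OF injective module_axioms, of G])
      show "G \<subseteq> carrier E \<times> carrier E" using fK gK s by (auto simp: G_def)
      show "(\<zero>\<^bsub>E\<^esub>, \<zero>\<^bsub>E\<^esub>) \<in> G"
        using GI[of "\<zero>\<^bsub>K\<^esub>"] linear_map_zero[OF f(1) K.module_axioms module_axioms]
          linear_map_zero[OF g K.module_axioms module_axioms] s by simp
    next
      fix a b a' b' assume "(a, b) \<in> G" "(a', b') \<in> G"
      then obtain y y' where *: "y \<in> carrier K" "y' \<in> carrier K" "a = f y" "b = s \<odot>\<^bsub>E\<^esub> g y" "a' = f y'" "b' = s \<odot>\<^bsub>E\<^esub> g y'"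
        by (auto simp: G_def)
      then show "(a \<oplus>\<^bsub>E\<^esub> a', b \<oplus>\<^bsub>E\<^esub> b') \<in> G"
        using GI[of "y \<oplus>\<^bsub>K\<^esub> y'"] s gK by (simp add: linear_map_add[OF f(1)] linear_map_add[OF g] smult_r_distr)
    next
      fix r a b assume r: "r \<in> carrier R" and "(a, b) \<in> G"
      then obtain y where *: "y \<in> carrier K" "a = f y" "b = s \<odot>\<^bsub>E\<^esub> g y" by (auto simp: G_def)
      then show "(r \<odot>\<^bsub>E\<^esub> a, r \<odot>\<^bsub>E\<^esub> b) \<in> G"
        using GI[of "r \<odot>\<^bsub>K\<^esub> y"] s r gK by (simp add: fs linear_map_smult[OF g] smult_swap[of s r])
    next
      fix b assume "(\<zero>\<^bsub>E\<^esub>, b) \<in> G"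
      then obtain y where *: "y \<in> carrier K" "f y = \<zero>\<^bsub>E\<^esub>" "b = s \<odot>\<^bsub>E\<^esub> g y" by (auto simp: G_def)
      obtain r where r: "r \<in> carrier R" "y = r \<odot>\<^bsub>K\<^esub> w N" using kernel[OF *(1,2)] by blast
      have "s \<odot>\<^bsub>K\<^esub> y = x [^]\<^bsub>R\<^esub> l \<odot>\<^bsub>K\<^esub> (r \<odot>\<^bsub>K\<^esub> (x [^]\<^bsub>R\<^esub> N \<odot>\<^bsub>K\<^esub> w N))"
        using r xc w(1) by (simp add: s_def K.smult_assoc1 K.smult_swap[of r])
      also have "\<dots> = r \<odot>\<^bsub>K\<^esub> (x [^]\<^bsub>R\<^esub> l \<odot>\<^bsub>K\<^esub> u)" using w(4)[of N 0] w(2) r xc u by (simp add: K.smult_swap[of r])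
      finally have "g (s \<odot>\<^bsub>K\<^esub> y) = r \<odot>\<^bsub>E\<^esub> (x [^]\<^bsub>R\<^esub> l \<odot>\<^bsub>E\<^esub> g u)"
        using r xc u by (simp add: linear_map_smult[OF g])
      then show "b = \<zero>\<^bsub>E\<^esub>" using gl r s * linear_map_smult[OF g, of s y] by simp
    qed (rule that)
    obtain d where d: "d \<in> carrier R" "\<And>e. e \<in> killed \<pp> \<Longrightarrow> \<phi> e = d \<odot>\<^bsub>E\<^esub> e"
      using endomorphism_scalar[OF p_ideal lim \<phi>(1)] by blast
    have "s \<odot>\<^bsub>E\<^esub> g y = d \<odot>\<^bsub>E\<^esub> f y" if "y \<in> carrier K" for y
      using \<phi>(2)[OF GI[OF that]] d(2)[OF image_killed[OF f(1) that]] by simp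
    then show "\<exists>s\<in>carrier R - \<pp>. \<exists>a\<in>carrier R. \<forall>y\<in>carrier K. s \<odot>\<^bsub>E\<^esub> g y = a \<odot>\<^bsub>E\<^esub> f y" using s d by blast
  qed
qed

end

context residue_field_module
begin

lemma dual_generatorD:
  assumes "dual_generator f"
  shows "linear_map R K E f" and "\<And>y. y \<in> carrier K \<Longrightarrow> f y \<in> carrier E"
    and "\<And>r y. r \<in> carrier R \<Longrightarrow> y \<in> carrier K \<Longrightarrow> f (r \<odot>\<^bsub>K\<^esub> y) = r \<odot>\<^bsub>E\<^esub> f y"
    and "\<And>g. linear_map R K E g \<Longrightarrow> (\<exists>s\<in>carrier R - \<pp>. \<exists>a\<in>carrier R. \<forall>y\<in>carrier K. s \<odot>\<^bsub>E\<^esub> g y = a \<odot>\<^bsub>E\<^esub> f y)"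
  using assms by (auto simp: dual_generator_def linear_mapD)

text \<open>This divides the relation by s: z is y/s, so g is f after multiplication by a/s.\<close>

lemma dual_eq:
  assumes f: "linear_map R K E f" and g: "linear_map R K E g"
    and sa: "s \<in> carrier R - \<pp>" "a \<in> carrier R" "\<And>y. y \<in> carrier K \<Longrightarrow> s \<odot>\<^bsub>E\<^esub> g y = a \<odot>\<^bsub>E\<^esub> f y"
    and z: "z \<in> carrier K" "s \<odot>\<^bsub>K\<^esub> z = y"
  shows "g y = f (a \<odot>\<^bsub>K\<^esub> z)"
  using sa z linear_map_smult[OF f sa(2) z(1)] linear_map_smult[OF g _ z(1), of s] by auto

subsection \<open>Completeness from a generator of the dual\<close>

text \<open>The assignment r u \<mapsto> r e is well defined because \<pp> kills e. An extension g
  to \<open>K\<close> is f composed with multiplication by a fraction, so e = g u is a value of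
  f.\<close>

lemma dual_generator_surj:
  assumes f: "dual_generator f" and e: "e \<in> killed \<pp>"
  shows "e \<in> f ` carrier K"
proof -
  have ec: "e \<in> carrier E" using e by (simp add: killed_def)
  define G where "G = (\<lambda>r. (r \<odot>\<^bsub>K\<^esub> u, r \<odot>\<^bsub>E\<^esub> e)) ` carrier R"
  have GI: "(r \<odot>\<^bsub>K\<^esub> u, r \<odot>\<^bsub>E\<^esub> e) \<in> G" if "r \<in> carrier R" for r using that by (auto simp: G_def)
  obtain g where g: "linear_map R K E g" "\<And>x y. (x, y) \<in> G \<Longrightarrow> g x = y"
  proof (rule injective_extend_graph[OF injective K.module_axioms, of G])
    show "G \<subseteq> carrier K \<times> carrier E" using u ec by (auto simp: G_def)
    show "(\<zero>\<^bsub>K\<^esub>, \<zero>\<^bsub>E\<^esub>) \<in> G" using GI[of "\<zero>\<^bsub>R\<^esub>"] u ec by simp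
  next
    fix a b a' b' assume "(a, b) \<in> G" "(a', b') \<in> G"
    then obtain r r' where "r \<in> carrier R" "r' \<in> carrier R" "a = r \<odot>\<^bsub>K\<^esub> u" "b = r \<odot>\<^bsub>E\<^esub> e"
      "a' = r' \<odot>\<^bsub>K\<^esub> u" "b' = r' \<odot>\<^bsub>E\<^esub> e" by (auto simp: G_def)
    then show "(a \<oplus>\<^bsub>K\<^esub> a', b \<oplus>\<^bsub>E\<^esub> b') \<in> G"
      using GI[of "r \<oplus>\<^bsub>R\<^esub> r'"] u ec by (simp add: smult_l_distr K.smult_l_distr)
  next
    fix s a b assume s: "s \<in> carrier R" and "(a, b) \<in> G"
    then obtain r where "r \<in> carrier R" "a = r \<odot>\<^bsub>K\<^esub> u" "b = r \<odot>\<^bsub>E\<^esub> e" by (auto simp: G_def)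
    then show "(s \<odot>\<^bsub>K\<^esub> a, s \<odot>\<^bsub>E\<^esub> b) \<in> G"
      using GI[of "s \<otimes>\<^bsub>R\<^esub> r"] u ec s by (simp add: smult_assoc1 K.smult_assoc1)
  next
    fix b assume "(\<zero>\<^bsub>K\<^esub>, b) \<in> G"
    then obtain r where r: "r \<in> carrier R" "r \<odot>\<^bsub>K\<^esub> u = \<zero>\<^bsub>K\<^esub>" "b = r \<odot>\<^bsub>E\<^esub> e" by (auto simp: G_def)
    then have "r \<in> \<pp>" using smult_eq_0 u by blast
    then show "b = \<zero>\<^bsub>E\<^esub>" using r e by (simp add: killed_def)
  qed (rule that)
  have "g u = e" using g(2)[OF GI[of "\<one>\<^bsub>R\<^esub>"]] u ec by simp
  obtain s a where sa: "s \<in> carrier R - \<pp>" "a \<in> carrier R" "\<And>y. y \<in> carrier K \<Longrightarrow> s \<odot>\<^bsub>E\<^esub> g y = a \<odot>\<^bsub>E\<^esub> f y"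
    using dual_generatorD(4)[OF f g(1)] by blast
  obtain z where z: "z \<in> carrier K" "s \<odot>\<^bsub>K\<^esub> z = u" using div[OF sa(1) u(1)] by blast
  have "e = f (a \<odot>\<^bsub>K\<^esub> z)" using dual_eq[OF dual_generatorD(1)[OF f] g(1) sa z] \<open>g u = e\<close> by simp
  then show ?thesis using sa z by blast
qed

lemma adic_limits_of_dual_generator:
  assumes f: "dual_generator f"
  shows "adic_limits R \<mm> \<pp>"
  unfolding adic_limits_def
proof (intro allI impI)
  fix a assume *: "\<forall>n. a n \<in> carrier R \<and> a (Suc n) \<ominus>\<^bsub>R\<^esub> a n \<in> \<pp> <+>\<^bsub>R\<^esub> ideal_pow R \<mm> n"
  then have a: "a n \<in> carrier R" for n by blast
  note fl = dual_generatorD(1)[OF f] and fK = dual_generatorD(2)[OF f] and fs = dual_generatorD(3)[OF f]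
  let ?I = "\<lambda>n. \<pp> <+>\<^bsub>R\<^esub> ideal_pow R \<mm> n"
  have I: "ideal (?I n) R" for n by (rule add_ideals[OF p_ideal ideal_max_pow])
  have kI: "c \<odot>\<^bsub>E\<^esub> e = \<zero>\<^bsub>E\<^esub>" if "c \<in> ?I n" "e \<in> killed \<pp>" "e \<in> killed (ideal_pow R \<mm> n)" for c e n
    using that p_carrier max_pow_carrier by (auto simp: set_add_def' killed_def smult_l_distr)
  have kId: "e \<in> killed \<pp>" "e \<in> killed (ideal_pow R \<mm> n)" if "e \<in> killed (?I n)" for e n
  proof -
    have "i \<in> ?I n" if "i \<in> \<pp>" for i
      unfolding set_add_def' using that p_carrier ideal_max_pow[of n] additive_subgroup.zero_closed[OF ideal.axioms(1)]
      by (auto intro!: bexI[OF _ that] bexI[of _ "\<zero>\<^bsub>R\<^esub>"])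
    moreover have "i \<in> ?I n" if "i \<in> ideal_pow R \<mm> n" for i
      unfolding set_add_def' using that max_pow_carrier additive_subgroup.zero_closed[OF ideal.axioms(1)[OF p_ideal]]
      by (auto intro!: bexI[OF _ that] bexI[of _ "\<zero>\<^bsub>R\<^esub>"])
    ultimately show "e \<in> killed \<pp>" "e \<in> killed (ideal_pow R \<mm> n)" using that by (auto simp: killed_def)
  qed
  have mono: "e \<in> killed (ideal_pow R \<mm> k)" if "e \<in> killed (ideal_pow R \<mm> n)" "n \<le> k" for e n k
    using that ideal_pow_decreasing[OF ideal_max that(2)] by (auto simp: killed_def)
  have stable: "a (n + k) \<odot>\<^bsub>E\<^esub> e = a n \<odot>\<^bsub>E\<^esub> e" if e: "e \<in> killed \<pp>" "e \<in> killed (ideal_pow R \<mm> n)" for e n k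
  proof (induction k)
    case (Suc k)
    have ec: "e \<in> carrier E" using e by (simp add: killed_def)
    have "(a (Suc (n + k)) \<ominus>\<^bsub>R\<^esub> a (n + k)) \<odot>\<^bsub>E\<^esub> e = \<zero>\<^bsub>E\<^esub>"
      using * e mono[OF e(2), of "n + k"] by (intro kI[of _ "n + k"]) auto
    then show ?case using Suc a ec by (simp add: smult_l_diff M.minus_eq_zero)
  qed simp
  \<comment> \<open>Any exponent for which \<mm>^n kills f y may be used: by \<open>stable\<close>
    all later terms of the sequence act alike on f y.\<close>
  define \<nu> where "\<nu> y = (SOME n. f y \<in> killed (ideal_pow R \<mm> n))" for y
  have \<nu>: "f y \<in> killed (ideal_pow R \<mm> (\<nu> y))" if "y \<in> carrier K" for y
    unfolding \<nu>_def using torsion[OF fK[OF that]] by (rule someI_ex)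
  define \<Phi> where "\<Phi> y = a (\<nu> y) \<odot>\<^bsub>E\<^esub> f y" for y
  have \<Phi>: "\<Phi> y = a n \<odot>\<^bsub>E\<^esub> f y" if y: "y \<in> carrier K" "f y \<in> killed (ideal_pow R \<mm> n)" for y n
    using stable[OF image_killed[OF fl y(1)] y(2), of "\<nu> y"]
      stable[OF image_killed[OF fl y(1)] \<nu>[OF y(1)], of n] by (simp add: \<Phi>_def add.commute)
  have \<Phi>lin: "linear_map R K E \<Phi>"
    unfolding linear_map_def
  proof (intro conjI ballI)
    fix y assume y: "y \<in> carrier K"
    then show "\<Phi> y \<in> carrier E" using a fK by (simp add: \<Phi>_def)
  next
    fix y y' assume y: "y \<in> carrier K" "y' \<in> carrier K"
    define n where "n = \<nu> y + \<nu> y'"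
    have n: "f y \<in> killed (ideal_pow R \<mm> n)" "f y' \<in> killed (ideal_pow R \<mm> n)"
      using mono[OF \<nu>] y by (simp_all add: n_def)
    moreover have "f (y \<oplus>\<^bsub>K\<^esub> y') \<in> killed (ideal_pow R \<mm> n)"
      unfolding linear_map_add[OF fl y] using n max_pow_carrier
      by (intro submodule_add[OF submodule_killed]) auto
    ultimately show "\<Phi> (y \<oplus>\<^bsub>K\<^esub> y') = \<Phi> y \<oplus>\<^bsub>E\<^esub> \<Phi> y'"
      using y a fK by (simp add: \<Phi>[of _ n] linear_map_add[OF fl] smult_r_distr)
  next
    fix r y assume r: "r \<in> carrier R" and y: "y \<in> carrier K"
    have "f (r \<odot>\<^bsub>K\<^esub> y) \<in> killed (ideal_pow R \<mm> (\<nu> y))"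
      unfolding fs[OF r y] using \<nu>[OF y] max_pow_carrier r
      by (intro submodule_smult[OF submodule_killed]) auto
    then show "\<Phi> (r \<odot>\<^bsub>K\<^esub> y) = r \<odot>\<^bsub>E\<^esub> \<Phi> y"
      using y a fK r \<nu>[OF y] by (simp add: \<Phi>[of _ "\<nu> y"] fs smult_swap[of r])
  qed
  obtain s b where sb: "s \<in> carrier R - \<pp>" "b \<in> carrier R" "\<And>y. y \<in> carrier K \<Longrightarrow> s \<odot>\<^bsub>E\<^esub> \<Phi> y = b \<odot>\<^bsub>E\<^esub> f y"
    using dual_generatorD(4)[OF f \<Phi>lin] by blast
  \<comment> \<open>All elements killed by \<pp> are values of f, so \<pp> + \<mm>^n is recovered by
    testing on those values of f that \<mm>^n kills.\<close>
  have memI: "c \<in> ?I n" if c: "c \<in> carrier R"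
    and "\<And>y. y \<in> carrier K \<Longrightarrow> f y \<in> killed (ideal_pow R \<mm> n) \<Longrightarrow> c \<odot>\<^bsub>E\<^esub> f y = \<zero>\<^bsub>E\<^esub>" for c n
  proof (rule ccontr)
    assume "c \<notin> ?I n"
    then obtain e where e: "e \<in> killed (?I n)" "c \<odot>\<^bsub>E\<^esub> e \<noteq> \<zero>\<^bsub>E\<^esub>" using killed_separates[OF I c] by blast
    obtain y where "y \<in> carrier K" "e = f y" using dual_generator_surj[OF f kId(1)[OF e(1)]] by blast
    then show False using that(2)[of y] kId(2)[OF e(1)] e(2) by simp
  qed
  have sab: "s \<otimes>\<^bsub>R\<^esub> a n \<ominus>\<^bsub>R\<^esub> b \<in> ?I n" for n
  proof (rule memI)
    fix y assume y: "y \<in> carrier K" "f y \<in> killed (ideal_pow R \<mm> n)"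
    show "(s \<otimes>\<^bsub>R\<^esub> a n \<ominus>\<^bsub>R\<^esub> b) \<odot>\<^bsub>E\<^esub> f y = \<zero>\<^bsub>E\<^esub>"
      using sb(1,2) sb(3)[OF y(1)] \<Phi>[OF y] a fK[OF y(1)] by (simp add: smult_l_diff smult_assoc1 M.minus_eq_zero)
  qed (use a sb in simp)
  \<comment> \<open>This makes b/s an element of R/\<pp>. As b is congruent to s (a n) modulo \<pp>
    + \<mm>^n for each n, Krull's theorem applies to the ideal \<pp> + (s).\<close>
  have "b \<in> \<pp> <+>\<^bsub>R\<^esub> PIdl\<^bsub>R\<^esub> s"
  proof (rule Krull_intersection)
    show "b \<in> carrier R" by fact
    show "ideal (\<pp> <+>\<^bsub>R\<^esub> PIdl\<^bsub>R\<^esub> s) R" using ideal_add_PIdl[OF p_ideal] sb by blast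
    show "b \<in> \<pp> <+>\<^bsub>R\<^esub> PIdl\<^bsub>R\<^esub> s <+>\<^bsub>R\<^esub> ideal_pow R \<mm> n" for n
    proof -
      obtain i j where ij: "i \<in> \<pp>" "j \<in> ideal_pow R \<mm> n" "s \<otimes>\<^bsub>R\<^esub> a n \<ominus>\<^bsub>R\<^esub> b = i \<oplus>\<^bsub>R\<^esub> j"
        using sab[of n] unfolding set_add_def' by blast
      have c: "i \<in> carrier R" "j \<in> carrier R" "s \<in> carrier R" "a n \<in> carrier R" "b \<in> carrier R"
        using ij p_carrier max_pow_carrier sb a by auto
      have "b = s \<otimes>\<^bsub>R\<^esub> a n \<ominus>\<^bsub>R\<^esub> (s \<otimes>\<^bsub>R\<^esub> a n \<ominus>\<^bsub>R\<^esub> b)"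
        using c by (simp add: R.minus_eq R.minus_add R.r_neg2 R.r_neg1)
      also have "\<dots> = (\<ominus>\<^bsub>R\<^esub> i \<oplus>\<^bsub>R\<^esub> a n \<otimes>\<^bsub>R\<^esub> s) \<oplus>\<^bsub>R\<^esub> \<ominus>\<^bsub>R\<^esub> j"
        unfolding ij(3) using c by (simp add: R.minus_eq R.minus_add R.a_ac m_comm[of "a n"])
      finally have "b = (\<ominus>\<^bsub>R\<^esub> i \<oplus>\<^bsub>R\<^esub> a n \<otimes>\<^bsub>R\<^esub> s) \<oplus>\<^bsub>R\<^esub> \<ominus>\<^bsub>R\<^esub> j" .
      moreover have "\<ominus>\<^bsub>R\<^esub> i \<oplus>\<^bsub>R\<^esub> a n \<otimes>\<^bsub>R\<^esub> s \<in> \<pp> <+>\<^bsub>R\<^esub> PIdl\<^bsub>R\<^esub> s"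
        unfolding mem_ideal_add_PIdl using ij(1) c
        using additive_subgroup.a_inv_closed[OF ideal.axioms(1)[OF p_ideal]] by blast
      moreover have "\<ominus>\<^bsub>R\<^esub> j \<in> ideal_pow R \<mm> n"
        using ij(2) by (intro additive_subgroup.a_inv_closed[OF ideal.axioms(1)[OF ideal_max_pow]])
      ultimately show ?thesis unfolding set_add_def'[of R "\<pp> <+>\<^bsub>R\<^esub> PIdl\<^bsub>R\<^esub> s"] by blast
    qed
  qed
  then obtain i d where d: "i \<in> \<pp>" "d \<in> carrier R" "b = i \<oplus>\<^bsub>R\<^esub> d \<otimes>\<^bsub>R\<^esub> s" unfolding mem_ideal_add_PIdl by blast
  have \<Phi>d: "\<Phi> y = d \<odot>\<^bsub>E\<^esub> f y" if y: "y \<in> carrier K" for y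
  proof -
    obtain z where z: "z \<in> carrier K" "s \<odot>\<^bsub>K\<^esub> z = y" using div[OF sb(1) y] by blast
    have "\<Phi> y = f (b \<odot>\<^bsub>K\<^esub> z)" by (rule dual_eq[OF fl \<Phi>lin sb z])
    also have "b \<odot>\<^bsub>K\<^esub> z = d \<odot>\<^bsub>K\<^esub> y"
      unfolding d(3) using d(1,2) z sb p_carrier y by (simp add: K.smult_l_distr K.smult_assoc1 kill)
    finally show ?thesis using fs d y by simp
  qed
  have "a n \<ominus>\<^bsub>R\<^esub> d \<in> ?I n" for n
  proof (rule memI)
    fix y assume y: "y \<in> carrier K" "f y \<in> killed (ideal_pow R \<mm> n)"
    show "(a n \<ominus>\<^bsub>R\<^esub> d) \<odot>\<^bsub>E\<^esub> f y = \<zero>\<^bsub>E\<^esub>"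
      using \<Phi>d[OF y(1)] \<Phi>[OF y] a fK[OF y(1)] d by (simp add: smult_l_diff M.minus_eq_zero)
  qed (use a d in simp)
  then show "\<exists>d\<in>carrier R. \<forall>n. a n \<ominus>\<^bsub>R\<^esub> d \<in> ?I n" using d by blast
qed

end

context residue_field_module
begin

subsection \<open>The dimension of the residue ring\<close>

text \<open>For y = a/s the product is a y'/s. The property is demanded for all representations of y
  at once, so that a product can be chosen without reference to a particular fraction.\<close>

lemma multiplication_exists:
  assumes y: "y \<in> carrier K" "y' \<in> carrier K"
  shows "\<exists>z\<in>carrier K. \<forall>s\<in>carrier R - \<pp>. \<forall>a\<in>carrier R.
    s \<odot>\<^bsub>K\<^esub> y = a \<odot>\<^bsub>K\<^esub> u \<longrightarrow> s \<odot>\<^bsub>K\<^esub> z = a \<odot>\<^bsub>K\<^esub> y'"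
proof -
  obtain s0 a0 where 0: "s0 \<in> carrier R - \<pp>" "a0 \<in> carrier R" "s0 \<odot>\<^bsub>K\<^esub> y = a0 \<odot>\<^bsub>K\<^esub> u" using fraction[OF y(1)] by blast
  obtain z where z: "z \<in> carrier K" "s0 \<odot>\<^bsub>K\<^esub> z = a0 \<odot>\<^bsub>K\<^esub> y'" using div[OF 0(1)] 0 y by (meson K.smult_closed)
  have "s \<odot>\<^bsub>K\<^esub> z = a \<odot>\<^bsub>K\<^esub> y'" if sa: "s \<in> carrier R - \<pp>" "a \<in> carrier R" "s \<odot>\<^bsub>K\<^esub> y = a \<odot>\<^bsub>K\<^esub> u" for s a
  proof -
    have "(s0 \<otimes>\<^bsub>R\<^esub> a) \<odot>\<^bsub>K\<^esub> u = (s \<otimes>\<^bsub>R\<^esub> a0) \<odot>\<^bsub>K\<^esub> u"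
      using 0 sa u y K.smult_swap[of s0 s y] by (simp add: K.smult_assoc1 flip: 0(3) sa(3))
    then have m: "s0 \<otimes>\<^bsub>R\<^esub> a \<ominus>\<^bsub>R\<^esub> s \<otimes>\<^bsub>R\<^esub> a0 \<in> \<pp>" using smult_eq u 0 sa by simp
    have "s0 \<odot>\<^bsub>K\<^esub> (s \<odot>\<^bsub>K\<^esub> z) = s \<odot>\<^bsub>K\<^esub> (a0 \<odot>\<^bsub>K\<^esub> y')" using 0 sa z K.smult_swap[of s0 s z] by simp
    also have "\<dots> = s0 \<odot>\<^bsub>K\<^esub> (a \<odot>\<^bsub>K\<^esub> y')"
      using kill[OF m y(2)] 0 sa y(2) by (simp add: K.smult_l_diff K.smult_assoc1 K.M.minus_eq_zero)
    finally show ?thesis using inj[OF 0(1), of "s \<odot>\<^bsub>K\<^esub> z" "a \<odot>\<^bsub>K\<^esub> y'"] sa z y by simp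
  qed
  then show ?thesis using z by blast
qed

text \<open>Identifying \<open>K\<close> with its dual turns evaluation into a pairing that is symmetric because the
  field underlying \<open>K\<close> is commutative.\<close>

lemma symmetric_pairing:
  assumes f: "dual_generator f"
  obtains \<beta> where "\<And>y. y \<in> carrier K \<Longrightarrow> linear_map R K E (\<beta> y)"
    and "\<And>y y'. y \<in> carrier K \<Longrightarrow> y' \<in> carrier K \<Longrightarrow> \<beta> y y' = \<beta> y' y"
    and "\<And>g. linear_map R K E g \<Longrightarrow> \<exists>y\<in>carrier K. \<forall>y'\<in>carrier K. g y' = \<beta> y y'"
proof -
  note fl = dual_generatorD(1)[OF f] and fK = dual_generatorD(2)[OF f] and fs = dual_generatorD(3)[OF f]
  \<comment> \<open>The multiplication of \<open>K\<close> as a field with unit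
    \<open>u\<close>.\<close>
  obtain mul where mul: "\<And>y y'. y \<in> carrier K \<Longrightarrow> y' \<in> carrier K \<Longrightarrow> mul y y' \<in> carrier K"
    "\<And>y y' s a. y \<in> carrier K \<Longrightarrow> y' \<in> carrier K \<Longrightarrow> s \<in> carrier R - \<pp> \<Longrightarrow> a \<in> carrier R \<Longrightarrow>
       s \<odot>\<^bsub>K\<^esub> y = a \<odot>\<^bsub>K\<^esub> u \<Longrightarrow> s \<odot>\<^bsub>K\<^esub> mul y y' = a \<odot>\<^bsub>K\<^esub> y'"
    using multiplication_exists by metis
  have lin: "linear_map R K E (\<lambda>y'. f (mul y y'))" if y: "y \<in> carrier K" for y
  proof -
    obtain s a where sa: "s \<in> carrier R - \<pp>" "a \<in> carrier R" "s \<odot>\<^bsub>K\<^esub> y = a \<odot>\<^bsub>K\<^esub> u" using fraction[OF y] by blast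
    note m = mul(1)[OF y] mul(2)[OF y _ sa]
    have add: "mul y (v \<oplus>\<^bsub>K\<^esub> v') = mul y v \<oplus>\<^bsub>K\<^esub> mul y v'" if "v \<in> carrier K" "v' \<in> carrier K" for v v'
      by (rule inj[OF sa(1)]) (use that m sa in \<open>auto simp: K.smult_r_distr\<close>)
    have sm: "mul y (r \<odot>\<^bsub>K\<^esub> v) = r \<odot>\<^bsub>K\<^esub> mul y v" if "r \<in> carrier R" "v \<in> carrier K" for r v
      by (rule inj[OF sa(1)]) (use that m sa in \<open>auto simp: K.smult_swap[of _ r]\<close>)
    show ?thesis using add sm m(1) fK fs by (simp add: linear_map_def linear_map_add[OF fl])
  qed
  have sym: "mul y y' = mul y' y" if y: "y \<in> carrier K" "y' \<in> carrier K" for y y'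
  proof -
    obtain s a where sa: "s \<in> carrier R - \<pp>" "a \<in> carrier R" "s \<odot>\<^bsub>K\<^esub> y = a \<odot>\<^bsub>K\<^esub> u" using fraction[OF y(1)] by blast
    obtain t b where tb: "t \<in> carrier R - \<pp>" "b \<in> carrier R" "t \<odot>\<^bsub>K\<^esub> y' = b \<odot>\<^bsub>K\<^esub> u" using fraction[OF y(2)] by blast
    have "(s \<otimes>\<^bsub>R\<^esub> t) \<odot>\<^bsub>K\<^esub> mul y y' = a \<odot>\<^bsub>K\<^esub> (b \<odot>\<^bsub>K\<^esub> u)"
      using mul(2)[OF y sa] mul(1) y sa tb K.smult_swap[of s t "mul y y'"]
      by (simp add: K.smult_assoc1 K.smult_swap[of t a])
    moreover have "(s \<otimes>\<^bsub>R\<^esub> t) \<odot>\<^bsub>K\<^esub> mul y' y = b \<odot>\<^bsub>K\<^esub> (a \<odot>\<^bsub>K\<^esub> u)"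
      using mul(2)[OF y(2,1) tb] mul(1) y sa tb
      by (simp add: K.smult_assoc1 K.smult_swap[of s b])
    ultimately have "(s \<otimes>\<^bsub>R\<^esub> t) \<odot>\<^bsub>K\<^esub> mul y y' = (s \<otimes>\<^bsub>R\<^esub> t) \<odot>\<^bsub>K\<^esub> mul y' y"
      using sa tb u K.smult_swap[of a b u] by simp
    then show ?thesis by (rule inj[OF notin_p_mult[OF sa(1) tb(1)] mul(1) mul(1), rotated -1]) (use y in auto)
  qed
  have univ: "\<exists>y\<in>carrier K. \<forall>y'\<in>carrier K. g y' = f (mul y y')" if g: "linear_map R K E g" for g
  proof -
    obtain s a where sa: "s \<in> carrier R - \<pp>" "a \<in> carrier R" "\<And>y. y \<in> carrier K \<Longrightarrow> s \<odot>\<^bsub>E\<^esub> g y = a \<odot>\<^bsub>E\<^esub> f y"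
      using dual_generatorD(4)[OF f g] by blast
    obtain y where y: "y \<in> carrier K" "s \<odot>\<^bsub>K\<^esub> y = a \<odot>\<^bsub>K\<^esub> u" using div[OF sa(1)] sa(2) u(1) by (meson K.smult_closed)
    have "g y' = f (mul y y')" if y': "y' \<in> carrier K" for y'
    proof -
      obtain z where z: "z \<in> carrier K" "s \<odot>\<^bsub>K\<^esub> z = y'" using div[OF sa(1) y'] by blast
      have "s \<odot>\<^bsub>K\<^esub> mul y y' = s \<odot>\<^bsub>K\<^esub> (a \<odot>\<^bsub>K\<^esub> z)"
        using mul(2)[OF y(1) y' sa(1,2) y(2)] z sa K.smult_swap[of s a z] by simp
      then have "mul y y' = a \<odot>\<^bsub>K\<^esub> z" using inj[OF sa(1) mul(1)[OF y(1) y'], of "a \<odot>\<^bsub>K\<^esub> z"] sa z by simp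
      then show ?thesis using dual_eq[OF fl g sa z] by simp
    qed
    then show ?thesis using y(1) by blast
  qed
  show ?thesis
    by (rule that[of "\<lambda>y y'. f (mul y y')"]) (use lin sym univ in auto)
qed

lemma submodule_smult_image:
  assumes "submodule S R K" "a \<in> carrier R" shows "submodule ((\<lambda>v. a \<odot>\<^bsub>K\<^esub> v) ` S) R K"
proof (rule K.submoduleI2)
  note SD = K.submoduleD[OF assms(1)]
  show "\<zero>\<^bsub>K\<^esub> \<in> (\<lambda>v. a \<odot>\<^bsub>K\<^esub> v) ` S" using SD(2) assms(2) by (intro image_eqI[of _ _ "\<zero>\<^bsub>K\<^esub>"]) auto
  show "x \<oplus>\<^bsub>K\<^esub> y \<in> (\<lambda>v. a \<odot>\<^bsub>K\<^esub> v) ` S" if "x \<in> (\<lambda>v. a \<odot>\<^bsub>K\<^esub> v) ` S" "y \<in> (\<lambda>v. a \<odot>\<^bsub>K\<^esub> v) ` S" for x y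
    using that SD assms(2) by (auto simp flip: K.smult_r_distr)
  show "r \<odot>\<^bsub>K\<^esub> x \<in> (\<lambda>v. a \<odot>\<^bsub>K\<^esub> v) ` S" if "r \<in> carrier R" "x \<in> (\<lambda>v. a \<odot>\<^bsub>K\<^esub> v) ` S" for r x
    using that SD assms(2) by (auto simp: K.smult_swap[of _ a])
qed (use K.submoduleD[OF assms(1)] assms in auto)

lemma no_intermediate_prime_of_dual_generator:
  assumes f: "dual_generator f" and q: "primeideal q R" "\<pp> \<subset> q" "q \<subset> \<mm>"
  shows False
proof -
  interpret q: primeideal q R by fact
  obtain \<beta> where \<beta>: "\<And>y. y \<in> carrier K \<Longrightarrow> linear_map R K E (\<beta> y)"
    and \<beta>sym: "\<And>y y'. y \<in> carrier K \<Longrightarrow> y' \<in> carrier K \<Longrightarrow> \<beta> y y' = \<beta> y' y"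
    and \<beta>univ: "\<And>g. linear_map R K E g \<Longrightarrow> \<exists>y\<in>carrier K. \<forall>y'\<in>carrier K. g y' = \<beta> y y'"
    using symmetric_pairing[OF f] by blast
  note \<beta>c = linear_map_closed[OF \<beta>] and \<beta>add = linear_map_add[OF \<beta>] and \<beta>smult = linear_map_smult[OF \<beta>]
    and \<beta>0 = linear_map_zero[OF \<beta> K.module_axioms module_axioms]
    and \<beta>diff = linear_map_diff[OF \<beta> K.module_axioms module_axioms]
  \<comment> \<open>Separation by elements of \<open>K\<close> itself, as every map to
    \<open>E\<close> is some \<beta> c.\<close>
  have sep: "\<exists>c\<in>carrier K. (\<forall>v\<in>U. \<beta> c v = \<zero>\<^bsub>E\<^esub>) \<and> \<beta> c v0 \<noteq> \<zero>\<^bsub>E\<^esub>"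
    if U: "submodule U R K" "v0 \<in> carrier K" "v0 \<notin> U" for U v0
  proof -
    obtain h where h: "linear_map R K E h" "\<And>v. v \<in> U \<Longrightarrow> h v = \<zero>\<^bsub>E\<^esub>" "h v0 = e0"
      using separation[OF K.module_axioms U] by blast
    obtain c where "c \<in> carrier K" "\<And>v. v \<in> carrier K \<Longrightarrow> h v = \<beta> c v" using \<beta>univ[OF h(1)] by blast
    then show ?thesis using h(2,3) e0 K.submoduleD(1)[OF U(1)] U(2) by metis
  qed
  obtain x where x: "x \<in> \<mm>" "x \<notin> q" using q by blast
  obtain y where y: "y \<in> q" "y \<notin> \<pp>" using q by blast
  have xc: "x \<in> carrier R" using x max_carrier by blast
  have yc: "y \<in> carrier R" using y q.Icarr by blast
  have xp: "x \<in> carrier R - \<pp>" and yp: "y \<in> carrier R - \<pp>" using xc yc x y q by auto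
  have ynp: "y [^]\<^bsub>R\<^esub> n \<in> carrier R - \<pp>" "y [^]\<^bsub>R\<^esub> n \<in> carrier R" for n :: nat using notin_p_pow[OF yp, of n] by auto
  have xnp: "x [^]\<^bsub>R\<^esub> n \<in> carrier R - \<pp>" "x [^]\<^bsub>R\<^esub> n \<in> carrier R" for n :: nat using notin_p_pow[OF xp, of n] by auto
  \<comment> \<open>In terms of (R/\<pp>)[1/x]: y is not a unit there, because it lies in q and no
    power of x does.\<close>
  have xq: "x [^]\<^bsub>R\<^esub> (n::nat) \<ominus>\<^bsub>R\<^esub> r \<otimes>\<^bsub>R\<^esub> y \<notin> \<pp>" if r: "r \<in> carrier R" for n r
  proof
    assume *: "x [^]\<^bsub>R\<^esub> n \<ominus>\<^bsub>R\<^esub> r \<otimes>\<^bsub>R\<^esub> y \<in> \<pp>"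
    have "x [^]\<^bsub>R\<^esub> n = (x [^]\<^bsub>R\<^esub> n \<ominus>\<^bsub>R\<^esub> r \<otimes>\<^bsub>R\<^esub> y) \<oplus>\<^bsub>R\<^esub> r \<otimes>\<^bsub>R\<^esub> y"
      using xc yc r by (simp add: R.add_minus_cancel)
    also have "\<dots> \<in> q" using * q(2) y r by (intro q.a_closed q.I_l_closed) auto
    finally show False using q.prime_pow[OF xc] x by blast
  qed
  obtain w where w: "\<And>n. w n \<in> carrier K" "w 0 = u" "\<And>n. x \<odot>\<^bsub>K\<^esub> w (Suc n) = w n"
    "\<And>n k. x [^]\<^bsub>R\<^esub> k \<odot>\<^bsub>K\<^esub> w (n + k) = w n" using roots[OF xp] by blast
  have wu: "x [^]\<^bsub>R\<^esub> n \<odot>\<^bsub>K\<^esub> w n = u" for n using w(4)[of n 0] w(2) by simp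
  \<comment> \<open>The ring (R/\<pp>)[1/x], as the union of the cyclic modules generated by u/x^n.
    Below, \<open>G j\<close> is y^j \<open>S\<close>.\<close>
  define S where "S = {r \<odot>\<^bsub>K\<^esub> w n | r n. r \<in> carrier R}"
  have SI: "r \<odot>\<^bsub>K\<^esub> w n \<in> S" if "r \<in> carrier R" for r n using that by (auto simp: S_def)
  have S: "submodule S R K"
  proof (rule K.submoduleI2)
    show "S \<subseteq> carrier K" using w(1) by (auto simp: S_def)
    show "\<zero>\<^bsub>K\<^esub> \<in> S" using SI[of "\<zero>\<^bsub>R\<^esub>" 0] w(1) by simp
    show "r \<odot>\<^bsub>K\<^esub> v \<in> S" if "r \<in> carrier R" "v \<in> S" for r v
    proof -
      obtain t n where "t \<in> carrier R" "v = t \<odot>\<^bsub>K\<^esub> w n" using \<open>v \<in> S\<close> by (auto simp: S_def)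
      then show ?thesis using SI[of "r \<otimes>\<^bsub>R\<^esub> t" n] that w(1) by (simp add: K.smult_assoc1)
    qed
    show "v \<oplus>\<^bsub>K\<^esub> v' \<in> S" if "v \<in> S" "v' \<in> S" for v v'
    proof -
      obtain t n where t: "t \<in> carrier R" "v = t \<odot>\<^bsub>K\<^esub> w n" using \<open>v \<in> S\<close> by (auto simp: S_def)
      obtain t' n' where t': "t' \<in> carrier R" "v' = t' \<odot>\<^bsub>K\<^esub> w n'" using \<open>v' \<in> S\<close> by (auto simp: S_def)
      have "v = (t \<otimes>\<^bsub>R\<^esub> x [^]\<^bsub>R\<^esub> n') \<odot>\<^bsub>K\<^esub> w (n + n')" "v' = (t' \<otimes>\<^bsub>R\<^esub> x [^]\<^bsub>R\<^esub> n) \<odot>\<^bsub>K\<^esub> w (n + n')"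
        using t t' w(4)[of n' n] w(4)[of n n'] w(1) xc by (simp_all add: K.smult_assoc1 add.commute)
      then have "v \<oplus>\<^bsub>K\<^esub> v' = (t \<otimes>\<^bsub>R\<^esub> x [^]\<^bsub>R\<^esub> n' \<oplus>\<^bsub>R\<^esub> t' \<otimes>\<^bsub>R\<^esub> x [^]\<^bsub>R\<^esub> n) \<odot>\<^bsub>K\<^esub> w (n + n')"
        using t t' w(1) xc by (simp add: K.smult_l_distr)
      then show ?thesis using SI[of "t \<otimes>\<^bsub>R\<^esub> x [^]\<^bsub>R\<^esub> n' \<oplus>\<^bsub>R\<^esub> t' \<otimes>\<^bsub>R\<^esub> x [^]\<^bsub>R\<^esub> n" "n + n'"] t t' xc by simp
    qed
  qed
  note SD = K.submoduleD[OF S]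
  define G where "G j = (\<lambda>v. y [^]\<^bsub>R\<^esub> j \<odot>\<^bsub>K\<^esub> v) ` S" for j :: nat
  have G: "submodule (G j) R K" for j unfolding G_def using S ynp by (intro submodule_smult_image)
  note GD = K.submoduleD[OF G]
  have GI: "y [^]\<^bsub>R\<^esub> j \<odot>\<^bsub>K\<^esub> v \<in> G j" if "v \<in> S" for v j using that by (auto simp: G_def)
  have GSuc: "G (Suc j) \<subseteq> G j" for j
  proof
    fix v assume "v \<in> G (Suc j)"
    then obtain v' where v': "v' \<in> S" "v = y [^]\<^bsub>R\<^esub> Suc j \<odot>\<^bsub>K\<^esub> v'" by (auto simp: G_def)
    then have "v = y [^]\<^bsub>R\<^esub> j \<odot>\<^bsub>K\<^esub> (y \<odot>\<^bsub>K\<^esub> v')" using yc SD(1) by (simp add: K.smult_assoc1)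
    then show "v \<in> G j" using GI[OF SD(4)[OF yc v'(1)]] by simp
  qed
  have Gmono: "G j \<subseteq> G i" if "i \<le> j" for i j using lift_Suc_antimono_le[of G, OF GSuc that] .
  have GS: "G j \<subseteq> S" for j using Gmono[of 0 j] SD(1) by (force simp: G_def)

  \<comment> \<open>Krull's theorem for \<open>S\<close>, carried out with ideals of
    \<open>R\<close>: if v = y^j V_j for all j, the \<open>S\<close>-modules generated by the V_j
    increase, and once they are stationary y acts invertibly on one of them.\<close>
  have inter_G: "v = \<zero>\<^bsub>K\<^esub>" if v: "v \<in> carrier K" "\<And>j. v \<in> G j" for v
  proof (rule ccontr)
    assume "v \<noteq> \<zero>\<^bsub>K\<^esub>"
    have "\<forall>j::nat. \<exists>v'\<in>S. v = y [^]\<^bsub>R\<^esub> j \<odot>\<^bsub>K\<^esub> v'" using v(2) unfolding G_def by blast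
    then obtain V where V: "\<And>j::nat. V j \<in> S" "\<And>j::nat. v = y [^]\<^bsub>R\<^esub> j \<odot>\<^bsub>K\<^esub> V j" by metis
    have Vc: "V j \<in> carrier K" for j using V(1) SD(1) by blast
    have V0: "V j \<noteq> \<zero>\<^bsub>K\<^esub>" for j
    proof
      assume "V j = \<zero>\<^bsub>K\<^esub>" then show False using V(2)[of j] \<open>v \<noteq> \<zero>\<^bsub>K\<^esub>\<close> yc by simp
    qed
    have VS: "V j = y \<odot>\<^bsub>K\<^esub> V (Suc j)" for j
    proof (rule inj[OF ynp(1)[of j]])
      show "y [^]\<^bsub>R\<^esub> j \<odot>\<^bsub>K\<^esub> V j = y [^]\<^bsub>R\<^esub> j \<odot>\<^bsub>K\<^esub> (y \<odot>\<^bsub>K\<^esub> V (Suc j))"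
        using V(2)[of j] V(2)[of "Suc j"] yc Vc by (simp add: K.smult_assoc1)
    qed (use Vc yc in auto)
    \<comment> \<open>Those r for which r u lies in the \<open>S\<close>-module generated by
      \<open>V j\<close>; the power of x clears the denominator.\<close>
    define A where "A j = {r \<in> carrier R. \<exists>i::nat. \<exists>a\<in>carrier R. x [^]\<^bsub>R\<^esub> i \<odot>\<^bsub>K\<^esub> (r \<odot>\<^bsub>K\<^esub> u) = a \<odot>\<^bsub>K\<^esub> V j}" for j
    have AI: "r \<in> A j" if "x [^]\<^bsub>R\<^esub> (i::nat) \<odot>\<^bsub>K\<^esub> (r \<odot>\<^bsub>K\<^esub> u) = a \<odot>\<^bsub>K\<^esub> V j" "r \<in> carrier R" "a \<in> carrier R" for r a i j
      using that by (auto simp: A_def)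
    have A: "ideal (A j) R" for j
    proof -
      have sm: "r \<otimes>\<^bsub>R\<^esub> a \<in> A j" if ra: "r \<in> carrier R" "a \<in> A j" for r a
      proof -
        obtain i b where ib: "b \<in> carrier R" "x [^]\<^bsub>R\<^esub> (i::nat) \<odot>\<^bsub>K\<^esub> (a \<odot>\<^bsub>K\<^esub> u) = b \<odot>\<^bsub>K\<^esub> V j" "a \<in> carrier R"
          using ra(2) by (auto simp: A_def)
        then have "x [^]\<^bsub>R\<^esub> i \<odot>\<^bsub>K\<^esub> ((r \<otimes>\<^bsub>R\<^esub> a) \<odot>\<^bsub>K\<^esub> u) = (r \<otimes>\<^bsub>R\<^esub> b) \<odot>\<^bsub>K\<^esub> V j"
          using ra(1) xc u Vc by (simp add: K.smult_assoc1 K.smult_swap[of _ r])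
        then show ?thesis by (rule AI) (use ib ra in auto)
      qed
      have ad: "a \<oplus>\<^bsub>R\<^esub> a' \<in> A j" if aa: "a \<in> A j" "a' \<in> A j" for a a'
      proof -
        obtain i b where ib: "b \<in> carrier R" "x [^]\<^bsub>R\<^esub> (i::nat) \<odot>\<^bsub>K\<^esub> (a \<odot>\<^bsub>K\<^esub> u) = b \<odot>\<^bsub>K\<^esub> V j" "a \<in> carrier R"
          using aa by (auto simp: A_def)
        obtain i' b' where ib': "b' \<in> carrier R" "x [^]\<^bsub>R\<^esub> (i'::nat) \<odot>\<^bsub>K\<^esub> (a' \<odot>\<^bsub>K\<^esub> u) = b' \<odot>\<^bsub>K\<^esub> V j" "a' \<in> carrier R"
          using aa by (auto simp: A_def)
        have "x [^]\<^bsub>R\<^esub> (i + i') \<odot>\<^bsub>K\<^esub> ((a \<oplus>\<^bsub>R\<^esub> a') \<odot>\<^bsub>K\<^esub> u)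
          = x [^]\<^bsub>R\<^esub> i' \<odot>\<^bsub>K\<^esub> (x [^]\<^bsub>R\<^esub> i \<odot>\<^bsub>K\<^esub> (a \<odot>\<^bsub>K\<^esub> u)) \<oplus>\<^bsub>K\<^esub> x [^]\<^bsub>R\<^esub> i \<odot>\<^bsub>K\<^esub> (x [^]\<^bsub>R\<^esub> i' \<odot>\<^bsub>K\<^esub> (a' \<odot>\<^bsub>K\<^esub> u))"
          using ib(3) ib'(3) xc u K.smult_swap[of "x [^]\<^bsub>R\<^esub> i'" "x [^]\<^bsub>R\<^esub> i" "a \<odot>\<^bsub>K\<^esub> u"]
          by (simp add: K.smult_l_distr K.smult_r_distr K.smult_assoc1 flip: R.nat_pow_mult)
        also have "\<dots> = (x [^]\<^bsub>R\<^esub> i' \<otimes>\<^bsub>R\<^esub> b \<oplus>\<^bsub>R\<^esub> x [^]\<^bsub>R\<^esub> i \<otimes>\<^bsub>R\<^esub> b') \<odot>\<^bsub>K\<^esub> V j"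
          using ib ib' xc Vc by (simp add: K.smult_l_distr K.smult_assoc1)
        finally show ?thesis by (rule AI) (use ib ib' xc in auto)
      qed
      have "\<zero>\<^bsub>R\<^esub> \<in> A j" by (rule AI[of 0 _ "\<zero>\<^bsub>R\<^esub>"]) (use u Vc in auto)
      show ?thesis
      proof (rule idealI)
        show "subgroup (A j) (add_monoid R)"
        proof (rule R.add.subgroupI)
          show "\<ominus>\<^bsub>R\<^esub> a \<in> A j" if "a \<in> A j" for a
            using sm[of "\<ominus>\<^bsub>R\<^esub> \<one>\<^bsub>R\<^esub>" a] that by (simp add: A_def l_minus)
        qed (use ad \<open>\<zero>\<^bsub>R\<^esub> \<in> A j\<close> in \<open>auto simp: A_def\<close>)
        show "r \<otimes>\<^bsub>R\<^esub> a \<in> A j" if "a \<in> A j" "r \<in> carrier R" for a r using sm that by blast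
        show "a \<otimes>\<^bsub>R\<^esub> r \<in> A j" if "a \<in> A j" "r \<in> carrier R" for a r
          using sm[OF that(2,1)] m_comm[of a r] that by (simp add: A_def)
      qed (rule R.ring_axioms)
    qed
    have "A j \<subseteq> A (Suc j)" for j
    proof
      fix r assume "r \<in> A j"
      then obtain i b where ib: "b \<in> carrier R" "x [^]\<^bsub>R\<^esub> (i::nat) \<odot>\<^bsub>K\<^esub> (r \<odot>\<^bsub>K\<^esub> u) = b \<odot>\<^bsub>K\<^esub> V j" "r \<in> carrier R"
        by (auto simp: A_def)
      moreover have "b \<odot>\<^bsub>K\<^esub> V j = (b \<otimes>\<^bsub>R\<^esub> y) \<odot>\<^bsub>K\<^esub> V (Suc j)" using VS[of j] ib yc Vc by (simp add: K.smult_assoc1)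
      ultimately show "r \<in> A (Suc j)" using yc by (intro AI[of i r "b \<otimes>\<^bsub>R\<^esub> y"]) auto
    qed
    then obtain n where n: "\<And>k. n \<le> k \<Longrightarrow> A k = A n"
      by (rule noetherian_ring.ideal_sequence_stable[OF noetherian, of A, OF A]) (rule that)
    have An: "A (Suc n) = A n" by (rule n) simp
    obtain r i where ri: "r \<in> carrier R" "V (Suc n) = r \<odot>\<^bsub>K\<^esub> w i" using V(1)[of "Suc n"] by (auto simp: S_def)
    have ru: "r \<odot>\<^bsub>K\<^esub> u = x [^]\<^bsub>R\<^esub> i \<odot>\<^bsub>K\<^esub> V (Suc n)"
      using wu[of i] ri w(1) xc K.smult_swap[of "x [^]\<^bsub>R\<^esub> i" r "w i"] by simp
    have "r \<in> A (Suc n)"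
      by (rule AI[of 0 r "x [^]\<^bsub>R\<^esub> i"]) (use ri(1) ru xc u Vc in auto)
    then obtain i' a where ia: "a \<in> carrier R" "x [^]\<^bsub>R\<^esub> (i'::nat) \<odot>\<^bsub>K\<^esub> (r \<odot>\<^bsub>K\<^esub> u) = a \<odot>\<^bsub>K\<^esub> V n"
      unfolding An by (auto simp: A_def)
    have "x [^]\<^bsub>R\<^esub> (i' + i) \<odot>\<^bsub>K\<^esub> V (Suc n) = (a \<otimes>\<^bsub>R\<^esub> y) \<odot>\<^bsub>K\<^esub> V (Suc n)"
      using ia VS[of n] ru xc yc Vc by (simp add: K.smult_assoc1 flip: R.nat_pow_mult)
    then have "x [^]\<^bsub>R\<^esub> (i' + i) \<ominus>\<^bsub>R\<^esub> a \<otimes>\<^bsub>R\<^esub> y \<in> \<pp>"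
      by (subst (asm) smult_eq[OF xnp(2) m_closed[OF ia(1) yc] Vc V0])
    then show False using xq[OF ia(1)] by blast
  qed

  \<comment> \<open>Otherwise some z is orthogonal to everything that annihilates one of the
    \<open>G j\<close>, but not to \<open>c\<close>. By double annihilation z then lies in every
    \<open>G j\<close>, hence is zero.\<close>
  have kills_G: "\<exists>j. \<forall>v\<in>G j. \<beta> c v = \<zero>\<^bsub>E\<^esub>" if c: "c \<in> carrier K" for c
  proof (rule ccontr)
    assume no: "\<not> ?thesis"
    define Z where "Z = {c \<in> carrier K. \<exists>j. \<forall>v\<in>G j. \<beta> v c = \<zero>\<^bsub>E\<^esub>}"
    have Z: "submodule Z R K"
    proof (rule K.submoduleI2)
      show "c \<oplus>\<^bsub>K\<^esub> c' \<in> Z" if cc: "c \<in> Z" "c' \<in> Z" for c c'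
      proof -
        obtain j j' where j: "\<And>v. v \<in> G j \<Longrightarrow> \<beta> v c = \<zero>\<^bsub>E\<^esub>" "\<And>v. v \<in> G j' \<Longrightarrow> \<beta> v c' = \<zero>\<^bsub>E\<^esub>"
          and c: "c \<in> carrier K" "c' \<in> carrier K" using cc by (auto simp: Z_def)
        have "\<beta> v (c \<oplus>\<^bsub>K\<^esub> c') = \<zero>\<^bsub>E\<^esub>" if v: "v \<in> G (j + j')" for v
        proof -
          have "v \<in> G j" "v \<in> G j'" using v Gmono[of j "j + j'"] Gmono[of j' "j + j'"] by auto
          then show ?thesis using \<beta>add[OF GD(1)[OF v] c] j by simp
        qed
        then show ?thesis using c by (auto simp: Z_def)
      qed
      show "r \<odot>\<^bsub>K\<^esub> c \<in> Z" if "r \<in> carrier R" "c \<in> Z" for r c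
      proof -
        obtain j where j: "\<And>v. v \<in> G j \<Longrightarrow> \<beta> v c = \<zero>\<^bsub>E\<^esub>" "c \<in> carrier K" using \<open>c \<in> Z\<close> by (auto simp: Z_def)
        have "\<beta> v (r \<odot>\<^bsub>K\<^esub> c) = \<zero>\<^bsub>E\<^esub>" if "v \<in> G j" for v
          using \<beta>smult[OF GD(1)[OF that] \<open>r \<in> carrier R\<close> j(2)] j(1)[OF that] \<open>r \<in> carrier R\<close> by simp
        then show ?thesis using j(2) \<open>r \<in> carrier R\<close> by (auto simp: Z_def)
      qed
    next
      have "\<beta> v \<zero>\<^bsub>K\<^esub> = \<zero>\<^bsub>E\<^esub>" if "v \<in> G 0" for v using \<beta>0 GD(1)[OF that] by blast
      then show "\<zero>\<^bsub>K\<^esub> \<in> Z" by (auto simp: Z_def)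
    qed (auto simp: Z_def)
    have cZ: "c \<notin> Z" using no \<beta>sym c GD(1) by (auto simp: Z_def)
    obtain z where z: "z \<in> carrier K" "\<And>c. c \<in> Z \<Longrightarrow> \<beta> z c = \<zero>\<^bsub>E\<^esub>" "\<beta> z c \<noteq> \<zero>\<^bsub>E\<^esub>"
      using sep[OF Z c cZ] by blast
    have "z \<in> G j" for j
    proof (rule ccontr)
      assume "z \<notin> G j"
      then obtain c' where c': "c' \<in> carrier K" "\<And>v. v \<in> G j \<Longrightarrow> \<beta> c' v = \<zero>\<^bsub>E\<^esub>" "\<beta> c' z \<noteq> \<zero>\<^bsub>E\<^esub>"
        using sep[OF G z(1)] by blast
      then have "c' \<in> Z" using \<beta>sym GD(1) by (auto simp: Z_def)
      then show False using z c' \<beta>sym by metis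
    qed
    then have "z = \<zero>\<^bsub>K\<^esub>" using inter_G z(1) by blast
    then show False using z(3) \<beta>sym[OF z(1) c] \<beta>0[OF c] by simp
  qed

  have choice: "\<exists>k. l < k \<and> (\<forall>r\<in>carrier R. \<forall>g\<in>G (Suc n). y [^]\<^bsub>R\<^esub> n \<odot>\<^bsub>K\<^esub> w k \<noteq> r \<odot>\<^bsub>K\<^esub> w l \<oplus>\<^bsub>K\<^esub> g)" for l n
  proof (rule ccontr)
    assume no: "\<not> ?thesis"
    \<comment> \<open>The contraction of y^(n+1) S to \<open>R\<close>. If no k works, clearing
      denominators puts y^n into I + \<mm>^d for each d; Krull's theorem then gives y^n in y^(n+1)
      S, and y would be a unit of \<open>S\<close>.\<close>
    define I where "I = {r \<in> carrier R. r \<odot>\<^bsub>K\<^esub> u \<in> G (Suc n)}"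
    have I: "ideal I R"
    proof (rule idealI)
      show "subgroup I (add_monoid R)"
        by (rule R.add.subgroupI) (use GD u in \<open>auto simp: I_def K.smult_l_distr K.smult_l_minus
            intro!: exI[of _ "\<zero>\<^bsub>R\<^esub>"] K.submoduleE(3)[OF G]\<close>)
      show "r \<otimes>\<^bsub>R\<^esub> a \<in> I" if "a \<in> I" "r \<in> carrier R" for a r
        using that GD(4)[of r "a \<odot>\<^bsub>K\<^esub> u" "Suc n"] u by (simp add: I_def K.smult_assoc1)
      then show "a \<otimes>\<^bsub>R\<^esub> r \<in> I" if "a \<in> I" "r \<in> carrier R" for a r
        using that m_comm[of a r] by (simp add: I_def)
    qed (rule R.ring_axioms)
    have "y [^]\<^bsub>R\<^esub> n \<in> I"
    proof (rule Krull_intersection[OF I ynp(2)])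
      fix d
      \<comment> \<open>With exponent l + d + 1 a factor x^(d+1) is left over when the denominator
        x^l is cleared, and this factor lies in \<mm>^d.\<close>
      obtain r g where rg: "r \<in> carrier R" "g \<in> G (Suc n)" "y [^]\<^bsub>R\<^esub> n \<odot>\<^bsub>K\<^esub> w (l + Suc d) = r \<odot>\<^bsub>K\<^esub> w l \<oplus>\<^bsub>K\<^esub> g"
        using no by (metis less_add_Suc1 add_Suc_right)
      let ?x = "x [^]\<^bsub>R\<^esub> (l + Suc d)"
      have xd: "?x = x [^]\<^bsub>R\<^esub> Suc d \<otimes>\<^bsub>R\<^esub> x [^]\<^bsub>R\<^esub> l" using xc R.nat_pow_mult[OF xc, of "Suc d" l] by (simp add: add.commute)
      have gc: "g \<in> carrier K" using GD(1) rg by blast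
      have "y [^]\<^bsub>R\<^esub> n \<odot>\<^bsub>K\<^esub> u = ?x \<odot>\<^bsub>K\<^esub> (y [^]\<^bsub>R\<^esub> n \<odot>\<^bsub>K\<^esub> w (l + Suc d))"
        using wu[of "l + Suc d"] K.smult_swap[OF xnp(2) ynp(2) w(1)] by metis
      also have "\<dots> = r \<odot>\<^bsub>K\<^esub> (?x \<odot>\<^bsub>K\<^esub> w l) \<oplus>\<^bsub>K\<^esub> ?x \<odot>\<^bsub>K\<^esub> g"
        unfolding rg(3) using rg(1) gc w(1) xc by (simp add: K.smult_r_distr K.smult_swap[of _ r] del: nat_pow_Suc add_Suc_right)
      also have "?x \<odot>\<^bsub>K\<^esub> w l = x [^]\<^bsub>R\<^esub> Suc d \<odot>\<^bsub>K\<^esub> u"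
        unfolding xd by (simp only: K.smult_assoc1[OF xnp(2) xnp(2) w(1)] wu)
      finally have eq: "y [^]\<^bsub>R\<^esub> n \<odot>\<^bsub>K\<^esub> u = (r \<otimes>\<^bsub>R\<^esub> x [^]\<^bsub>R\<^esub> Suc d) \<odot>\<^bsub>K\<^esub> u \<oplus>\<^bsub>K\<^esub> ?x \<odot>\<^bsub>K\<^esub> g"
        by (simp only: K.smult_assoc1[OF rg(1) xnp(2) u(1)])
      define b where "b = r \<otimes>\<^bsub>R\<^esub> x [^]\<^bsub>R\<^esub> Suc d"
      have b: "b \<in> carrier R" "b \<in> ideal_pow R \<mm> d"
      proof -
        show "b \<in> carrier R" using rg xc by (simp add: b_def)
        have "x [^]\<^bsub>R\<^esub> Suc d \<in> ideal_pow R \<mm> d"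
          using pow_mem_ideal_pow[OF ideal_max x(1), of "Suc d"] ideal_pow_decreasing[OF ideal_max, of d "Suc d"] by auto
        then show "b \<in> ideal_pow R \<mm> d" unfolding b_def using rg(1) by (intro ideal.I_l_closed[OF ideal_max_pow])
      qed
      have "(y [^]\<^bsub>R\<^esub> n \<ominus>\<^bsub>R\<^esub> b) \<odot>\<^bsub>K\<^esub> u = ?x \<odot>\<^bsub>K\<^esub> g"
        using eq[folded b_def] K.smult_closed[OF xnp(2) gc, of "l + Suc d"] b u yc
        by (simp add: K.smult_l_diff K.M.minus_eq K.M.a_comm K.M.r_neg1 del: nat_pow_Suc add_Suc_right)
      then have "y [^]\<^bsub>R\<^esub> n \<ominus>\<^bsub>R\<^esub> b \<in> I" using GD(4)[OF xnp(2) rg(2)] b yc by (simp add: I_def del: nat_pow_Suc add_Suc_right)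
      then show "y [^]\<^bsub>R\<^esub> n \<in> I <+>\<^bsub>R\<^esub> ideal_pow R \<mm> d"
        unfolding set_add_def' using b R.add_minus_cancel[of "y [^]\<^bsub>R\<^esub> n" b] yc by fastforce
    qed
    then obtain v where v: "v \<in> S" "y [^]\<^bsub>R\<^esub> n \<odot>\<^bsub>K\<^esub> u = y [^]\<^bsub>R\<^esub> Suc n \<odot>\<^bsub>K\<^esub> v" by (auto simp: I_def G_def)
    have vc: "v \<in> carrier K" using SD(1) v by blast
    then have "y [^]\<^bsub>R\<^esub> n \<odot>\<^bsub>K\<^esub> u = y [^]\<^bsub>R\<^esub> n \<odot>\<^bsub>K\<^esub> (y \<odot>\<^bsub>K\<^esub> v)" using v yc by (simp add: K.smult_assoc1)
    then have uy: "u = y \<odot>\<^bsub>K\<^esub> v" using inj[OF ynp(1) u(1), of "y \<odot>\<^bsub>K\<^esub> v"] yc vc by simp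
    obtain r i where ri: "r \<in> carrier R" "v = r \<odot>\<^bsub>K\<^esub> w i" using v by (auto simp: S_def)
    have "x [^]\<^bsub>R\<^esub> i \<odot>\<^bsub>K\<^esub> u = x [^]\<^bsub>R\<^esub> i \<odot>\<^bsub>K\<^esub> (y \<odot>\<^bsub>K\<^esub> (r \<odot>\<^bsub>K\<^esub> w i))" using uy ri by simp
    also have "\<dots> = (r \<otimes>\<^bsub>R\<^esub> y) \<odot>\<^bsub>K\<^esub> (x [^]\<^bsub>R\<^esub> i \<odot>\<^bsub>K\<^esub> w i)"
      using ri(1) yc xc w(1) by (simp add: K.smult_assoc1[symmetric] m_ac)
    finally have "x [^]\<^bsub>R\<^esub> i \<odot>\<^bsub>K\<^esub> u = (r \<otimes>\<^bsub>R\<^esub> y) \<odot>\<^bsub>K\<^esub> u" using wu by simp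
    then have "x [^]\<^bsub>R\<^esub> i \<ominus>\<^bsub>R\<^esub> r \<otimes>\<^bsub>R\<^esub> y \<in> \<pp>"
      by (subst (asm) smult_eq[OF xnp(2) m_closed[OF ri(1) yc] u])
    then show False using xq[OF ri(1)] by blast
  qed
  \<comment> \<open>Step n of the recursion fixes the exponent for index n + 1, as each exponent is
    compared with its predecessor; the first one is free.\<close>
  have "\<exists>k. \<forall>n. True \<and> (k n < k (Suc n) \<and> (\<forall>r\<in>carrier R. \<forall>g\<in>G (Suc (Suc n)).
    y [^]\<^bsub>R\<^esub> Suc n \<odot>\<^bsub>K\<^esub> w (k (Suc n)) \<noteq> r \<odot>\<^bsub>K\<^esub> w (k n) \<oplus>\<^bsub>K\<^esub> g))"
  proof (rule dependent_nat_choice)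
    show "\<exists>k. True \<and> l < k \<and> (\<forall>r\<in>carrier R. \<forall>g\<in>G (Suc (Suc n)).
      y [^]\<^bsub>R\<^esub> Suc n \<odot>\<^bsub>K\<^esub> w k \<noteq> r \<odot>\<^bsub>K\<^esub> w l \<oplus>\<^bsub>K\<^esub> g)" for l n
      using choice[of l "Suc n"] by blast
  qed simp
  then obtain k where k: "\<And>n. k n < k (Suc n)"
    "\<And>n r g. r \<in> carrier R \<Longrightarrow> g \<in> G (Suc (Suc n)) \<Longrightarrow>
       y [^]\<^bsub>R\<^esub> Suc n \<odot>\<^bsub>K\<^esub> w (k (Suc n)) \<noteq> r \<odot>\<^bsub>K\<^esub> w (k n) \<oplus>\<^bsub>K\<^esub> g" by blast
  have kn: "n \<le> k n" for n
    by (induction n) (use k(1) in \<open>auto intro: le_less_trans Suc_leI\<close>)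
  define z where "z n = y [^]\<^bsub>R\<^esub> n \<odot>\<^bsub>K\<^esub> w (k n)" for n
  have wS: "w n \<in> S" for n using SI[of "\<one>\<^bsub>R\<^esub>" n] w(1) by simp
  have zG: "z n \<in> G n" for n unfolding z_def using wS by (rule GI)
  have zc: "z n \<in> carrier K" for n using GD(1) zG by blast
  define \<sigma> where "\<sigma> = rec_nat \<zero>\<^bsub>K\<^esub> (\<lambda>n s. s \<oplus>\<^bsub>K\<^esub> z n)"
  have \<sigma>: "\<sigma> 0 = \<zero>\<^bsub>K\<^esub>" "\<And>n. \<sigma> (Suc n) = \<sigma> n \<oplus>\<^bsub>K\<^esub> z n" by (simp_all add: \<sigma>_def)
  have \<sigma>S: "\<sigma> n \<in> S" for n
  proof (induction n)
    case (Suc n)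
    then show ?case unfolding \<sigma>(2) using SD(3)[OF Suc] zG[of n] GS[of n] by blast
  qed (simp add: \<sigma>(1) SD(2))
  have \<sigma>c: "\<sigma> n \<in> carrier K" for n using SD(1) \<sigma>S by blast
  have wle: "\<exists>r\<in>carrier R. w i = r \<odot>\<^bsub>K\<^esub> w j" if "i \<le> j" for i j
    using w(4)[of "j - i" i] that xnp(2)[of "j - i"] by (intro bexI[of _ "x [^]\<^bsub>R\<^esub> (j - i)"]) auto
  \<comment> \<open>The exponents increase, so the partial sum through index n has the common
    denominator x^(k n).\<close>
  have \<sigma>w: "\<exists>r\<in>carrier R. \<sigma> (Suc n) = r \<odot>\<^bsub>K\<^esub> w (k n)" for n
  proof (induction n)
    case 0
    then show ?case using \<sigma> zc[of 0] yc w(1) by (intro bexI[of _ "\<one>\<^bsub>R\<^esub>"]) (auto simp: z_def)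
  next
    case (Suc n)
    then obtain r where r: "r \<in> carrier R" "\<sigma> (Suc n) = r \<odot>\<^bsub>K\<^esub> w (k n)" by blast
    obtain t where t: "t \<in> carrier R" "w (k n) = t \<odot>\<^bsub>K\<^esub> w (k (Suc n))" using wle[of "k n" "k (Suc n)"] k(1)[of n] by auto
    have "\<sigma> (Suc (Suc n)) = (r \<otimes>\<^bsub>R\<^esub> t \<oplus>\<^bsub>R\<^esub> y [^]\<^bsub>R\<^esub> Suc n) \<odot>\<^bsub>K\<^esub> w (k (Suc n))"
      using \<sigma>(2)[of "Suc n"] r t w(1) yc by (simp add: z_def K.smult_l_distr K.smult_assoc1 del: nat_pow_Suc)
    then show ?case using r t yc by blast
  qed
  \<comment> \<open>The infinite sum paired with c: by \<open>kills_G\<close> its terms contribute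
    nothing from some index on, and by \<open>stab\<close> the choice of the cutoff is
    immaterial.\<close>
  define \<Phi> where "\<Phi> c = \<beta> c (\<sigma> (SOME j. \<forall>v\<in>G j. \<beta> c v = \<zero>\<^bsub>E\<^esub>))" for c
  have stab: "\<beta> c (\<sigma> (j + i)) = \<beta> c (\<sigma> j)" if c: "c \<in> carrier K" "\<forall>v\<in>G j. \<beta> c v = \<zero>\<^bsub>E\<^esub>" for c i j
  proof (induction i)
    case (Suc i)
    have "z (j + i) \<in> G j" using zG Gmono[of j "j + i"] by auto
    then show ?case using Suc \<beta>add[OF c(1) \<sigma>c zc, of "j + i" "j + i"] c(2) \<beta>c[OF c(1) \<sigma>c[of j]] by (simp add: \<sigma>(2))
  qed simp
  have \<Phi>: "\<Phi> c = \<beta> c (\<sigma> j)" if c: "c \<in> carrier K" "\<forall>v\<in>G j. \<beta> c v = \<zero>\<^bsub>E\<^esub>" for c j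
  proof -
    define i where "i = (SOME j. \<forall>v\<in>G j. \<beta> c v = \<zero>\<^bsub>E\<^esub>)"
    have i: "\<forall>v\<in>G i. \<beta> c v = \<zero>\<^bsub>E\<^esub>" unfolding i_def using kills_G[OF c(1)] by (rule someI_ex)
    show ?thesis using stab[OF c, of i] stab[OF c(1) i, of j] by (simp add: \<Phi>_def add.commute flip: i_def)
  qed
  have "linear_map R K E \<Phi>"
    unfolding linear_map_def
  proof (intro conjI ballI)
    fix c assume "c \<in> carrier K"
    then show "\<Phi> c \<in> carrier E" using \<beta>c \<sigma>c by (simp add: \<Phi>_def)
  next
    fix c c' assume c: "c \<in> carrier K" "c' \<in> carrier K"
    obtain i i' where i: "\<forall>v\<in>G i. \<beta> c v = \<zero>\<^bsub>E\<^esub>" "\<forall>v\<in>G i'. \<beta> c' v = \<zero>\<^bsub>E\<^esub>"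
      using kills_G[OF c(1)] kills_G[OF c(2)] by metis
    define j where "j = i + i'"
    have j: "\<forall>v\<in>G j. \<beta> c v = \<zero>\<^bsub>E\<^esub>" "\<forall>v\<in>G j. \<beta> c' v = \<zero>\<^bsub>E\<^esub>"
      using i Gmono[of i j] Gmono[of i' j] by (auto simp only: j_def le_add1 le_add2 subset_iff)
    have add: "\<beta> (c \<oplus>\<^bsub>K\<^esub> c') v = \<beta> c v \<oplus>\<^bsub>E\<^esub> \<beta> c' v" if "v \<in> carrier K" for v
      using \<beta>add[OF that c] \<beta>sym that c by simp
    have "\<forall>v\<in>G j. \<beta> (c \<oplus>\<^bsub>K\<^esub> c') v = \<zero>\<^bsub>E\<^esub>"
    proof
      fix v assume "v \<in> G j"
      then show "\<beta> (c \<oplus>\<^bsub>K\<^esub> c') v = \<zero>\<^bsub>E\<^esub>" using add[OF GD(1)] j by simp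
    qed
    then show "\<Phi> (c \<oplus>\<^bsub>K\<^esub> c') = \<Phi> c \<oplus>\<^bsub>E\<^esub> \<Phi> c'"
      using \<Phi>[OF c(1) j(1)] \<Phi>[OF c(2) j(2)] \<Phi>[of "c \<oplus>\<^bsub>K\<^esub> c'" j] c add[OF \<sigma>c] by simp
  next
    fix r c assume r: "r \<in> carrier R" and c: "c \<in> carrier K"
    obtain j where j: "\<forall>v\<in>G j. \<beta> c v = \<zero>\<^bsub>E\<^esub>" using kills_G[OF c] by blast
    have sm: "\<beta> (r \<odot>\<^bsub>K\<^esub> c) v = r \<odot>\<^bsub>E\<^esub> \<beta> c v" if "v \<in> carrier K" for v
      using \<beta>smult[OF that r c] \<beta>sym that c r by simp
    have "\<forall>v\<in>G j. \<beta> (r \<odot>\<^bsub>K\<^esub> c) v = \<zero>\<^bsub>E\<^esub>"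
    proof
      fix v assume "v \<in> G j"
      then show "\<beta> (r \<odot>\<^bsub>K\<^esub> c) v = \<zero>\<^bsub>E\<^esub>" using sm[OF GD(1)] j r by simp
    qed
    then show "\<Phi> (r \<odot>\<^bsub>K\<^esub> c) = r \<odot>\<^bsub>E\<^esub> \<Phi> c"
      using \<Phi>[OF c j] \<Phi>[of "r \<odot>\<^bsub>K\<^esub> c" j] c r sm[OF \<sigma>c] by simp
  qed
  then obtain s where s: "s \<in> carrier K" "\<And>c. c \<in> carrier K \<Longrightarrow> \<Phi> c = \<beta> s c" using \<beta>univ by blast
  \<comment> \<open>Whatever is orthogonal to \<open>S\<close> is orthogonal to all partial sums and
    therefore to s; for s outside \<open>S\<close>, separation would contradict this.\<close>
  have "s \<in> S"
  proof (rule ccontr)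
    assume "s \<notin> S"
    then obtain c where c: "c \<in> carrier K" "\<And>v. v \<in> S \<Longrightarrow> \<beta> c v = \<zero>\<^bsub>E\<^esub>" "\<beta> c s \<noteq> \<zero>\<^bsub>E\<^esub>" using sep[OF S s(1)] by blast
    then have "\<Phi> c = \<zero>\<^bsub>E\<^esub>" using \<sigma>S by (simp add: \<Phi>_def)
    then show False using s c \<beta>sym by metis
  qed
  then obtain r a where ra: "r \<in> carrier R" "s = r \<odot>\<^bsub>K\<^esub> w a" by (auto simp: S_def)
  \<comment> \<open>The same argument for \<open>G n\<close>: whatever annihilates
    \<open>G n\<close> has the same pairing with s as with the partial sum.\<close>
  have sG: "s \<ominus>\<^bsub>K\<^esub> \<sigma> n \<in> G n" for n
  proof (rule ccontr)
    assume "s \<ominus>\<^bsub>K\<^esub> \<sigma> n \<notin> G n"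
    then obtain c where c: "c \<in> carrier K" "\<forall>v\<in>G n. \<beta> c v = \<zero>\<^bsub>E\<^esub>" "\<beta> c (s \<ominus>\<^bsub>K\<^esub> \<sigma> n) \<noteq> \<zero>\<^bsub>E\<^esub>"
      using sep[OF G, of "s \<ominus>\<^bsub>K\<^esub> \<sigma> n"] s(1) \<sigma>c by (metis K.M.minus_closed)
    have "\<beta> c s = \<beta> c (\<sigma> n)" using \<Phi>[OF c(1,2)] s(2)[OF c(1)] \<beta>sym[OF c(1) s(1)] by simp
    then show False using \<beta>diff[OF c(1) s(1) \<sigma>c, of n] c(3) \<beta>c[OF c(1) \<sigma>c] M.minus_eq_zero by simp
  qed
  \<comment> \<open>Now s = r u/x^a with a \<le> k a, so s and the partial sum through index a both
    have denominator x^(k a). Their difference agrees with the summand of index a + 1 modulo y^(a+2)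
    S, which the choice of its exponent excludes.\<close>
  obtain t where t: "t \<in> carrier R" "w a = t \<odot>\<^bsub>K\<^esub> w (k a)" using wle[OF kn[of a]] by blast
  obtain b where b: "b \<in> carrier R" "\<sigma> (Suc a) = b \<odot>\<^bsub>K\<^esub> w (k a)" using \<sigma>w by blast
  define g where "g = \<ominus>\<^bsub>K\<^esub> (s \<ominus>\<^bsub>K\<^esub> \<sigma> (Suc (Suc a)))"
  have g: "g \<in> G (Suc (Suc a))" unfolding g_def by (rule K.submoduleE(3)[OF G sG])
  have "z (Suc a) = (s \<ominus>\<^bsub>K\<^esub> \<sigma> (Suc a)) \<oplus>\<^bsub>K\<^esub> g"
  proof -
    have "(s \<ominus>\<^bsub>K\<^esub> \<sigma> (Suc a)) \<oplus>\<^bsub>K\<^esub> g = s \<oplus>\<^bsub>K\<^esub> (\<ominus>\<^bsub>K\<^esub> \<sigma> (Suc a) \<oplus>\<^bsub>K\<^esub> (\<ominus>\<^bsub>K\<^esub> s \<oplus>\<^bsub>K\<^esub> (\<sigma> (Suc a) \<oplus>\<^bsub>K\<^esub> z (Suc a))))"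
      using s(1) \<sigma>c[of "Suc a"] zc[of "Suc a"]
      by (simp add: g_def K.M.minus_eq \<sigma>(2)[of "Suc a"] K.M.minus_add K.M.a_assoc del: \<sigma>)
    also have "\<dots> = z (Suc a)"
      using s(1) \<sigma>c[of "Suc a"] zc[of "Suc a"] by (simp add: K.M.a_lcomm[of "\<ominus>\<^bsub>K\<^esub> \<sigma> (Suc a)"] K.M.r_neg1 K.M.r_neg2 del: \<sigma>)
    finally show ?thesis by simp
  qed
  also have "s \<ominus>\<^bsub>K\<^esub> \<sigma> (Suc a) = (r \<otimes>\<^bsub>R\<^esub> t \<ominus>\<^bsub>R\<^esub> b) \<odot>\<^bsub>K\<^esub> w (k a)"
    using ra t b w(1) by (simp add: K.smult_l_diff K.smult_assoc1)
  finally show False using k(2)[of "r \<otimes>\<^bsub>R\<^esub> t \<ominus>\<^bsub>R\<^esub> b" g a] ra t b g by (simp add: z_def del: nat_pow_Suc)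
qed

end

section \<open>Quotient modules and adic completions\<close>

context module
begin

lemma mem_coset:
  assumes N: "submodule N R M" and x: "x \<in> carrier M"
  shows "y \<in> N +>\<^bsub>M\<^esub> x \<longleftrightarrow> y \<in> carrier M \<and> y \<ominus>\<^bsub>M\<^esub> x \<in> N"
proof
  note ND = submoduleD[OF N]
  assume "y \<in> N +>\<^bsub>M\<^esub> x"
  then obtain h where h: "h \<in> N" "y = h \<oplus>\<^bsub>M\<^esub> x" by (auto simp: a_r_coset_def')
  then show "y \<in> carrier M \<and> y \<ominus>\<^bsub>M\<^esub> x \<in> N" using x ND(1) by (simp add: M.minus_eq M.a_assoc M.r_neg)
next
  assume *: "y \<in> carrier M \<and> y \<ominus>\<^bsub>M\<^esub> x \<in> N"
  then have "y = (y \<ominus>\<^bsub>M\<^esub> x) \<oplus>\<^bsub>M\<^esub> x" using x by (simp add: M.add_minus_cancel)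
  then show "y \<in> N +>\<^bsub>M\<^esub> x" using * by (auto simp: a_r_coset_def')
qed

lemma diff_zero: "x \<in> carrier M \<Longrightarrow> x \<ominus>\<^bsub>M\<^esub> \<zero>\<^bsub>M\<^esub> = x"
  using M.add_minus_cancel[of x "\<zero>\<^bsub>M\<^esub>"] by simp

lemma diff_trans:
  "x \<in> carrier M \<Longrightarrow> y \<in> carrier M \<Longrightarrow> z \<in> carrier M \<Longrightarrow> (x \<ominus>\<^bsub>M\<^esub> y) \<oplus>\<^bsub>M\<^esub> (y \<ominus>\<^bsub>M\<^esub> z) = x \<ominus>\<^bsub>M\<^esub> z"
  by (simp add: M.minus_eq M.a_assoc M.r_neg1)

lemma add_diff_add:
  "x \<in> carrier M \<Longrightarrow> y \<in> carrier M \<Longrightarrow> x' \<in> carrier M \<Longrightarrow> y' \<in> carrier M \<Longrightarrow>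
    (x \<oplus>\<^bsub>M\<^esub> y) \<ominus>\<^bsub>M\<^esub> (x' \<oplus>\<^bsub>M\<^esub> y') = (x \<ominus>\<^bsub>M\<^esub> x') \<oplus>\<^bsub>M\<^esub> (y \<ominus>\<^bsub>M\<^esub> y')"
  by (simp add: M.minus_eq M.minus_add M.a_ac)

lemma diff_self: "x \<in> carrier M \<Longrightarrow> x \<ominus>\<^bsub>M\<^esub> x = \<zero>\<^bsub>M\<^esub>"
  by (simp add: M.minus_eq_zero)

lemma diff_swap:
  assumes "submodule N R M" "x \<in> carrier M" "y \<in> carrier M" "x \<ominus>\<^bsub>M\<^esub> y \<in> N" shows "y \<ominus>\<^bsub>M\<^esub> x \<in> N"
  using submodule_minus[OF assms(1) submodule_zero[OF assms(1)] assms(4)] assms(2,3)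
  by (simp add: M.minus_eq M.minus_add M.a_comm)

lemma coset_eq_iff:
  assumes N: "submodule N R M" and x: "x \<in> carrier M" and y: "y \<in> carrier M"
  shows "N +>\<^bsub>M\<^esub> x = N +>\<^bsub>M\<^esub> y \<longleftrightarrow> x \<ominus>\<^bsub>M\<^esub> y \<in> N"
proof
  assume "N +>\<^bsub>M\<^esub> x = N +>\<^bsub>M\<^esub> y"
  moreover have "x \<in> N +>\<^bsub>M\<^esub> x" using mem_coset[OF N x] x submodule_zero[OF N] by (simp add: diff_self)
  ultimately show "x \<ominus>\<^bsub>M\<^esub> y \<in> N" using mem_coset[OF N y] by simp
next
  assume *: "x \<ominus>\<^bsub>M\<^esub> y \<in> N"
  have "z \<in> N +>\<^bsub>M\<^esub> x \<longleftrightarrow> z \<in> N +>\<^bsub>M\<^esub> y" for z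
    unfolding mem_coset[OF N x] mem_coset[OF N y]
    using submodule_add[OF N _ *, of "z \<ominus>\<^bsub>M\<^esub> x"] submodule_add[OF N _ diff_swap[OF N x y *], of "z \<ominus>\<^bsub>M\<^esub> y"]
      diff_trans[of z x y] diff_trans[of z y x] x y by auto
  then show "N +>\<^bsub>M\<^esub> x = N +>\<^bsub>M\<^esub> y" by blast
qed

lemma coset_zero: "submodule N R M \<Longrightarrow> N +>\<^bsub>M\<^esub> \<zero>\<^bsub>M\<^esub> = N"
  using mem_coset[of N "\<zero>\<^bsub>M\<^esub>"] submodule_carrier[of N] by (auto simp: diff_zero)

lemma carrier_quot_module: "carrier (quot_module M N) = (\<lambda>x. N +>\<^bsub>M\<^esub> x) ` carrier M"
  by (auto simp: quot_module_def A_RCOSETS_def')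

lemma zero_quot_module: "submodule N R M \<Longrightarrow> \<zero>\<^bsub>quot_module M N\<^esub> = N +>\<^bsub>M\<^esub> \<zero>\<^bsub>M\<^esub>"
  by (simp add: quot_module_def coset_zero)

lemma add_quot_module:
  assumes N: "submodule N R M" and x: "x \<in> carrier M" and y: "y \<in> carrier M"
  shows "(N +>\<^bsub>M\<^esub> x) \<oplus>\<^bsub>quot_module M N\<^esub> (N +>\<^bsub>M\<^esub> y) = N +>\<^bsub>M\<^esub> (x \<oplus>\<^bsub>M\<^esub> y)"
proof -
  note ND = submoduleD[OF N]
  have "z \<in> (N +>\<^bsub>M\<^esub> x) <+>\<^bsub>M\<^esub> (N +>\<^bsub>M\<^esub> y) \<longleftrightarrow> z \<in> N +>\<^bsub>M\<^esub> (x \<oplus>\<^bsub>M\<^esub> y)" for z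
  proof
    assume "z \<in> (N +>\<^bsub>M\<^esub> x) <+>\<^bsub>M\<^esub> (N +>\<^bsub>M\<^esub> y)"
    then obtain a b where ab: "a \<in> N +>\<^bsub>M\<^esub> x" "b \<in> N +>\<^bsub>M\<^esub> y" "z = a \<oplus>\<^bsub>M\<^esub> b" by (auto simp: set_add_def')
    then have "a \<in> carrier M" "b \<in> carrier M" "a \<ominus>\<^bsub>M\<^esub> x \<in> N" "b \<ominus>\<^bsub>M\<^esub> y \<in> N"
      unfolding mem_coset[OF N x] mem_coset[OF N y] by auto
    then show "z \<in> N +>\<^bsub>M\<^esub> (x \<oplus>\<^bsub>M\<^esub> y)"
      unfolding mem_coset[OF N M.a_closed[OF x y]] ab(3) using x y ND(3) by (simp add: add_diff_add)
  next
    assume "z \<in> N +>\<^bsub>M\<^esub> (x \<oplus>\<^bsub>M\<^esub> y)"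
    then obtain h where h: "h \<in> N" "z = h \<oplus>\<^bsub>M\<^esub> (x \<oplus>\<^bsub>M\<^esub> y)" by (auto simp: a_r_coset_def')
    then have "z = (h \<oplus>\<^bsub>M\<^esub> x) \<oplus>\<^bsub>M\<^esub> (\<zero>\<^bsub>M\<^esub> \<oplus>\<^bsub>M\<^esub> y)" using x y ND(1) by (simp add: M.a_assoc)
    moreover have "h \<oplus>\<^bsub>M\<^esub> x \<in> N +>\<^bsub>M\<^esub> x" "\<zero>\<^bsub>M\<^esub> \<oplus>\<^bsub>M\<^esub> y \<in> N +>\<^bsub>M\<^esub> y" using h(1) ND(2) by (auto simp: a_r_coset_def')
    ultimately show "z \<in> (N +>\<^bsub>M\<^esub> x) <+>\<^bsub>M\<^esub> (N +>\<^bsub>M\<^esub> y)" unfolding set_add_def' by blast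
  qed
  then show ?thesis by (auto simp: quot_module_def)
qed

lemma smult_quot_module:
  assumes N: "submodule N R M" and r: "r \<in> carrier R" and x: "x \<in> carrier M"
  shows "r \<odot>\<^bsub>quot_module M N\<^esub> (N +>\<^bsub>M\<^esub> x) = N +>\<^bsub>M\<^esub> (r \<odot>\<^bsub>M\<^esub> x)"
proof -
  have "N +>\<^bsub>M\<^esub> (r \<odot>\<^bsub>M\<^esub> y) = N +>\<^bsub>M\<^esub> (r \<odot>\<^bsub>M\<^esub> x)" if "y \<in> N +>\<^bsub>M\<^esub> x" for y
  proof -
    have y: "y \<in> carrier M" "y \<ominus>\<^bsub>M\<^esub> x \<in> N" using that unfolding mem_coset[OF N x] by auto
    have "r \<odot>\<^bsub>M\<^esub> y \<ominus>\<^bsub>M\<^esub> r \<odot>\<^bsub>M\<^esub> x \<in> N"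
      using submodule_smult[OF N r y(2)] unfolding smult_r_diff[OF r y(1) x] .
    then show ?thesis unfolding coset_eq_iff[OF N smult_closed[OF r y(1)] smult_closed[OF r x]] .
  qed
  moreover have "x \<in> N +>\<^bsub>M\<^esub> x" using mem_coset[OF N x] x submodule_zero[OF N] by (simp add: diff_self)
  ultimately have "(\<Union>y\<in>N +>\<^bsub>M\<^esub> x. N +>\<^bsub>M\<^esub> (r \<odot>\<^bsub>M\<^esub> y)) = N +>\<^bsub>M\<^esub> (r \<odot>\<^bsub>M\<^esub> x)" by blast
  then show ?thesis by (simp add: quot_module_def)
qed

lemma module_quot_module:
  assumes N: "submodule N R M" shows "module R (quot_module M N)"
proof (intro moduleI abelian_groupI)
  show "\<exists>y\<in>carrier (quot_module M N). y \<oplus>\<^bsub>quot_module M N\<^esub> x = \<zero>\<^bsub>quot_module M N\<^esub>"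
    if "x \<in> carrier (quot_module M N)" for x
  proof -
    obtain a where a: "a \<in> carrier M" "x = N +>\<^bsub>M\<^esub> a"
      using \<open>x \<in> carrier (quot_module M N)\<close> by (auto simp: carrier_quot_module)
    then show ?thesis using N
      by (intro bexI[of _ "N +>\<^bsub>M\<^esub> (\<ominus>\<^bsub>M\<^esub> a)"]) (auto simp: carrier_quot_module add_quot_module zero_quot_module M.l_neg)
  qed
qed (use N in \<open>auto simp: carrier_quot_module add_quot_module smult_quot_module zero_quot_module M.a_ac
    smult_l_distr smult_r_distr smult_assoc1 R.is_cring\<close>)

lemma minus_quot_module:
  assumes N: "submodule N R M" and x: "x \<in> carrier M" and y: "y \<in> carrier M"
  shows "(N +>\<^bsub>M\<^esub> x) \<ominus>\<^bsub>quot_module M N\<^esub> (N +>\<^bsub>M\<^esub> y) = N +>\<^bsub>M\<^esub> (x \<ominus>\<^bsub>M\<^esub> y)"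
proof -
  interpret Q: module R "quot_module M N" by (rule module_quot_module[OF N])
  have c: "N +>\<^bsub>M\<^esub> z \<in> carrier (quot_module M N)" if "z \<in> carrier M" for z using that by (auto simp: carrier_quot_module)
  have "\<ominus>\<^bsub>quot_module M N\<^esub> (N +>\<^bsub>M\<^esub> y) = N +>\<^bsub>M\<^esub> (\<ominus>\<^bsub>M\<^esub> y)"
    by (rule Q.M.minus_equality) (use y c in \<open>auto simp: add_quot_module[OF N] zero_quot_module[OF N] M.l_neg\<close>)
  then show ?thesis using x y by (simp add: Q.M.minus_eq M.minus_eq add_quot_module[OF N])
qed

subsection \<open>Adic completions by coherent sequences\<close>

lemma submodule_ideal_smult:
  assumes "I \<subseteq> carrier R" shows "submodule (ideal_smult R I M) R M"
proof (rule submoduleI2)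
  show "ideal_smult R I M \<subseteq> carrier M"
    unfolding ideal_smult_def using carrier_is_submodule assms by (intro Inter_lower) auto
qed (auto simp: ideal_smult_def submoduleD)

lemma smult_mem_ideal_smult: "a \<in> I \<Longrightarrow> x \<in> carrier M \<Longrightarrow> a \<odot>\<^bsub>M\<^esub> x \<in> ideal_smult R I M"
  by (auto simp: ideal_smult_def)

lemma ideal_smult_subset:
  "submodule N R M \<Longrightarrow> (\<And>a x. a \<in> I \<Longrightarrow> x \<in> carrier M \<Longrightarrow> a \<odot>\<^bsub>M\<^esub> x \<in> N) \<Longrightarrow> ideal_smult R I M \<subseteq> N"
  by (auto simp: ideal_smult_def)

lemma adic_submodule_eq: "adic_submodule R I M n = ideal_smult R (ideal_pow R I n) M"
  by (simp add: adic_submodule_def ideal_pow_def)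

lemma submodule_adic_submodule:
  assumes "ideal I R" shows "submodule (adic_submodule R I M n) R M"
  unfolding adic_submodule_eq
  using ideal_ideal_pow[OF assms] by (intro submodule_ideal_smult) (auto dest: ideal.Icarr)

lemma adic_submodule_Suc_subset:
  assumes "ideal I R" shows "adic_submodule R I M (Suc n) \<subseteq> adic_submodule R I M n"
  unfolding adic_submodule_eq[of I "Suc n"]
proof (rule ideal_smult_subset[OF submodule_adic_submodule[OF assms]])
  show "a \<odot>\<^bsub>M\<^esub> x \<in> adic_submodule R I M n" if "a \<in> ideal_pow R I (Suc n)" "x \<in> carrier M" for a x
    unfolding adic_submodule_eq using that ideal_pow_decreasing[OF assms, of n "Suc n"]
    by (intro smult_mem_ideal_smult) auto
qed

lemma adic_submodule_0:
  assumes "ideal I R" shows "adic_submodule R I M 0 = carrier M"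
proof
  show "carrier M \<subseteq> adic_submodule R I M 0"
    using smult_mem_ideal_smult[of "\<one>\<^bsub>R\<^esub>" "carrier R"] by (auto simp: adic_submodule_eq)
qed (use submodule_carrier[OF submodule_adic_submodule[OF assms]] in blast)

text \<open>Elements of the inverse limit are represented by sequences in \<open>M\<close>, so that
  operations can be computed termwise; two sequences count as equal when their n-th terms agree
  modulo the n-th submodule.\<close>

definition coherent :: "'a set \<Rightarrow> (nat \<Rightarrow> 'c) \<Rightarrow> bool" where
  "coherent I c \<longleftrightarrow> (\<forall>n. c n \<in> carrier M \<and> c (Suc n) \<ominus>\<^bsub>M\<^esub> c n \<in> adic_submodule R I M n)"

definition adic_class :: "'a set \<Rightarrow> (nat \<Rightarrow> 'c) \<Rightarrow> nat \<Rightarrow> 'c set" where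
  "adic_class I c = (\<lambda>n. adic_submodule R I M n +>\<^bsub>M\<^esub> c n)"

context
  fixes I assumes I: "ideal I R"
begin

lemmas adic_sub = submodule_adic_submodule[OF I]

lemma carrier_adic_completion:
  "carrier (adic_completion R I M) = adic_class I ` {c. coherent I c}"
proof
  have "\<exists>c. coherent I c \<and> x = adic_class I c" if x: "x \<in> carrier (adic_completion R I M)" for x
  proof -
    have "\<exists>c. c \<in> carrier M \<and> x n = adic_submodule R I M n +>\<^bsub>M\<^esub> c" for n
    proof -
      have "x n \<in> carrier (quot_module M (adic_submodule R I M n))" using x by (simp add: adic_completion_def Let_def)
      then show ?thesis unfolding carrier_quot_module by blast
    qed
    then obtain c where c: "\<And>n. c n \<in> carrier M" "\<And>n. x n = adic_submodule R I M n +>\<^bsub>M\<^esub> c n" by metis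
    have "c (Suc n) \<ominus>\<^bsub>M\<^esub> c n \<in> adic_submodule R I M n" for n
    proof -
      have "c (Suc n) \<in> x (Suc n)"
        unfolding c(2) mem_coset[OF adic_sub c(1)] using c(1) submodule_zero[OF adic_sub] by (simp add: diff_self)
      also have "x (Suc n) \<subseteq> x n" using x by (simp add: adic_completion_def Let_def)
      finally show ?thesis unfolding c(2) mem_coset[OF adic_sub c(1)] by simp
    qed
    then have "coherent I c" using c(1) by (simp add: coherent_def)
    moreover have "x = adic_class I c" using c(2) by (simp add: adic_class_def fun_eq_iff)
    ultimately show ?thesis by blast
  qed
  then show "carrier (adic_completion R I M) \<subseteq> adic_class I ` {c. coherent I c}" by blast
  have "adic_class I c \<in> carrier (adic_completion R I M)" if c: "coherent I c" for c
  proof -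
    have cc: "c n \<in> carrier M" "c (Suc n) \<ominus>\<^bsub>M\<^esub> c n \<in> adic_submodule R I M n" for n
      using c by (auto simp: coherent_def)
    have "adic_submodule R I M (Suc n) +>\<^bsub>M\<^esub> c (Suc n) \<subseteq> adic_submodule R I M n +>\<^bsub>M\<^esub> c n" for n
    proof
      fix y assume "y \<in> adic_submodule R I M (Suc n) +>\<^bsub>M\<^esub> c (Suc n)"
      then have y: "y \<in> carrier M" "y \<ominus>\<^bsub>M\<^esub> c (Suc n) \<in> adic_submodule R I M n"
        using adic_submodule_Suc_subset[OF I, of n] unfolding mem_coset[OF adic_sub cc(1)] by auto
      then show "y \<in> adic_submodule R I M n +>\<^bsub>M\<^esub> c n"
        using submodule_add[OF adic_sub y(2) cc(2)] cc(1) unfolding mem_coset[OF adic_sub cc(1)]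
        by (simp add: diff_trans)
    qed
    then show ?thesis using cc(1) by (auto simp: adic_completion_def Let_def adic_class_def carrier_quot_module)
  qed
  then show "adic_class I ` {c. coherent I c} \<subseteq> carrier (adic_completion R I M)" by blast
qed

lemma adic_class_eq_iff:
  assumes "\<And>n. c n \<in> carrier M" "\<And>n. d n \<in> carrier M"
  shows "adic_class I c = adic_class I d \<longleftrightarrow> (\<forall>n. c n \<ominus>\<^bsub>M\<^esub> d n \<in> adic_submodule R I M n)"
  using coset_eq_iff[OF adic_sub] assms by (simp add: adic_class_def fun_eq_iff)

lemma adic_class_add:
  assumes "coherent I c" "coherent I d"
  shows "adic_class I c \<oplus>\<^bsub>adic_completion R I M\<^esub> adic_class I d = adic_class I (\<lambda>n. c n \<oplus>\<^bsub>M\<^esub> d n)"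
  using assms add_quot_module[OF adic_sub] by (simp add: adic_class_def coherent_def adic_completion_def Let_def)

lemma adic_class_smult:
  assumes "coherent I c" "r \<in> carrier R"
  shows "r \<odot>\<^bsub>adic_completion R I M\<^esub> adic_class I c = adic_class I (\<lambda>n. r \<odot>\<^bsub>M\<^esub> c n)"
  using assms smult_quot_module[OF adic_sub] by (simp add: adic_class_def coherent_def adic_completion_def Let_def)

lemma coherent_add: "coherent I c \<Longrightarrow> coherent I d \<Longrightarrow> coherent I (\<lambda>n. c n \<oplus>\<^bsub>M\<^esub> d n)"
  using submodule_add[OF adic_sub] by (simp add: coherent_def add_diff_add)

lemma coherent_smult: "r \<in> carrier R \<Longrightarrow> coherent I c \<Longrightarrow> coherent I (\<lambda>n. r \<odot>\<^bsub>M\<^esub> c n)"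
  using submodule_smult[OF adic_sub] by (simp add: coherent_def flip: smult_r_diff)

lemma coherent_const: "x \<in> carrier M \<Longrightarrow> coherent I (\<lambda>n. x)"
  using submodule_zero[OF adic_sub] by (simp add: coherent_def diff_self)

end

text \<open>For a submodule U this is a_1 U + ... + a_k U, by recursion so that one generator can be
  split off at a time.\<close>

fun list_span :: "'a list \<Rightarrow> 'c set \<Rightarrow> 'c set" where
  "list_span [] U = {\<zero>\<^bsub>M\<^esub>}"
| "list_span (a # as) U = {a \<odot>\<^bsub>M\<^esub> x \<oplus>\<^bsub>M\<^esub> v | x v. x \<in> U \<and> v \<in> list_span as U}"

lemma submodule_list_span:
  assumes U: "submodule U R M" and "set as \<subseteq> carrier R"
  shows "submodule (list_span as U) R M \<and> (\<forall>a\<in>set as. \<forall>x\<in>U. a \<odot>\<^bsub>M\<^esub> x \<in> list_span as U)"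
  using assms(2)
proof (induction as)
  case Nil
  show ?case by (auto intro!: submoduleI2)
next
  case (Cons a as)
  note UD = submoduleD[OF U]
  have a: "a \<in> carrier R" and V: "submodule (list_span as U) R M" using Cons by auto
  note VD = submoduleD[OF V]
  have LI: "a \<odot>\<^bsub>M\<^esub> x \<oplus>\<^bsub>M\<^esub> v \<in> list_span (a # as) U" if "x \<in> U" "v \<in> list_span as U" for x v
    using that by auto
  have "submodule (list_span (a # as) U) R M"
  proof (rule submoduleI2)
    show "list_span (a # as) U \<subseteq> carrier M" using a UD(1) VD(1) by auto
    show "\<zero>\<^bsub>M\<^esub> \<in> list_span (a # as) U" using LI[OF UD(2) VD(2)] a by simp
    show "x \<oplus>\<^bsub>M\<^esub> y \<in> list_span (a # as) U" if xy: "x \<in> list_span (a # as) U" "y \<in> list_span (a # as) U" for x y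
    proof -
      obtain p v p' v' where *: "p \<in> U" "v \<in> list_span as U" "p' \<in> U" "v' \<in> list_span as U"
        "x = a \<odot>\<^bsub>M\<^esub> p \<oplus>\<^bsub>M\<^esub> v" "y = a \<odot>\<^bsub>M\<^esub> p' \<oplus>\<^bsub>M\<^esub> v'" using xy by auto
      then have "x \<oplus>\<^bsub>M\<^esub> y = a \<odot>\<^bsub>M\<^esub> (p \<oplus>\<^bsub>M\<^esub> p') \<oplus>\<^bsub>M\<^esub> (v \<oplus>\<^bsub>M\<^esub> v')"
        using a UD(1) VD(1) by (simp add: smult_r_distr M.a_ac)
      then show ?thesis using LI[OF UD(3) VD(3)] * by simp
    qed
    show "r \<odot>\<^bsub>M\<^esub> x \<in> list_span (a # as) U" if rx: "r \<in> carrier R" "x \<in> list_span (a # as) U" for r x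
    proof -
      obtain p v where *: "p \<in> U" "v \<in> list_span as U" "x = a \<odot>\<^bsub>M\<^esub> p \<oplus>\<^bsub>M\<^esub> v" using rx by auto
      then have "r \<odot>\<^bsub>M\<^esub> x = a \<odot>\<^bsub>M\<^esub> (r \<odot>\<^bsub>M\<^esub> p) \<oplus>\<^bsub>M\<^esub> r \<odot>\<^bsub>M\<^esub> v"
        using a rx(1) UD(1) VD(1) by (simp add: smult_r_distr smult_swap[of r a])
      then show ?thesis using LI[OF UD(4) VD(4)] * rx(1) by simp
    qed
  qed
  moreover have "a \<odot>\<^bsub>M\<^esub> x \<in> list_span (a # as) U" if "x \<in> U" for x
    using LI[OF that VD(2)] a UD(1) that by simp
  moreover have "b \<odot>\<^bsub>M\<^esub> x \<in> list_span (a # as) U" if "b \<in> set as" "x \<in> U" for b x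
  proof -
    have "b \<odot>\<^bsub>M\<^esub> x \<in> list_span as U" using Cons that by auto
    then show ?thesis using LI[OF UD(2)] a VD(1) by fastforce
  qed
  ultimately show ?case by auto
qed

text \<open>The scalars carrying a given set into a submodule form an ideal, namely an annihilator
  in the quotient. So the inclusion has to be checked only on generators of \<open>I\<close> and on
  products of an element of I^n with one of \<open>I\<close>.\<close>

lemma adic_submodule_Suc_span:
  assumes "set as \<subseteq> carrier R" and I: "I = Idl\<^bsub>R\<^esub> (set as)"
  shows "adic_submodule R I M (Suc n) \<subseteq> list_span as (adic_submodule R I M n)"
proof -
  have Ii: "ideal I R" unfolding I using assms(1) by (rule genideal_ideal)
  let ?T = "list_span as (adic_submodule R I M n)"
  have T: "submodule ?T R M" "\<And>a x. a \<in> set as \<Longrightarrow> x \<in> adic_submodule R I M n \<Longrightarrow> a \<odot>\<^bsub>M\<^esub> x \<in> ?T"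
    using submodule_list_span[OF submodule_adic_submodule[OF Ii] assms(1)] by blast+
  note ND = submoduleD[OF submodule_adic_submodule[OF Ii]]
  have colon: "ideal {r \<in> carrier R. \<forall>x\<in>W. r \<odot>\<^bsub>M\<^esub> x \<in> ?T} R" if W: "W \<subseteq> carrier M" for W
  proof -
    interpret Q: module R "quot_module M ?T" by (rule module_quot_module[OF T(1)])
    have eq: "{r \<in> carrier R. \<forall>x\<in>W. r \<odot>\<^bsub>M\<^esub> x \<in> ?T}
      = {r \<in> carrier R. \<forall>x\<in>(\<lambda>x. ?T +>\<^bsub>M\<^esub> x) ` W. r \<odot>\<^bsub>quot_module M ?T\<^esub> x = \<zero>\<^bsub>quot_module M ?T\<^esub>}"
    proof (intro Collect_cong conj_cong refl)
      fix r assume r: "r \<in> carrier R"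
      have "r \<odot>\<^bsub>quot_module M ?T\<^esub> (?T +>\<^bsub>M\<^esub> x) = \<zero>\<^bsub>quot_module M ?T\<^esub> \<longleftrightarrow> r \<odot>\<^bsub>M\<^esub> x \<in> ?T" if "x \<in> W" for x
      proof -
        have "x \<in> carrier M" using that W by blast
        then show ?thesis
          unfolding smult_quot_module[OF T(1) r \<open>x \<in> carrier M\<close>] zero_quot_module[OF T(1)]
          using coset_eq_iff[OF T(1) smult_closed[OF r] M.zero_closed, of x] r by (simp add: diff_zero)
      qed
      then show "(\<forall>x\<in>W. r \<odot>\<^bsub>M\<^esub> x \<in> ?T) =
        (\<forall>x\<in>(\<lambda>x. ?T +>\<^bsub>M\<^esub> x) ` W. r \<odot>\<^bsub>quot_module M ?T\<^esub> x = \<zero>\<^bsub>quot_module M ?T\<^esub>)" by auto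
    qed
    have sub: "(\<lambda>x. ?T +>\<^bsub>M\<^esub> x) ` W \<subseteq> carrier (quot_module M ?T)"
      unfolding carrier_quot_module using W by (rule image_mono)
    show ?thesis unfolding eq by (rule Q.ideal_annihilator[OF sub])
  qed
  have IT: "I \<subseteq> {r \<in> carrier R. \<forall>x\<in>adic_submodule R I M n. r \<odot>\<^bsub>M\<^esub> x \<in> ?T}"
    unfolding I by (rule genideal_minimal[OF colon[unfolded I]]) (use T(2) ND(1) assms(1) I in auto)
  have "ideal_pow R I (Suc n) \<subseteq> {r \<in> carrier R. \<forall>x\<in>carrier M. r \<odot>\<^bsub>M\<^esub> x \<in> ?T}"
    unfolding ideal_pow_Suc
  proof (rule ideal_prod_subset[OF colon])
    fix a b assume ab: "a \<in> ideal_pow R I n" "b \<in> I"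
    have c: "a \<in> carrier R" "b \<in> carrier R" using ab ideal.Icarr[OF ideal_ideal_pow[OF Ii]] ideal.Icarr[OF Ii] by auto
    have "(a \<otimes>\<^bsub>R\<^esub> b) \<odot>\<^bsub>M\<^esub> x \<in> ?T" if x: "x \<in> carrier M" for x
    proof -
      have "a \<odot>\<^bsub>M\<^esub> x \<in> adic_submodule R I M n" unfolding adic_submodule_eq using ab(1) x by (rule smult_mem_ideal_smult)
      then have "b \<odot>\<^bsub>M\<^esub> (a \<odot>\<^bsub>M\<^esub> x) \<in> ?T" using IT ab(2) by blast
      then show ?thesis using c x smult_swap[of a b x] by (simp add: smult_assoc1)
    qed
    then show "a \<otimes>\<^bsub>R\<^esub> b \<in> {r \<in> carrier R. \<forall>x\<in>carrier M. r \<odot>\<^bsub>M\<^esub> x \<in> ?T}" using c by simp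
  qed simp
  then show ?thesis
    unfolding adic_submodule_eq[of I "Suc n"] by (intro ideal_smult_subset[OF T(1)]) blast
qed

text \<open>The part of the completion lying over \<open>IM\<close> is \<open>I\<close> times the completion when \<open>I\<close> is finitely
  generated; as sums over the generators are inconvenient, the conclusion is stated for every set \<open>Z\<close>
  that is closed under addition and contains the multiples by generators.\<close>

lemma completion_lift:
  assumes as: "set as \<subseteq> carrier R" and I: "I = Idl\<^bsub>R\<^esub> (set as)"
    and Z0: "adic_class I (\<lambda>n. \<zero>\<^bsub>M\<^esub>) \<in> Z"
    and Zadd: "\<And>x y. x \<in> Z \<Longrightarrow> y \<in> Z \<Longrightarrow> x \<in> carrier (adic_completion R I M) \<Longrightarrow>
      y \<in> carrier (adic_completion R I M) \<Longrightarrow> x \<oplus>\<^bsub>adic_completion R I M\<^esub> y \<in> Z"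
    and Zs: "\<And>a y. a \<in> set as \<Longrightarrow> y \<in> carrier (adic_completion R I M) \<Longrightarrow> a \<odot>\<^bsub>adic_completion R I M\<^esub> y \<in> Z"
    and c: "coherent I c" "c 1 \<in> adic_submodule R I M 1"
  shows "adic_class I c \<in> Z"
proof -
  have Ii: "ideal I R" unfolding I using as by (rule genideal_ideal)
  let ?N = "adic_submodule R I M"
  note N = submodule_adic_submodule[OF Ii]
  note ND = submoduleD[OF N]
  \<comment> \<open>The increments are split along the generators. Summing the parts that belong to
    one generator b gives a coherent sequence \<open>D\<close>, so that e is b \<open>D\<close> plus
    a sequence for the remaining generators.\<close>
  have main: "coherent I e \<and> adic_class I e \<in> Z"
    if "set bs \<subseteq> set as" "e 0 = \<zero>\<^bsub>M\<^esub>" "\<And>n. e n \<in> carrier M" "\<And>n. e (Suc n) \<ominus>\<^bsub>M\<^esub> e n \<in> list_span bs (?N n)" for bs e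
    using that
  proof (induction bs arbitrary: e)
    case Nil
    have "e n = \<zero>\<^bsub>M\<^esub>" for n by (induction n) (use Nil in \<open>auto simp: M.minus_eq_zero\<close>)
    then have "e = (\<lambda>n. \<zero>\<^bsub>M\<^esub>)" by blast
    then show ?case using Z0 coherent_const[OF Ii M.zero_closed] by simp
  next
    case (Cons b bs)
    have b: "b \<in> carrier R" "b \<in> set as" using Cons.prems(1) as by auto
    have "\<forall>n. \<exists>x v. x \<in> ?N n \<and> v \<in> list_span bs (?N n) \<and> e (Suc n) \<ominus>\<^bsub>M\<^esub> e n = b \<odot>\<^bsub>M\<^esub> x \<oplus>\<^bsub>M\<^esub> v"
      using Cons.prems(4) by fastforce
    then obtain d v where d: "\<And>n. d n \<in> ?N n" and v: "\<And>n. v n \<in> list_span bs (?N n)"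
      and ed: "\<And>n. e (Suc n) \<ominus>\<^bsub>M\<^esub> e n = b \<odot>\<^bsub>M\<^esub> d n \<oplus>\<^bsub>M\<^esub> v n" by metis
    have dc: "d n \<in> carrier M" for n using ND(1) d by blast
    have "set bs \<subseteq> carrier R" using Cons.prems(1) as by auto
    then have vc: "v n \<in> carrier M" for n using submodule_list_span[OF N] v submodule_carrier by blast
    define D where "D = rec_nat \<zero>\<^bsub>M\<^esub> (\<lambda>n x. x \<oplus>\<^bsub>M\<^esub> d n)"
    define V where "V = rec_nat \<zero>\<^bsub>M\<^esub> (\<lambda>n x. x \<oplus>\<^bsub>M\<^esub> v n)"
    have D: "D 0 = \<zero>\<^bsub>M\<^esub>" "\<And>n. D (Suc n) = D n \<oplus>\<^bsub>M\<^esub> d n" by (simp_all add: D_def)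
    have V: "V 0 = \<zero>\<^bsub>M\<^esub>" "\<And>n. V (Suc n) = V n \<oplus>\<^bsub>M\<^esub> v n" by (simp_all add: V_def)
    have Dc: "D n \<in> carrier M" for n by (induction n) (use D dc in auto)
    have Vc: "V n \<in> carrier M" for n by (induction n) (use V vc in auto)
    have step: "(x \<oplus>\<^bsub>M\<^esub> y) \<ominus>\<^bsub>M\<^esub> x = y" if "x \<in> carrier M" "y \<in> carrier M" for x y
      using that by (simp add: M.minus_eq M.a_comm[of x y] M.a_assoc M.r_neg)
    have Dcoh: "coherent I D" unfolding coherent_def using D d Dc dc by (simp add: step)
    have V': "coherent I V \<and> adic_class I V \<in> Z"
      by (rule Cons.IH) (use Cons.prems V Vc v vc in \<open>auto simp: step\<close>)
    have e: "e n = b \<odot>\<^bsub>M\<^esub> D n \<oplus>\<^bsub>M\<^esub> V n" for n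
    proof (induction n)
      case 0
      then show ?case using Cons.prems(2) D V b by simp
    next
      case (Suc n)
      have "e (Suc n) = (e (Suc n) \<ominus>\<^bsub>M\<^esub> e n) \<oplus>\<^bsub>M\<^esub> e n" using Cons.prems(3) by (simp add: M.add_minus_cancel)
      also have "\<dots> = (b \<odot>\<^bsub>M\<^esub> d n \<oplus>\<^bsub>M\<^esub> v n) \<oplus>\<^bsub>M\<^esub> e n" by (simp only: ed)
      also have "\<dots> = b \<odot>\<^bsub>M\<^esub> (D n \<oplus>\<^bsub>M\<^esub> d n) \<oplus>\<^bsub>M\<^esub> (V n \<oplus>\<^bsub>M\<^esub> v n)"
        unfolding Suc using b dc vc Dc Vc by (simp add: smult_r_distr M.a_ac)
      finally show ?case by (simp add: D V)
    qed
    have eq: "e = (\<lambda>n. b \<odot>\<^bsub>M\<^esub> D n \<oplus>\<^bsub>M\<^esub> V n)" using e by blast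
    have cl: "adic_class I g \<in> carrier (adic_completion R I M)" if "coherent I g" for g
      using that carrier_adic_completion[OF Ii] by blast
    have bD: "coherent I (\<lambda>n. b \<odot>\<^bsub>M\<^esub> D n)" "adic_class I (\<lambda>n. b \<odot>\<^bsub>M\<^esub> D n) \<in> Z"
      using coherent_smult[OF Ii b(1) Dcoh] Zs[OF b(2) cl[OF Dcoh]] adic_class_smult[OF Ii Dcoh b(1)] by auto
    show ?case
      unfolding eq using coherent_add[OF Ii bD(1)] V' adic_class_add[OF Ii bD(1)] Zadd[OF bD(2)] cl bD(1) by force
  qed
  have cc: "c n \<in> carrier M" "c (Suc n) \<ominus>\<^bsub>M\<^esub> c n \<in> ?N n" for n using c by (auto simp: coherent_def)
  \<comment> \<open>Shifted by one place, the increments lie in I^(n+1) M and are therefore sums of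
    generators times elements of I^n M. The start at 0 is legitimate since c 2 lies in IM, and place
    0 of a class carries no information.\<close>
  define e where "e n = (if n = 0 then \<zero>\<^bsub>M\<^esub> else c (Suc n))" for n
  have ec: "e n \<in> carrier M" for n by (simp add: e_def cc)
  have "e (Suc n) \<ominus>\<^bsub>M\<^esub> e n \<in> ?N (Suc n)" for n
  proof (cases "n = 0")
    case True
    have "c 2 \<in> ?N 1"
      using ND(3)[OF cc(2)[of 1] c(2)] cc by (simp add: M.add_minus_cancel numeral_2_eq_2)
    then show ?thesis using True cc by (simp add: e_def diff_zero numeral_2_eq_2)
  qed (simp add: e_def cc)
  then have "adic_class I e \<in> Z"
    using main[of as e] ec adic_submodule_Suc_span[OF as I] by (auto simp: e_def)
  moreover have "adic_class I e = adic_class I c"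
    unfolding adic_class_eq_iff[OF Ii ec cc(1)]
    using cc adic_submodule_0[OF Ii] by (auto simp: e_def)
  ultimately show ?thesis by simp
qed

end

section \<open>Localization\<close>

locale multiplicative_set = cring R for R (structure) +
  fixes S
  assumes S_subset: "S \<subseteq> carrier R" and S_one: "\<one> \<in> S"
    and S_mult: "s \<in> S \<Longrightarrow> t \<in> S \<Longrightarrow> s \<otimes> t \<in> S"
begin

lemma S_carrier [simp]: "s \<in> S \<Longrightarrow> s \<in> carrier R"
  using S_subset by blast

lemma mem_frac: "(b, t) \<in> frac R S a s \<longleftrightarrow> b \<in> carrier R \<and> t \<in> S \<and> (\<exists>v\<in>S. v \<otimes> (t \<otimes> a) = v \<otimes> (s \<otimes> b))"
  by (simp add: frac_def)

lemma frac_trans: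
  assumes c: "a \<in> carrier R" "b \<in> carrier R" "c \<in> carrier R" "s \<in> S" "t \<in> S" "r \<in> S"
    and "\<exists>v\<in>S. v \<otimes> (t \<otimes> a) = v \<otimes> (s \<otimes> b)" "\<exists>v\<in>S. v \<otimes> (r \<otimes> b) = v \<otimes> (t \<otimes> c)"
  shows "\<exists>v\<in>S. v \<otimes> (r \<otimes> a) = v \<otimes> (s \<otimes> c)"
proof -
  obtain v w where v: "v \<in> S" "v \<otimes> (t \<otimes> a) = v \<otimes> (s \<otimes> b)" and w: "w \<in> S" "w \<otimes> (r \<otimes> b) = w \<otimes> (t \<otimes> c)"
    using assms by blast
  \<comment> \<open>The middle denominator t joins v and w in the witness, so that both given
    equations can be applied in turn.\<close>
  have "(v \<otimes> (w \<otimes> t)) \<otimes> (r \<otimes> a) = (w \<otimes> r) \<otimes> (v \<otimes> (t \<otimes> a))" using c v(1) w(1) by (simp add: m_ac)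
  also have "\<dots> = (v \<otimes> s) \<otimes> (w \<otimes> (r \<otimes> b))" unfolding v(2) using c v(1) w(1) by (simp add: m_ac)
  also have "\<dots> = (v \<otimes> (w \<otimes> t)) \<otimes> (s \<otimes> c)" unfolding w(2) using c v(1) w(1) by (simp add: m_ac)
  finally show ?thesis using v w c S_mult by blast
qed

lemma frac_eq_iff:
  assumes c: "a \<in> carrier R" "b \<in> carrier R" "s \<in> S" "t \<in> S"
  shows "frac R S a s = frac R S b t \<longleftrightarrow> (\<exists>v\<in>S. v \<otimes> (t \<otimes> a) = v \<otimes> (s \<otimes> b))"
proof
  have "(b, t) \<in> frac R S b t" using c S_one by (auto simp: mem_frac)
  then show "\<exists>v\<in>S. v \<otimes> (t \<otimes> a) = v \<otimes> (s \<otimes> b)" if "frac R S a s = frac R S b t"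
    using that mem_frac by blast
next
  assume *: "\<exists>v\<in>S. v \<otimes> (t \<otimes> a) = v \<otimes> (s \<otimes> b)"
  then have sym: "\<exists>v\<in>S. v \<otimes> (s \<otimes> b) = v \<otimes> (t \<otimes> a)" by metis
  have "(x, r) \<in> frac R S a s \<longleftrightarrow> (x, r) \<in> frac R S b t" for x r
    using frac_trans[OF c(2,1) _ c(4,3) _ sym] frac_trans[OF c(1,2) _ c(3,4) _ *] unfolding mem_frac by blast
  then show "frac R S a s = frac R S b t" by auto
qed

lemma frac_self: "a \<in> carrier R \<Longrightarrow> s \<in> S \<Longrightarrow> (a, s) \<in> frac R S a s"
  using S_one by (auto simp: mem_frac)

lemma frac_eqI:
  assumes "a \<in> carrier R" "b \<in> carrier R" "s \<in> S" "t \<in> S" "t \<otimes> a = s \<otimes> b"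
  shows "frac R S a s = frac R S b t"
  using assms S_one by (auto simp: frac_eq_iff)

abbreviation "L \<equiv> localization R S"

lemma carrier_localization: "carrier L = {frac R S a s | a s. a \<in> carrier R \<and> s \<in> S}"
  by (simp add: localization_def)

lemma frac_closed [simp]: "a \<in> carrier R \<Longrightarrow> s \<in> S \<Longrightarrow> frac R S a s \<in> carrier L"
  by (auto simp: carrier_localization)

text \<open>The union over all representatives collapses, since each choice yields the same
  fraction.\<close>

lemma frac_mult:
  assumes c: "a \<in> carrier R" "b \<in> carrier R" "s \<in> S" "t \<in> S"
  shows "frac R S a s \<otimes>\<^bsub>L\<^esub> frac R S b t = frac R S (a \<otimes> b) (s \<otimes> t)"
proof -
  have "frac R S (a' \<otimes> b') (s' \<otimes> t') = frac R S (a \<otimes> b) (s \<otimes> t)"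
    if x: "(a', s') \<in> frac R S a s" and y: "(b', t') \<in> frac R S b t" for a' s' b' t'
  proof -
    obtain v where v: "v \<in> S" "v \<otimes> (s' \<otimes> a) = v \<otimes> (s \<otimes> a')" "a' \<in> carrier R" "s' \<in> S" using x mem_frac by blast
    obtain w where w: "w \<in> S" "w \<otimes> (t' \<otimes> b) = w \<otimes> (t \<otimes> b')" "b' \<in> carrier R" "t' \<in> S" using y mem_frac by blast
    have "(v \<otimes> w) \<otimes> ((s \<otimes> t) \<otimes> (a' \<otimes> b')) = (v \<otimes> (s \<otimes> a')) \<otimes> (w \<otimes> (t \<otimes> b'))"
      using c v(1,3,4) w(1,3,4) by (simp add: m_ac)
    also have "\<dots> = (v \<otimes> w) \<otimes> ((s' \<otimes> t') \<otimes> (a \<otimes> b))"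
      unfolding v(2)[symmetric] w(2)[symmetric] using c v(1,3,4) w(1,3,4) by (simp add: m_ac)
    finally have "\<exists>z\<in>S. z \<otimes> ((s \<otimes> t) \<otimes> (a' \<otimes> b')) = z \<otimes> ((s' \<otimes> t') \<otimes> (a \<otimes> b))"
      using v w S_mult by blast
    then show ?thesis using c v w S_mult by (subst frac_eq_iff) auto
  qed
  moreover have "frac R S a s \<noteq> {}" "frac R S b t \<noteq> {}" using frac_self c by blast+
  ultimately have "(\<Union>x\<in>frac R S a s. \<Union>y\<in>frac R S b t. frac R S (fst x \<otimes> fst y) (snd x \<otimes> snd y))
    = frac R S (a \<otimes> b) (s \<otimes> t)" by auto
  then show ?thesis by (simp add: localization_def)
qed

lemma frac_add:
  assumes c: "a \<in> carrier R" "b \<in> carrier R" "s \<in> S" "t \<in> S"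
  shows "frac R S a s \<oplus>\<^bsub>L\<^esub> frac R S b t = frac R S (t \<otimes> a \<oplus> s \<otimes> b) (s \<otimes> t)"
proof -
  have "frac R S (t' \<otimes> a' \<oplus> s' \<otimes> b') (s' \<otimes> t') = frac R S (t \<otimes> a \<oplus> s \<otimes> b) (s \<otimes> t)"
    if x: "(a', s') \<in> frac R S a s" and y: "(b', t') \<in> frac R S b t" for a' s' b' t'
  proof -
    obtain v where v: "v \<in> S" "v \<otimes> (s' \<otimes> a) = v \<otimes> (s \<otimes> a')" "a' \<in> carrier R" "s' \<in> S" using x mem_frac by blast
    obtain w where w: "w \<in> S" "w \<otimes> (t' \<otimes> b) = w \<otimes> (t \<otimes> b')" "b' \<in> carrier R" "t' \<in> S" using y mem_frac by blast
    have "(v \<otimes> w) \<otimes> ((s \<otimes> t) \<otimes> (t' \<otimes> a' \<oplus> s' \<otimes> b'))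
      = (v \<otimes> (s \<otimes> a')) \<otimes> (w \<otimes> (t \<otimes> t')) \<oplus> (w \<otimes> (t \<otimes> b')) \<otimes> (v \<otimes> (s \<otimes> s'))"
      using c v(1,3,4) w(1,3,4) by (simp add: m_ac r_distr)
    also have "\<dots> = (v \<otimes> w) \<otimes> ((s' \<otimes> t') \<otimes> (t \<otimes> a \<oplus> s \<otimes> b))"
      unfolding v(2)[symmetric] w(2)[symmetric] using c v(1,3,4) w(1,3,4) by (simp add: m_ac r_distr)
    finally have "\<exists>z\<in>S. z \<otimes> ((s \<otimes> t) \<otimes> (t' \<otimes> a' \<oplus> s' \<otimes> b')) = z \<otimes> ((s' \<otimes> t') \<otimes> (t \<otimes> a \<oplus> s \<otimes> b))"
      using v w S_mult by blast
    then show ?thesis using c v w S_mult by (subst frac_eq_iff) auto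
  qed
  moreover have "frac R S a s \<noteq> {}" "frac R S b t \<noteq> {}" using frac_self c by blast+
  ultimately have "(\<Union>x\<in>frac R S a s. \<Union>y\<in>frac R S b t. frac R S (snd y \<otimes> fst x \<oplus> snd x \<otimes> fst y) (snd x \<otimes> snd y))
    = frac R S (t \<otimes> a \<oplus> s \<otimes> b) (s \<otimes> t)" by auto
  then show ?thesis by (simp add: localization_def)
qed

lemma localization_zero: "\<zero>\<^bsub>L\<^esub> = frac R S \<zero> \<one>" and localization_one: "\<one>\<^bsub>L\<^esub> = frac R S \<one> \<one>"
  by (simp_all add: localization_def)

lemma localizationE:
  assumes "x \<in> carrier L" obtains a s where "a \<in> carrier R" "s \<in> S" "x = frac R S a s"
  using assms by (auto simp: carrier_localization)

lemma cring_localization: "cring L"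
proof (intro cringI abelian_groupI comm_monoidI)
  fix x y z assume "x \<in> carrier L" "y \<in> carrier L" "z \<in> carrier L"
  then obtain a s b t c r where e: "a \<in> carrier R" "s \<in> S" "b \<in> carrier R" "t \<in> S" "c \<in> carrier R" "r \<in> S"
    "x = frac R S a s" "y = frac R S b t" "z = frac R S c r" by (meson localizationE)
  note c = e(1-6) S_mult S_one
  show "x \<oplus>\<^bsub>L\<^esub> y \<oplus>\<^bsub>L\<^esub> z = x \<oplus>\<^bsub>L\<^esub> (y \<oplus>\<^bsub>L\<^esub> z)"
    unfolding e(7-9) using c by (simp add: frac_add) (rule frac_eqI; simp add: m_ac a_ac r_distr)
  show "x \<otimes>\<^bsub>L\<^esub> y \<otimes>\<^bsub>L\<^esub> z = x \<otimes>\<^bsub>L\<^esub> (y \<otimes>\<^bsub>L\<^esub> z)"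
    unfolding e(7-9) using c by (simp add: frac_mult m_ac)
  show "(x \<oplus>\<^bsub>L\<^esub> y) \<otimes>\<^bsub>L\<^esub> z = x \<otimes>\<^bsub>L\<^esub> z \<oplus>\<^bsub>L\<^esub> y \<otimes>\<^bsub>L\<^esub> z"
    unfolding e(7-9) using c by (simp add: frac_add frac_mult) (rule frac_eqI; simp add: m_ac a_ac r_distr l_distr)
next
  fix x y assume "x \<in> carrier L" "y \<in> carrier L"
  then obtain a s b t where e: "a \<in> carrier R" "s \<in> S" "b \<in> carrier R" "t \<in> S"
    "x = frac R S a s" "y = frac R S b t" by (meson localizationE)
  note c = e(1-4) S_mult S_one
  show "x \<oplus>\<^bsub>L\<^esub> y \<in> carrier L" "x \<otimes>\<^bsub>L\<^esub> y \<in> carrier L"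
    unfolding e(5,6) using c by (simp_all add: frac_add frac_mult)
  show "x \<oplus>\<^bsub>L\<^esub> y = y \<oplus>\<^bsub>L\<^esub> x" "x \<otimes>\<^bsub>L\<^esub> y = y \<otimes>\<^bsub>L\<^esub> x"
    unfolding e(5,6) using c by (simp_all add: frac_add frac_mult m_ac a_ac)
next
  fix x assume "x \<in> carrier L"
  then obtain a s where e: "a \<in> carrier R" "s \<in> S" "x = frac R S a s" by (meson localizationE)
  show "\<zero>\<^bsub>L\<^esub> \<oplus>\<^bsub>L\<^esub> x = x" "\<one>\<^bsub>L\<^esub> \<otimes>\<^bsub>L\<^esub> x = x"
    unfolding e(3) using e S_one by (simp_all add: localization_zero localization_one frac_add frac_mult)
  have "frac R S (\<ominus> a) s \<oplus>\<^bsub>L\<^esub> x = \<zero>\<^bsub>L\<^esub>"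
    unfolding e(3) using e S_one S_mult
    by (simp add: localization_zero frac_add) (rule frac_eqI; simp add: r_minus l_neg)
  then show "\<exists>y\<in>carrier L. y \<oplus>\<^bsub>L\<^esub> x = \<zero>\<^bsub>L\<^esub>" using e by (intro bexI) auto
qed (use S_one in \<open>auto simp: localization_zero localization_one\<close>)

lemma frac_hom: "(\<lambda>a. frac R S a \<one>) \<in> ring_hom R L"
  by (rule ring_hom_memI) (use S_one in \<open>auto simp: frac_add frac_mult localization_one\<close>)

end

lemma (in primeideal) multiplicative_set: "multiplicative_set R (carrier R - I)"
  by unfold_locales (use I_prime one_imp_carrier I_notcarr in auto)

context primeideal
begin

interpretation S: multiplicative_set R "carrier R - I" by (rule multiplicative_set)

lemma cring_localization_at: "cring (localization_at R I)"
  unfolding localization_at_def by (rule S.cring_localization)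

lemma localization_map_hom: "localization_map R I \<in> ring_hom R (localization_at R I)"
  using S.frac_hom by (simp add: localization_map_def[abs_def] localization_at_def)

lemma localization_fraction:
  assumes "x \<in> carrier (localization_at R I)"
  shows "\<exists>s\<in>carrier R - I. \<exists>a\<in>carrier R. localization_map R I s \<otimes>\<^bsub>localization_at R I\<^esub> x = localization_map R I a"
proof -
  obtain a s where e: "a \<in> carrier R" "s \<in> carrier R - I" "x = frac R (carrier R - I) a s"
    using assms unfolding localization_at_def by (rule S.localizationE)
  have "localization_map R I s \<otimes>\<^bsub>localization_at R I\<^esub> x = localization_map R I a"
    unfolding e(3) localization_map_def localization_at_def using e S.S_one
    by (simp add: S.frac_mult) (rule S.frac_eqI; simp)
  then show ?thesis using e by blast
qed

text \<open>The fractions with numerator in \<open>I\<close> already form an ideal, so the generated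
  ideal contains nothing else; primality then removes the denominators.\<close>

lemma localization_map_extended_prime:
  assumes a: "a \<in> carrier R" "localization_map R I a \<in> extended_prime R I"
  shows "a \<in> I"
proof -
  let ?S = "carrier R - I"
  let ?L = "localization R ?S"
  interpret L: cring ?L by (rule S.cring_localization)
  define T where "T = {frac R ?S a s | a s. a \<in> I \<and> s \<in> ?S}"
  have T: "ideal T ?L"
  proof (rule idealI)
    have TI: "frac R ?S a s \<in> T" if "a \<in> I" "s \<in> ?S" for a s using that by (auto simp: T_def)
    have sm: "x \<otimes>\<^bsub>?L\<^esub> y \<in> T" if x: "x \<in> carrier ?L" and y: "y \<in> T" for x y
    proof -
      obtain a s where e: "a \<in> carrier R" "s \<in> ?S" "x = frac R ?S a s" using x by (rule S.localizationE)
      obtain b t where f: "b \<in> I" "t \<in> ?S" "y = frac R ?S b t" using y by (auto simp: T_def)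
      show ?thesis unfolding e(3) f(3) S.frac_mult[OF e(1) Icarr[OF f(1)] e(2) f(2)]
        using e f by (intro TI S.S_mult) (auto intro: I_l_closed)
    qed
    have Tc: "T \<subseteq> carrier ?L" using Icarr by (auto simp: T_def)
    show "subgroup T (add_monoid ?L)"
    proof (rule L.add.subgroupI[OF Tc])
      show "T \<noteq> {}" using TI[OF additive_subgroup.zero_closed[OF is_additive_subgroup] S.S_one] by blast
      show "\<ominus>\<^bsub>?L\<^esub> y \<in> T" if "y \<in> T" for y
      proof -
        have "\<ominus>\<^bsub>?L\<^esub> y = (\<ominus>\<^bsub>?L\<^esub> \<one>\<^bsub>?L\<^esub>) \<otimes>\<^bsub>?L\<^esub> y" using that Tc by (auto simp: L.l_minus)
        then show ?thesis using sm[of "\<ominus>\<^bsub>?L\<^esub> \<one>\<^bsub>?L\<^esub>" y] that by simp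
      qed
      show "x \<oplus>\<^bsub>?L\<^esub> y \<in> T" if "x \<in> T" "y \<in> T" for x y
      proof -
        obtain a s where e: "a \<in> I" "s \<in> ?S" "x = frac R ?S a s" using \<open>x \<in> T\<close> by (auto simp: T_def)
        obtain b t where f: "b \<in> I" "t \<in> ?S" "y = frac R ?S b t" using \<open>y \<in> T\<close> by (auto simp: T_def)
        show ?thesis unfolding e(3) f(3) S.frac_add[OF Icarr[OF e(1)] Icarr[OF f(1)] e(2) f(2)]
          using e f by (intro TI S.S_mult additive_subgroup.a_closed[OF is_additive_subgroup] I_l_closed) auto
      qed
    qed
    show "x \<otimes>\<^bsub>?L\<^esub> y \<in> T" "y \<otimes>\<^bsub>?L\<^esub> x \<in> T" if "y \<in> T" "x \<in> carrier ?L" for x y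
      using sm[OF that(2,1)] L.m_comm[OF that(2) subsetD[OF Tc that(1)]] by simp_all
  qed (rule L.ring_axioms)
  have "extended_prime R I \<subseteq> T"
    unfolding extended_prime_def localization_at_def
    by (rule L.genideal_minimal[OF T]) (use S.S_one in \<open>auto simp: T_def localization_map_def\<close>)
  then obtain b s where b: "b \<in> I" "s \<in> ?S" "frac R ?S a \<one> = frac R ?S b s"
    using a(2) by (auto simp: T_def localization_map_def)
  then obtain v where v: "v \<in> ?S" "v \<otimes> (s \<otimes> a) = v \<otimes> (\<one> \<otimes> b)"
    using S.frac_eq_iff[OF a(1) Icarr[OF b(1)] S.S_one b(2)] by blast
  have "v \<otimes> (s \<otimes> a) \<in> I" unfolding v(2) using v(1) b(1) Icarr by (intro I_l_closed) auto
  then have "s \<otimes> a \<in> I" using I_prime[of v "s \<otimes> a"] v b a by auto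
  then show ?thesis using I_prime[of s a] b a by auto
qed

text \<open>The preimage of the ideal generated by the images is an ideal containing the generators,
  hence \<open>I\<close>. This supplies the finite generation over the localization that
  \<open>completion_lift\<close> asks for.\<close>

lemma extended_prime_generators:
  assumes "set as \<subseteq> carrier R" "I = Idl\<^bsub>R\<^esub> (set as)"
  shows "extended_prime R I = Idl\<^bsub>localization_at R I\<^esub> (set (map (localization_map R I) as))"
proof -
  let ?f = "localization_map R I" and ?L = "localization_at R I"
  interpret L: cring ?L by (rule cring_localization_at)
  interpret h: ring_hom_cring R ?L ?f
    using localization_map_hom by unfold_locales (simp add: ring_hom_def)
  have sub: "set (map ?f as) \<subseteq> carrier ?L" using assms(1) by auto
  have J: "ideal (Idl\<^bsub>?L\<^esub> (set (map ?f as))) ?L" using sub by (rule L.genideal_ideal)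
  have "set as \<subseteq> {r \<in> carrier R. ?f r \<in> Idl\<^bsub>?L\<^esub> (set (map ?f as))}"
    using L.genideal_self[OF sub] assms(1) by auto
  then have "I \<subseteq> {r \<in> carrier R. ?f r \<in> Idl\<^bsub>?L\<^esub> (set (map ?f as))}"
    using genideal_minimal[OF h.ring.ideal_vimage[OF J]] assms(2) by simp
  then have "?f ` I \<subseteq> Idl\<^bsub>?L\<^esub> (set (map ?f as))" by blast
  then have 1: "extended_prime R I \<subseteq> Idl\<^bsub>?L\<^esub> (set (map ?f as))"
    unfolding extended_prime_def by (rule L.genideal_minimal[OF J])
  have fI: "?f ` I \<subseteq> carrier ?L" using Icarr by auto
  have "set as \<subseteq> I" using genideal_self[OF assms(1)] assms(2) by blast
  then have "set (map ?f as) \<subseteq> extended_prime R I"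
    using L.genideal_self[OF fI] by (auto simp: extended_prime_def)
  then have 2: "Idl\<^bsub>?L\<^esub> (set (map ?f as)) \<subseteq> extended_prime R I"
    unfolding extended_prime_def using L.genideal_ideal[OF fI] by (intro L.genideal_minimal)
  show ?thesis using 1 2 by blast
qed

end

section \<open>Free modules\<close>

context cring
begin

lemma module_free_module: "module R (free_module R B)"
proof -
  let ?F = "free_module R B"
  have fin_add: "finite {x \<in> B. f x \<oplus> g x \<noteq> \<zero>}"
    if "f \<in> B \<rightarrow>\<^sub>E carrier R" "g \<in> B \<rightarrow>\<^sub>E carrier R" "finite {x \<in> B. f x \<noteq> \<zero>}" "finite {x \<in> B. g x \<noteq> \<zero>}" for f g
    by (rule finite_subset[OF _ finite_UnI[OF that(3,4)]]) auto
  have fin_sm: "finite {x \<in> B. a \<otimes> f x \<noteq> \<zero>}"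
    if "a \<in> carrier R" "finite {x \<in> B. f x \<noteq> \<zero>}" for a f
    by (rule finite_subset[OF _ that(2)]) (use that in auto)
  have c: "f x \<in> carrier R" if "f \<in> carrier ?F" "x \<in> B" for f x
    using that by (auto simp: free_module_def)
  have add: "f \<oplus>\<^bsub>?F\<^esub> g \<in> carrier ?F" if "f \<in> carrier ?F" "g \<in> carrier ?F" for f g
    using that fin_add[of f g] c[OF that(1)] c[OF that(2)]
    by (auto simp: free_module_def cong: conj_cong)
  have sm: "a \<odot>\<^bsub>?F\<^esub> f \<in> carrier ?F" if "a \<in> carrier R" "f \<in> carrier ?F" for a f
    using that fin_sm[of a f] c[OF that(2)] by (auto simp: free_module_def cong: conj_cong)
  have ev: "(f \<oplus>\<^bsub>?F\<^esub> g) x = (if x \<in> B then f x \<oplus> g x else undefined)"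
    "(a \<odot>\<^bsub>?F\<^esub> f) x = (if x \<in> B then a \<otimes> f x else undefined)"
    "\<zero>\<^bsub>?F\<^esub> x = (if x \<in> B then \<zero> else undefined)" for f g a x
    by (simp_all add: free_module_def)
  have out: "f x = undefined" if "f \<in> carrier ?F" "x \<notin> B" for f x
    using that by (auto simp: free_module_def PiE_def extensional_def)
  show ?thesis
  proof (intro moduleI abelian_groupI)
    fix f assume f: "f \<in> carrier ?F"
    show "\<exists>g\<in>carrier ?F. g \<oplus>\<^bsub>?F\<^esub> f = \<zero>\<^bsub>?F\<^esub>"
    proof (intro bexI)
      show "((\<ominus> \<one>) \<odot>\<^bsub>?F\<^esub> f) \<oplus>\<^bsub>?F\<^esub> f = \<zero>\<^bsub>?F\<^esub>" using c[OF f] by (auto simp: fun_eq_iff ev l_minus l_neg)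
      show "(\<ominus> \<one>) \<odot>\<^bsub>?F\<^esub> f \<in> carrier ?F" using f by (intro sm) auto
    qed
  next
    show "\<zero>\<^bsub>?F\<^esub> \<in> carrier ?F" by (auto simp: free_module_def)
  qed (auto simp: add sm fun_eq_iff ev c out a_ac l_distr r_distr m_assoc cring_axioms)
qed

definition basis_vector :: "'x set \<Rightarrow> 'x \<Rightarrow> 'x \<Rightarrow> 'a" where
  "basis_vector B b = (\<lambda>x\<in>B. if x = b then \<one> else \<zero>)"

lemma basis_vector_closed: "basis_vector B b \<in> carrier (free_module R B)"
  by (auto simp: free_module_def basis_vector_def intro: finite_subset[of _ "{b}"])

lemma free_module_apply:
  assumes "x \<in> B"
  shows "(f \<oplus>\<^bsub>free_module R B\<^esub> g) x = f x \<oplus> g x" "(a \<odot>\<^bsub>free_module R B\<^esub> f) x = a \<otimes> f x"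
  using assms by (simp_all add: free_module_def)

text \<open>Vectors whose coordinate at \<open>x\<close> lies in \<open>I\<close> form a submodule
  containing all multiples by \<open>I\<close>. This serves to read off coefficients of basis
  vectors modulo the ideal.\<close>

lemma adic_submodule_coordinate:
  assumes I: "ideal I R" and f: "f \<in> adic_submodule R I (free_module R B) 1" and x: "x \<in> B"
  shows "f x \<in> I"
proof -
  interpret F: module R "free_module R B" by (rule module_free_module)
  interpret I: ideal I R by (rule I)
  have "submodule {f \<in> carrier (free_module R B). f x \<in> I} R (free_module R B)"
  proof (rule F.submoduleI2)
    show "\<zero>\<^bsub>free_module R B\<^esub> \<in> {f \<in> carrier (free_module R B). f x \<in> I}"
      using x F.M.zero_closed by (simp add: free_module_def)
  qed (use x in \<open>auto simp: free_module_apply intro: I.I_l_closed\<close>)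
  moreover have "a \<odot>\<^bsub>free_module R B\<^esub> g \<in> {f \<in> carrier (free_module R B). f x \<in> I}"
    if "a \<in> ideal_pow R I 1" "g \<in> carrier (free_module R B)" for a g
  proof -
    have "a \<in> I" "a \<in> carrier R" using that(1) ideal_pow_1[OF I] I.Icarr by auto
    moreover have "g x \<in> carrier R" using that(2) x by (auto simp: free_module_def)
    ultimately show ?thesis using that(2) x by (simp add: free_module_apply I.I_r_closed)
  qed
  ultimately have "ideal_smult R (ideal_pow R I 1) (free_module R B) \<subseteq> {f \<in> carrier (free_module R B). f x \<in> I}"
    by (rule F.ideal_smult_subset)
  then show ?thesis using f unfolding F.adic_submodule_eq by blast
qed

end

section \<open>Hulls of cyclic modules\<close>

text \<open>The image \<open>v\<close> of the class of 1 determines the embedding; in terms of it,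
  essentiality becomes a condition on single multiples of \<open>v\<close>.\<close>

lemma injective_hull_generator:
  fixes R :: "('a, 'r) ring_scheme" and E :: "('a, 'e, 'm) module_scheme"
  assumes R: "cring R" and J: "ideal J R" and hull: "injective_hull R (quot_module (ring_as_module R) J) E"
  obtains v where "v \<in> carrier E" "\<And>a. a \<in> carrier R \<Longrightarrow> a \<odot>\<^bsub>E\<^esub> v = \<zero>\<^bsub>E\<^esub> \<longleftrightarrow> a \<in> J"
    "\<And>N. submodule N R E \<Longrightarrow> N \<noteq> {\<zero>\<^bsub>E\<^esub>} \<Longrightarrow> \<exists>a\<in>carrier R. a \<odot>\<^bsub>E\<^esub> v \<in> N \<and> a \<odot>\<^bsub>E\<^esub> v \<noteq> \<zero>\<^bsub>E\<^esub>"
proof -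
  interpret R: cring R by fact
  interpret E: module R E using hull by (simp add: injective_hull_def injective_module_def)
  interpret M: module R "ring_as_module R" by (rule R.ring_as_module)
  have Js: "submodule J R (ring_as_module R)" using J by (rule R.submodule_ring_as_module)
  let ?Q = "quot_module (ring_as_module R) J"
  interpret Q: module R ?Q by (rule M.module_quot_module[OF Js])
  let ?q = "\<lambda>a. J +>\<^bsub>ring_as_module R\<^esub> a"
  obtain i where i: "i \<in> linear_maps R ?Q E" "inj_on i (carrier ?Q)"
    and ess: "\<And>N. submodule N R E \<Longrightarrow> N \<noteq> {\<zero>\<^bsub>E\<^esub>} \<Longrightarrow> N \<inter> i ` carrier ?Q \<noteq> {\<zero>\<^bsub>E\<^esub>}"
    using hull unfolding injective_hull_def by blast
  have il: "linear_map R ?Q E i" using i(1) by (rule linear_maps_imp_linear_map)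
  have qc: "?q a \<in> carrier ?Q" if "a \<in> carrier R" for a using that by (simp add: M.carrier_quot_module)
  define v where "v = i (?q \<one>\<^bsub>R\<^esub>)"
  have v: "v \<in> carrier E" unfolding v_def using qc by (intro linear_map_closed[OF il]) simp
  have iq: "i (?q a) = a \<odot>\<^bsub>E\<^esub> v" if "a \<in> carrier R" for a
    using linear_map_smult[OF il that qc[OF R.one_closed]] M.smult_quot_module[OF Js that, of "\<one>\<^bsub>R\<^esub>"] that
    by (simp add: v_def)
  have i0: "i (?q \<zero>\<^bsub>R\<^esub>) = \<zero>\<^bsub>E\<^esub>" using iq[OF R.zero_closed] v by simp
  show ?thesis
  proof (rule that[OF v])
    fix a assume a: "a \<in> carrier R"
    have "a \<odot>\<^bsub>E\<^esub> v = \<zero>\<^bsub>E\<^esub> \<longleftrightarrow> i (?q a) = i (?q \<zero>\<^bsub>R\<^esub>)" using iq[OF a] i0 by simp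
    also have "\<dots> \<longleftrightarrow> ?q a = ?q \<zero>\<^bsub>R\<^esub>" using inj_on_eq_iff[OF i(2) qc[OF a] qc[OF R.zero_closed]] .
    also have "\<dots> \<longleftrightarrow> a \<in> J" using M.coset_eq_iff[OF Js, of a "\<zero>\<^bsub>R\<^esub>"] M.diff_zero[of a] a by simp
    finally show "a \<odot>\<^bsub>E\<^esub> v = \<zero>\<^bsub>E\<^esub> \<longleftrightarrow> a \<in> J" .
  next
    fix N assume N: "submodule N R E" "N \<noteq> {\<zero>\<^bsub>E\<^esub>}"
    have im: "i ` carrier ?Q = (\<lambda>a. a \<odot>\<^bsub>E\<^esub> v) ` carrier R"
      using iq by (auto simp: M.carrier_quot_module image_image cong: image_cong_simp)
    \<comment> \<open>As zero belongs to the intersection, being different from {0} means having a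
      nonzero element.\<close>
    have "\<zero>\<^bsub>E\<^esub> \<in> N \<inter> i ` carrier ?Q"
      using E.submodule_zero[OF N(1)] i0 qc[OF R.zero_closed] by (metis IntI imageI)
    then show "\<exists>a\<in>carrier R. a \<odot>\<^bsub>E\<^esub> v \<in> N \<and> a \<odot>\<^bsub>E\<^esub> v \<noteq> \<zero>\<^bsub>E\<^esub>" using ess[OF N] unfolding im by blast
  qed
qed

lemma (in module) submodule_cyclic:
  assumes "x \<in> carrier M" shows "submodule ((\<lambda>r. r \<odot>\<^bsub>M\<^esub> x) ` carrier R) R M"
proof -
  have "linear_map R (ring_as_module R) M (\<lambda>r. r \<odot>\<^bsub>M\<^esub> x)"
    using assms by (simp add: linear_map_def smult_l_distr smult_assoc1)
  from submodule_image[OF this ring_as_module module_axioms] show ?thesis by simp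
qed

text \<open>For nonzero e, essentiality gives a common nonzero multiple a v = r e. As \<mm> kills v,
  the coefficient a is a unit, and v itself is a multiple of e.\<close>

lemma residue_hull_of_injective_hull:
  assumes loc: "local_noetherian_ring R \<mm>" and hull: "injective_hull R (quot_module (ring_as_module R) \<mm>) E"
  shows "\<exists>e0. residue_hull R E \<mm> e0"
proof -
  interpret R: cring R using loc by (simp add: local_noetherian_ring_def)
  interpret \<mm>: primeideal \<mm> R using loc by (rule local_noetherian_ring_prime)
  interpret E: module R E using hull by (simp add: injective_hull_def injective_module_def)
  obtain v where v: "v \<in> carrier E" "\<And>a. a \<in> carrier R \<Longrightarrow> a \<odot>\<^bsub>E\<^esub> v = \<zero>\<^bsub>E\<^esub> \<longleftrightarrow> a \<in> \<mm>"
    "\<And>N. submodule N R E \<Longrightarrow> N \<noteq> {\<zero>\<^bsub>E\<^esub>} \<Longrightarrow> \<exists>a\<in>carrier R. a \<odot>\<^bsub>E\<^esub> v \<in> N \<and> a \<odot>\<^bsub>E\<^esub> v \<noteq> \<zero>\<^bsub>E\<^esub>"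
    using injective_hull_generator[OF R.cring_axioms \<mm>.is_ideal hull] by blast
  have "residue_hull R E \<mm> v"
  proof
    show "v \<noteq> \<zero>\<^bsub>E\<^esub>" using v(1) v(2)[of "\<one>\<^bsub>R\<^esub>"] \<mm>.one_imp_carrier \<mm>.I_notcarr by auto
    show "a \<odot>\<^bsub>E\<^esub> v = \<zero>\<^bsub>E\<^esub>" if "a \<in> \<mm>" for a using v(2) that \<mm>.Icarr by blast
    show "injective_module R E" using hull by (simp add: injective_hull_def)
    fix e assume e: "e \<in> carrier E" "e \<noteq> \<zero>\<^bsub>E\<^esub>"
    have "e \<in> (\<lambda>r. r \<odot>\<^bsub>E\<^esub> e) ` carrier R" using e(1) by (intro image_eqI[of _ _ "\<one>\<^bsub>R\<^esub>"]) auto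
    then have "(\<lambda>r. r \<odot>\<^bsub>E\<^esub> e) ` carrier R \<noteq> {\<zero>\<^bsub>E\<^esub>}" using e(2) by blast
    then obtain a where "a \<in> carrier R" "a \<odot>\<^bsub>E\<^esub> v \<in> (\<lambda>r. r \<odot>\<^bsub>E\<^esub> e) ` carrier R" "a \<odot>\<^bsub>E\<^esub> v \<noteq> \<zero>\<^bsub>E\<^esub>"
      using v(3)[OF E.submodule_cyclic[OF e(1)]] by blast
    then obtain r where ar: "a \<in> carrier R" "r \<in> carrier R" "a \<odot>\<^bsub>E\<^esub> v = r \<odot>\<^bsub>E\<^esub> e" "a \<odot>\<^bsub>E\<^esub> v \<noteq> \<zero>\<^bsub>E\<^esub>" by auto
    then have "a \<notin> \<mm>" using v(2) by blast
    then obtain b where b: "b \<in> carrier R" "b \<otimes>\<^bsub>R\<^esub> a = \<one>\<^bsub>R\<^esub>" using local_noetherian_ring_unit[OF loc ar(1)] by blast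
    have "(b \<otimes>\<^bsub>R\<^esub> r) \<odot>\<^bsub>E\<^esub> e = (b \<otimes>\<^bsub>R\<^esub> a) \<odot>\<^bsub>E\<^esub> v" using b(1) ar e v(1) by (simp add: E.smult_assoc1)
    then have "(b \<otimes>\<^bsub>R\<^esub> r) \<odot>\<^bsub>E\<^esub> e = v" using b v(1) by simp
    then show "\<exists>r\<in>carrier R. r \<odot>\<^bsub>E\<^esub> e = v" using b ar by blast
  qed (use loc v in auto)
  then show ?thesis by blast
qed

text \<open>An s outside \<pp> acts injectively on \<open>F\<close>: its kernel would otherwise
  contain a nonzero a v with s a in \<pp>, against primality. That \<open>F\<close> is injective
  then allows division by s. Essentiality turns y into a fraction: in a v = r y with r y nonzero, r
  is outside \<pp>, since \<pp> kills y.\<close>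

lemma residue_field_module_of_hull:
  fixes R :: "('a, 'r) ring_scheme" and F :: "('a, 'f, 'm) module_scheme"
  assumes E: "residue_hull R E \<mm> e0" and p: "primeideal \<pp> R" "\<pp> \<noteq> \<mm>"
    and hull: "injective_hull R (quot_module (ring_as_module R) \<pp>) F"
  shows "\<exists>v. residue_field_module R E \<mm> e0 (F\<lparr>carrier := module.killed F \<pp>\<rparr>) \<pp> v"
proof -
  interpret E: residue_hull R E \<mm> e0 by fact
  interpret p: primeideal \<pp> R by fact
  interpret F: module R F using hull by (simp add: injective_hull_def injective_module_def)
  have injF: "injective_module R F" using hull by (simp add: injective_hull_def)
  obtain v where v: "v \<in> carrier F" and v0: "\<And>a. a \<in> carrier R \<Longrightarrow> a \<odot>\<^bsub>F\<^esub> v = \<zero>\<^bsub>F\<^esub> \<longleftrightarrow> a \<in> \<pp>"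
    and ess: "\<And>N. submodule N R F \<Longrightarrow> N \<noteq> {\<zero>\<^bsub>F\<^esub>} \<Longrightarrow> \<exists>a\<in>carrier R. a \<odot>\<^bsub>F\<^esub> v \<in> N \<and> a \<odot>\<^bsub>F\<^esub> v \<noteq> \<zero>\<^bsub>F\<^esub>"
    using injective_hull_generator[OF module.axioms(1)[OF F.module_axioms] p.is_ideal hull] by blast
  have pc: "\<pp> \<subseteq> carrier R" using p.Icarr by blast
  let ?K = "F\<lparr>carrier := F.killed \<pp>\<rparr>"
  have K: "module R ?K" using F.submodule_killed[OF pc] F.module_axioms by (rule submodule.submodule_is_module)
  interpret K: module R ?K by (rule K)
  have inj0: "y = \<zero>\<^bsub>F\<^esub>" if s: "s \<in> carrier R - \<pp>" and y: "y \<in> carrier F" "s \<odot>\<^bsub>F\<^esub> y = \<zero>\<^bsub>F\<^esub>" for s y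
  proof (rule ccontr)
    assume "y \<noteq> \<zero>\<^bsub>F\<^esub>"
    have N: "submodule (F.killed {s}) R F" using s by (intro F.submodule_killed) auto
    have "y \<in> F.killed {s}" using y by (simp add: F.killed_def)
    then have "F.killed {s} \<noteq> {\<zero>\<^bsub>F\<^esub>}" using \<open>y \<noteq> \<zero>\<^bsub>F\<^esub>\<close> by blast
    then obtain a where a: "a \<in> carrier R" "a \<odot>\<^bsub>F\<^esub> v \<in> F.killed {s}" "a \<odot>\<^bsub>F\<^esub> v \<noteq> \<zero>\<^bsub>F\<^esub>" using ess[OF N] by blast
    then have "(s \<otimes>\<^bsub>R\<^esub> a) \<odot>\<^bsub>F\<^esub> v = \<zero>\<^bsub>F\<^esub>" using s v by (simp add: F.killed_def F.smult_assoc1)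
    then have "s \<otimes>\<^bsub>R\<^esub> a \<in> \<pp>" using v0 s a by simp
    then show False using p.I_prime[of s a] s a v0[OF a(1)] by auto
  qed
  have "residue_field_module R E \<mm> e0 ?K \<pp> v"
  proof (intro residue_field_module.intro E K residue_field_module_axioms.intro p)
    show "v \<in> carrier ?K" using v v0 p.Icarr by (simp add: F.killed_def)
    show "v \<noteq> \<zero>\<^bsub>?K\<^esub>" using v v0[of "\<one>\<^bsub>R\<^esub>"] p.one_imp_carrier p.I_notcarr by auto
    show "a \<odot>\<^bsub>?K\<^esub> y = \<zero>\<^bsub>?K\<^esub>" if "a \<in> \<pp>" "y \<in> carrier ?K" for a y using that by (simp add: F.killed_def)
    show "y = \<zero>\<^bsub>?K\<^esub>" if "s \<in> carrier R - \<pp>" "y \<in> carrier ?K" "s \<odot>\<^bsub>?K\<^esub> y = \<zero>\<^bsub>?K\<^esub>" for s y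
      using inj0[OF that(1)] that(2,3) by (simp add: F.killed_def)
  next
    fix y assume y: "y \<in> carrier ?K"
    then have yF: "y \<in> carrier F" by (simp add: F.killed_def)
    show "\<exists>s\<in>carrier R - \<pp>. \<exists>a\<in>carrier R. s \<odot>\<^bsub>?K\<^esub> y = a \<odot>\<^bsub>?K\<^esub> v"
    proof (cases "y = \<zero>\<^bsub>F\<^esub>")
      case True
      have "\<one>\<^bsub>R\<^esub> \<in> carrier R - \<pp>" using p.one_imp_carrier p.I_notcarr by auto
      then show ?thesis using True v by (intro bexI[of _ "\<one>\<^bsub>R\<^esub>"] bexI[of _ "\<zero>\<^bsub>R\<^esub>"]) auto
    next
      case False
      have "y \<in> (\<lambda>r. r \<odot>\<^bsub>F\<^esub> y) ` carrier R" using yF by (intro image_eqI[of _ _ "\<one>\<^bsub>R\<^esub>"]) auto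
      then have "(\<lambda>r. r \<odot>\<^bsub>F\<^esub> y) ` carrier R \<noteq> {\<zero>\<^bsub>F\<^esub>}" using False by blast
      then obtain a where "a \<in> carrier R" "a \<odot>\<^bsub>F\<^esub> v \<in> (\<lambda>r. r \<odot>\<^bsub>F\<^esub> y) ` carrier R" "a \<odot>\<^bsub>F\<^esub> v \<noteq> \<zero>\<^bsub>F\<^esub>"
        using ess[OF F.submodule_cyclic[OF yF]] by blast
      then obtain r where ar: "a \<in> carrier R" "r \<in> carrier R" "a \<odot>\<^bsub>F\<^esub> v = r \<odot>\<^bsub>F\<^esub> y" "r \<odot>\<^bsub>F\<^esub> y \<noteq> \<zero>\<^bsub>F\<^esub>" by auto
      then have "r \<notin> \<pp>" using y by (auto simp: F.killed_def)
      then show ?thesis using ar by (intro bexI[of _ r] bexI[of _ a]) auto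
    qed
  next
    fix s y assume s: "s \<in> carrier R - \<pp>" and y: "y \<in> carrier ?K"
    then have yF: "y \<in> carrier F" by (simp add: F.killed_def)
    \<comment> \<open>The graph of division by s on s F. Its linear extension g to \<open>F\<close>
      satisfies s g(y) = g(s y) = y.\<close>
    define G where "G = (\<lambda>e. (s \<odot>\<^bsub>F\<^esub> e, e)) ` carrier F"
    have GI: "(s \<odot>\<^bsub>F\<^esub> e, e) \<in> G" if "e \<in> carrier F" for e using that by (auto simp: G_def)
    obtain g where g: "linear_map R F F g" "\<And>x y. (x, y) \<in> G \<Longrightarrow> g x = y"
    proof (rule injective_extend_graph[OF injF F.module_axioms, of G])
      show "G \<subseteq> carrier F \<times> carrier F" using s by (auto simp: G_def)
      show "(\<zero>\<^bsub>F\<^esub>, \<zero>\<^bsub>F\<^esub>) \<in> G" using GI[of "\<zero>\<^bsub>F\<^esub>"] s by simp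
      show "(x \<oplus>\<^bsub>F\<^esub> x', y \<oplus>\<^bsub>F\<^esub> y') \<in> G" if xy: "(x, y) \<in> G" "(x', y') \<in> G" for x y x' y'
      proof -
        have "y \<in> carrier F" "y' \<in> carrier F" "x = s \<odot>\<^bsub>F\<^esub> y" "x' = s \<odot>\<^bsub>F\<^esub> y'" using xy by (auto simp: G_def)
        then show ?thesis using GI[of "y \<oplus>\<^bsub>F\<^esub> y'"] s by (simp add: F.smult_r_distr)
      qed
      show "(r \<odot>\<^bsub>F\<^esub> x, r \<odot>\<^bsub>F\<^esub> y) \<in> G" if r: "r \<in> carrier R" and xy: "(x, y) \<in> G" for r x y
      proof -
        have "y \<in> carrier F" "x = s \<odot>\<^bsub>F\<^esub> y" using xy by (auto simp: G_def)
        then show ?thesis using GI[of "r \<odot>\<^bsub>F\<^esub> y"] s r by (simp add: F.smult_swap[of s r])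
      qed
      show "y = \<zero>\<^bsub>F\<^esub>" if "(\<zero>\<^bsub>F\<^esub>, y) \<in> G" for y using that inj0[OF s, of y] by (auto simp: G_def)
    qed (rule that)
    have gc: "g y \<in> carrier F" using linear_map_closed[OF g(1) yF] .
    have "s \<odot>\<^bsub>F\<^esub> g y = y" using linear_map_smult[OF g(1) _ yF, of s] g(2)[OF GI[OF yF]] s by simp
    moreover have "a \<odot>\<^bsub>F\<^esub> g y = \<zero>\<^bsub>F\<^esub>" if "a \<in> \<pp>" for a
      using linear_map_smult[OF g(1) p.Icarr[OF that] yF] y that linear_map_zero[OF g(1) F.module_axioms F.module_axioms]
      by (simp add: F.killed_def)
    ultimately show "\<exists>z\<in>carrier ?K. s \<odot>\<^bsub>?K\<^esub> z = y" using gc by (intro bexI[of _ "g y"]) (auto simp: F.killed_def)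
  qed
  then show ?thesis by blast
qed

section \<open>Completeness of the residue ring\<close>

lemma (in cring) minus_ring_as_module:
  assumes "x \<in> carrier R" "y \<in> carrier R" shows "x \<ominus>\<^bsub>ring_as_module R\<^esub> y = x \<ominus> y"
proof -
  interpret M: module R "ring_as_module R" by (rule ring_as_module)
  have "\<ominus>\<^bsub>ring_as_module R\<^esub> y = \<ominus> y" by (rule M.M.minus_equality) (use assms in \<open>auto simp: l_neg\<close>)
  then show ?thesis by (simp add: M.M.minus_eq minus_eq)
qed

context residue_hull
begin

text \<open>This identifies \<mm>^n (R/\<pp>) with (\<pp> + \<mm>^n)/\<pp>: the latter is a
  submodule containing the multiples by \<mm>^n, and conversely the class of j in \<mm>^n is j times
  the class of 1.\<close>

lemma coset_mem_adic_submodule: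
  assumes p: "ideal \<pp> R" and r: "r \<in> carrier R"
  shows "\<pp> +>\<^bsub>ring_as_module R\<^esub> r \<in> adic_submodule R \<mm> (quot_module (ring_as_module R) \<pp>) n \<longleftrightarrow>
    r \<in> \<pp> <+>\<^bsub>R\<^esub> ideal_pow R \<mm> n"
proof -
  interpret M: module R "ring_as_module R" by (rule ring_as_module)
  have ps: "submodule \<pp> R (ring_as_module R)" using p by (rule submodule_ring_as_module)
  let ?Q = "quot_module (ring_as_module R) \<pp>"
  interpret Q: module R ?Q by (rule M.module_quot_module[OF ps])
  interpret p: ideal \<pp> R by fact
  let ?q = "\<lambda>a. \<pp> +>\<^bsub>ring_as_module R\<^esub> a"
  let ?I = "\<pp> <+>\<^bsub>R\<^esub> ideal_pow R \<mm> n"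
  have I: "ideal ?I R" by (rule add_ideals[OF p ideal_max_pow])
  interpret I: ideal ?I R by (rule I)
  have qc: "?q a \<in> carrier ?Q" if "a \<in> carrier R" for a using that by (simp add: M.carrier_quot_module)
  have qadd: "?q a \<oplus>\<^bsub>?Q\<^esub> ?q b = ?q (a \<oplus>\<^bsub>R\<^esub> b)" if "a \<in> carrier R" "b \<in> carrier R" for a b
    using M.add_quot_module[OF ps, of a b] that by simp
  have qsm: "a \<odot>\<^bsub>?Q\<^esub> ?q b = ?q (a \<otimes>\<^bsub>R\<^esub> b)" if "a \<in> carrier R" "b \<in> carrier R" for a b
    using M.smult_quot_module[OF ps that(1), of b] that by simp
  have qeq: "?q a = ?q b \<longleftrightarrow> a \<ominus>\<^bsub>R\<^esub> b \<in> \<pp>" if "a \<in> carrier R" "b \<in> carrier R" for a b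
    using M.coset_eq_iff[OF ps, of a b] that by (simp add: minus_ring_as_module)
  have pI: "i \<in> ?I" if "i \<in> \<pp>" for i
    unfolding set_add_def' using that p.Icarr additive_subgroup.zero_closed[OF ideal.axioms(1)[OF ideal_max_pow[of n]]]
    by (auto intro!: bexI[OF _ that] bexI[of _ "\<zero>\<^bsub>R\<^esub>"])
  have mI: "i \<in> ?I" if "i \<in> ideal_pow R \<mm> n" for i
    unfolding set_add_def' using that max_pow_carrier additive_subgroup.zero_closed[OF ideal.axioms(1)[OF p]]
    by (auto intro!: bexI[OF _ that] bexI[of _ "\<zero>\<^bsub>R\<^esub>"])
  have T: "submodule (?q ` ?I) R ?Q"
  proof (rule Q.submoduleI2)
    show "\<zero>\<^bsub>?Q\<^esub> \<in> ?q ` ?I"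
      using M.zero_quot_module[OF ps] additive_subgroup.zero_closed[OF ideal.axioms(1)[OF I]] by auto
    show "x \<oplus>\<^bsub>?Q\<^esub> y \<in> ?q ` ?I" if "x \<in> ?q ` ?I" "y \<in> ?q ` ?I" for x y
      using that qadd I.Icarr additive_subgroup.a_closed[OF ideal.axioms(1)[OF I]] by auto
    show "a \<odot>\<^bsub>?Q\<^esub> x \<in> ?q ` ?I" if "a \<in> carrier R" "x \<in> ?q ` ?I" for a x
      using that qsm I.Icarr I.I_l_closed by auto
  qed (use qc I.Icarr in auto)
  have "adic_submodule R \<mm> ?Q n \<subseteq> ?q ` ?I"
    unfolding Q.adic_submodule_eq
  proof (rule Q.ideal_smult_subset[OF T])
    fix a x assume a: "a \<in> ideal_pow R \<mm> n" and x: "x \<in> carrier ?Q"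
    obtain b where b: "b \<in> carrier R" "x = ?q b" using x by (auto simp: M.carrier_quot_module)
    have "a \<otimes>\<^bsub>R\<^esub> b \<in> ?I" using mI[OF a] b(1) by (rule I.I_r_closed)
    then show "a \<odot>\<^bsub>?Q\<^esub> x \<in> ?q ` ?I" using b qsm[OF max_pow_carrier[OF a] b(1)] by auto
  qed
  moreover have "r \<in> ?I" if eq: "?q r = ?q b" and b: "b \<in> ?I" for b
  proof -
    have "r = (r \<ominus>\<^bsub>R\<^esub> b) \<oplus>\<^bsub>R\<^esub> b" using r I.Icarr[OF b] by (simp add: R.add_minus_cancel)
    also have "\<dots> \<in> ?I"
      using qeq[OF r I.Icarr[OF b]] eq pI b by (intro additive_subgroup.a_closed[OF ideal.axioms(1)[OF I]]) auto
    finally show ?thesis .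
  qed
  moreover have "?q r \<in> adic_submodule R \<mm> ?Q n" if "r \<in> ?I"
  proof -
    obtain i j where ij: "i \<in> \<pp>" "j \<in> ideal_pow R \<mm> n" "r = i \<oplus>\<^bsub>R\<^esub> j" using \<open>r \<in> ?I\<close> unfolding set_add_def' by blast
    have c: "i \<in> carrier R" "j \<in> carrier R" using ij p.Icarr max_pow_carrier by auto
    have "r \<ominus>\<^bsub>R\<^esub> j = i" unfolding ij(3) using c by (simp add: R.minus_eq R.a_assoc R.r_neg)
    then have "?q r = ?q j" using qeq[OF r c(2)] ij(1) by simp
    also have "\<dots> = j \<odot>\<^bsub>?Q\<^esub> ?q \<one>\<^bsub>R\<^esub>" using qsm[OF c(2) R.one_closed] c by simp
    also have "\<dots> \<in> adic_submodule R \<mm> ?Q n"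
      unfolding Q.adic_submodule_eq using ij(2) qc[OF R.one_closed] by (rule Q.smult_mem_ideal_smult)
    finally show ?thesis .
  qed
  ultimately show ?thesis by blast
qed

text \<open>The map to the completion is injective by Krull's theorem, so completeness amounts to
  surjectivity, and this is the existence of limits once sequences of classes are lifted to
  \<open>R\<close>.\<close>

lemma adically_complete_iff_adic_limits:
  assumes p: "ideal \<pp> R"
  shows "adically_complete R \<mm> (quot_module (ring_as_module R) \<pp>) \<longleftrightarrow> adic_limits R \<mm> \<pp>"
proof -
  interpret M: module R "ring_as_module R" by (rule ring_as_module)
  have ps: "submodule \<pp> R (ring_as_module R)" using p by (rule submodule_ring_as_module)
  let ?Q = "quot_module (ring_as_module R) \<pp>"
  interpret Q: module R ?Q by (rule M.module_quot_module[OF ps])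
  let ?q = "\<lambda>a. \<pp> +>\<^bsub>ring_as_module R\<^esub> a"
  let ?I = "\<lambda>n. \<pp> <+>\<^bsub>R\<^esub> ideal_pow R \<mm> n"
  have qc: "?q a \<in> carrier ?Q" if "a \<in> carrier R" for a using that by (simp add: M.carrier_quot_module)
  have cQ: "\<exists>a\<in>carrier R. x = ?q a" if "x \<in> carrier ?Q" for x using that by (auto simp: M.carrier_quot_module)
  have diff: "?q a \<ominus>\<^bsub>?Q\<^esub> ?q b \<in> adic_submodule R \<mm> ?Q n \<longleftrightarrow> a \<ominus>\<^bsub>R\<^esub> b \<in> ?I n"
    if "a \<in> carrier R" "b \<in> carrier R" for a b n
    using M.minus_quot_module[OF ps, of a b] that coset_mem_adic_submodule[OF p, of "a \<ominus>\<^bsub>R\<^esub> b" n]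
    by (simp add: minus_ring_as_module)
  have coh: "Q.coherent \<mm> (\<lambda>n. ?q (a n)) \<longleftrightarrow> (\<forall>n. a (Suc n) \<ominus>\<^bsub>R\<^esub> a n \<in> ?I n)" if "\<And>n. a n \<in> carrier R" for a
    using that qc diff by (simp add: Q.coherent_def)
  have inj: "inj_on (\<lambda>x. Q.adic_class \<mm> (\<lambda>n. x)) (carrier ?Q)"
  proof (rule inj_onI)
    fix x y assume xy: "x \<in> carrier ?Q" "y \<in> carrier ?Q" "Q.adic_class \<mm> (\<lambda>n. x) = Q.adic_class \<mm> (\<lambda>n. y)"
    obtain a b where ab: "a \<in> carrier R" "b \<in> carrier R" "x = ?q a" "y = ?q b" using cQ xy by meson
    have "a \<ominus>\<^bsub>R\<^esub> b \<in> ?I n" for n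
      using xy(3) Q.adic_class_eq_iff[OF ideal_max, of "\<lambda>n. x" "\<lambda>n. y"] xy(1,2) diff[OF ab(1,2)] ab by simp
    then have "a \<ominus>\<^bsub>R\<^esub> b \<in> \<pp>" using ab by (intro Krull_intersection[OF p]) auto
    then show "x = y" using M.coset_eq_iff[OF ps, of a b] ab by (simp add: minus_ring_as_module)
  qed
  have sub: "(\<lambda>x. Q.adic_class \<mm> (\<lambda>n. x)) ` carrier ?Q \<subseteq> carrier (adic_completion R \<mm> ?Q)"
    using Q.coherent_const[OF ideal_max] Q.carrier_adic_completion[OF ideal_max] by blast
  have lim: "(\<exists>x\<in>carrier ?Q. Q.adic_class \<mm> (\<lambda>n. ?q (a n)) = Q.adic_class \<mm> (\<lambda>n. x)) \<longleftrightarrow>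
    (\<exists>d\<in>carrier R. \<forall>n. a n \<ominus>\<^bsub>R\<^esub> d \<in> ?I n)" if a: "\<And>n. a n \<in> carrier R" for a
  proof -
    have "Q.adic_class \<mm> (\<lambda>n. ?q (a n)) = Q.adic_class \<mm> (\<lambda>n. ?q d) \<longleftrightarrow> (\<forall>n. a n \<ominus>\<^bsub>R\<^esub> d \<in> ?I n)"
      if "d \<in> carrier R" for d
      using Q.adic_class_eq_iff[OF ideal_max, of "\<lambda>n. ?q (a n)" "\<lambda>n. ?q d"] qc a that diff by simp
    then show ?thesis unfolding M.carrier_quot_module by auto
  qed
  have surj: "carrier (adic_completion R \<mm> ?Q) \<subseteq> (\<lambda>x. Q.adic_class \<mm> (\<lambda>n. x)) ` carrier ?Q \<longleftrightarrow> adic_limits R \<mm> \<pp>"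
  proof
    assume *: "carrier (adic_completion R \<mm> ?Q) \<subseteq> (\<lambda>x. Q.adic_class \<mm> (\<lambda>n. x)) ` carrier ?Q"
    show "adic_limits R \<mm> \<pp>"
      unfolding adic_limits_def
    proof (intro allI impI)
      fix a assume "\<forall>n. a n \<in> carrier R \<and> a (Suc n) \<ominus>\<^bsub>R\<^esub> a n \<in> ?I n"
      then have a: "\<And>n. a n \<in> carrier R" "Q.coherent \<mm> (\<lambda>n. ?q (a n))" using coh by auto
      then have "Q.adic_class \<mm> (\<lambda>n. ?q (a n)) \<in> carrier (adic_completion R \<mm> ?Q)"
        using Q.carrier_adic_completion[OF ideal_max] by blast
      then have "\<exists>x\<in>carrier ?Q. Q.adic_class \<mm> (\<lambda>n. ?q (a n)) = Q.adic_class \<mm> (\<lambda>n. x)" using * by blast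
      then show "\<exists>d\<in>carrier R. \<forall>n. a n \<ominus>\<^bsub>R\<^esub> d \<in> ?I n" using lim[of a, OF a(1)] by blast
    qed
  next
    assume *: "adic_limits R \<mm> \<pp>"
    show "carrier (adic_completion R \<mm> ?Q) \<subseteq> (\<lambda>x. Q.adic_class \<mm> (\<lambda>n. x)) ` carrier ?Q"
    proof
      fix x assume "x \<in> carrier (adic_completion R \<mm> ?Q)"
      then obtain c where c: "Q.coherent \<mm> c" "x = Q.adic_class \<mm> c" unfolding Q.carrier_adic_completion[OF ideal_max] by blast
      have "\<forall>n. \<exists>a\<in>carrier R. c n = ?q a" using c(1) cQ by (simp add: Q.coherent_def)
      then obtain a where a: "\<And>n. a n \<in> carrier R" "\<And>n. c n = ?q (a n)" by metis
      have ceq: "c = (\<lambda>n. ?q (a n))" using a(2) by blast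
      have "\<forall>n. a (Suc n) \<ominus>\<^bsub>R\<^esub> a n \<in> ?I n" using c(1) coh[of a, OF a(1)] unfolding ceq by blast
      then have "\<exists>d\<in>carrier R. \<forall>n. a n \<ominus>\<^bsub>R\<^esub> d \<in> ?I n" using * a(1) unfolding adic_limits_def by blast
      then show "x \<in> (\<lambda>x. Q.adic_class \<mm> (\<lambda>n. x)) ` carrier ?Q" using lim[of a, OF a(1)] c(2) unfolding ceq by blast
    qed
  qed
  have "adically_complete R \<mm> ?Q \<longleftrightarrow>
    bij_betw (\<lambda>x. Q.adic_class \<mm> (\<lambda>n. x)) (carrier ?Q) (carrier (adic_completion R \<mm> ?Q))"
    by (simp add: adically_complete_def Q.adic_class_def)
  also have "\<dots> \<longleftrightarrow> adic_limits R \<mm> \<pp>" using inj sub surj unfolding bij_betw_def by blast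
  finally show ?thesis .
qed

end

section \<open>Dimension of the residue ring\<close>

lemma carrier_FactRing: "carrier (R Quot I) = (\<lambda>r. I +>\<^bsub>R\<^esub> r) ` carrier R"
  unfolding FactRing_def partial_object.simps A_RCOSETS_def' by blast

text \<open>Since \<open>I\<close> lies in \<open>q\<close>, membership in \<open>q\<close> depends
  only on the class modulo \<open>I\<close>, and primality passes to the image.\<close>

lemma (in primeideal) image_prime_quotient:
  assumes q: "primeideal q R" "I \<subseteq> q"
  shows "primeideal ((+>) I ` q) (R Quot I)"
    and "r \<in> carrier R \<Longrightarrow> I +> r \<in> (+>) I ` q \<longleftrightarrow> r \<in> q"
proof -
  interpret q: primeideal q R by fact
  interpret h: ring_hom_ring R "R Quot I" "(+>) I" by (rule rcos_ring_hom_ring)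
  interpret D: domain "R Quot I" by (rule quotient_is_domain)
  have mem: "I +> r \<in> (+>) I ` q \<longleftrightarrow> r \<in> q" if r: "r \<in> carrier R" for r
  proof
    assume "I +> r \<in> (+>) I ` q"
    then obtain s where s: "s \<in> q" "I +> r = I +> s" by blast
    have "r \<ominus> s \<in> I" using s r q.Icarr quotient_eq_iff_same_a_r_cos[OF is_ideal r q.Icarr[OF s(1)]] by blast
    then have "r \<ominus> s \<in> q" using q(2) by blast
    then have "(r \<ominus> s) \<oplus> s \<in> q" using s(1) by (rule additive_subgroup.a_closed[OF q.is_additive_subgroup])
    then show "r \<in> q" using r q.Icarr[OF s(1)] by (simp add: minus_eq a_assoc l_neg)
  qed blast
  then show "r \<in> carrier R \<Longrightarrow> I +> r \<in> (+>) I ` q \<longleftrightarrow> r \<in> q" .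
  note car = carrier_FactRing[of R I]
  show "primeideal ((+>) I ` q) (R Quot I)"
  proof (rule primeidealI)
    have "\<one> \<notin> q" using q.one_imp_carrier q.I_notcarr by auto
    then show "carrier (R Quot I) \<noteq> (+>) I ` q" using mem[OF one_closed] car by blast
    show "ideal ((+>) I ` q) (R Quot I)"
      using ring_ideal_imp_quot_ideal[OF is_ideal q.is_ideal] .
    fix x y assume "x \<in> carrier (R Quot I)" "y \<in> carrier (R Quot I)" "x \<otimes>\<^bsub>R Quot I\<^esub> y \<in> (+>) I ` q"
    then obtain a b where ab: "a \<in> carrier R" "b \<in> carrier R" "x = I +> a" "y = I +> b"
      "(I +> a) \<otimes>\<^bsub>R Quot I\<^esub> (I +> b) \<in> (+>) I ` q" unfolding car by blast
    then have "I +> (a \<otimes> b) \<in> (+>) I ` q" by simp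
    then have "a \<otimes> b \<in> q" using mem ab by blast
    then show "x \<in> (+>) I ` q \<or> y \<in> (+>) I ` q" using q.I_prime[OF ab(1,2)] ab(3,4) by blast
  qed (rule D.cring_axioms)
qed

text \<open>The pair \<pp> \<subset> \<mm> gives a chain of length 1, so only length 2 has to be
  decided. A prime in between extends the pair to such a chain; conversely, a longer chain
  contracted to \<open>R\<close> starts above \<pp>, and its third member lies in \<mm>, so its
  second is strictly between.\<close>

lemma krull_dim_quotient_eq_1_iff:
  assumes loc: "local_noetherian_ring R \<mm>" and p: "primeideal \<pp> R" "\<pp> \<noteq> \<mm>"
  shows "krull_dim (R Quot \<pp>) = 1 \<longleftrightarrow> \<not> (\<exists>q. primeideal q R \<and> \<pp> \<subset> q \<and> q \<subset> \<mm>)"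
proof -
  interpret p: primeideal \<pp> R by fact
  have max: "primeideal \<mm> R" using loc by (rule local_noetherian_ring_prime)
  have pm: "\<pp> \<subset> \<mm>" using local_noetherian_ring_proper[OF loc p.is_ideal] p.I_notcarr p(2) by blast
  let ?\<pi> = "\<lambda>q. (\<lambda>r. \<pp> +>\<^bsub>R\<^esub> r) ` q"
  interpret h: ring_hom_ring R "R Quot \<pp>" "(+>\<^bsub>R\<^esub>) \<pp>" by (rule p.rcos_ring_hom_ring)
  note car = carrier_FactRing[of R \<pp>]
  have im: "primeideal (?\<pi> q) (R Quot \<pp>)" if "primeideal q R" "\<pp> \<subseteq> q" for q using p.image_prime_quotient[OF that] by blast
  have strict: "?\<pi> q \<subset> ?\<pi> q'" if q: "primeideal q R" "\<pp> \<subseteq> q" "primeideal q' R" "q \<subset> q'" for q q'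
  proof -
    obtain r where r: "r \<in> q'" "r \<notin> q" using q by blast
    interpret q': primeideal q' R by fact
    have "\<pp> +>\<^bsub>R\<^esub> r \<notin> ?\<pi> q" using p.image_prime_quotient(2)[OF q(1,2) q'.Icarr[OF r(1)]] r(2) by simp
    moreover have "\<pp> +>\<^bsub>R\<^esub> r \<in> ?\<pi> q'" using r(1) by (rule imageI)
    moreover have "?\<pi> q \<subseteq> ?\<pi> q'" using q(4) by (intro image_mono) blast
    ultimately show ?thesis by blast
  qed
  let ?A = "{enat n | n. \<exists>P. (\<forall>i\<le>n. primeideal (P i) (R Quot \<pp>)) \<and> (\<forall>i<n. P i \<subset> P (Suc i))}"
  have dim: "krull_dim (R Quot \<pp>) = Sup ?A" by (simp add: krull_dim_def)
  have mem: "enat n \<in> ?A" if "\<forall>i\<le>n. primeideal (P i) (R Quot \<pp>)" "\<forall>i<n. P i \<subset> P (Suc i)" for n P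
    by (rule CollectI, intro exI conjI) (rule refl, rule that(1), rule that(2))
  show ?thesis
  proof
    assume 1: "krull_dim (R Quot \<pp>) = 1"
    show "\<not> (\<exists>q. primeideal q R \<and> \<pp> \<subset> q \<and> q \<subset> \<mm>)"
    proof
      assume "\<exists>q. primeideal q R \<and> \<pp> \<subset> q \<and> q \<subset> \<mm>"
      then obtain q where q: "primeideal q R" "\<pp> \<subset> q" "q \<subset> \<mm>" by blast
      define P where "P i = (if i = 0 then ?\<pi> \<pp> else if i = 1 then ?\<pi> q else ?\<pi> \<mm>)" for i :: nat
      have "enat 2 \<in> ?A"
      proof (rule mem)
        show "\<forall>i\<le>2. primeideal (P i) (R Quot \<pp>)" using im p(1) q max pm by (auto simp: P_def)
        have "P 0 \<subset> P 1" using strict[OF p(1) _ q(1,2)] by (simp add: P_def)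
        moreover have "P 1 \<subset> P 2" using strict[OF q(1) _ max q(3)] q(2) by (simp add: P_def psubset_imp_subset)
        ultimately show "\<forall>i<2. P i \<subset> P (Suc i)" by (auto simp: numeral_2_eq_2 less_Suc_eq)
      qed
      then have "enat 2 \<le> Sup ?A" by (rule Sup_upper)
      then show False using 1 unfolding dim by (simp add: one_enat_def)
    qed
  next
    assume no: "\<not> (\<exists>q. primeideal q R \<and> \<pp> \<subset> q \<and> q \<subset> \<mm>)"
    define P where "P i = (if i = 0 then ?\<pi> \<pp> else ?\<pi> \<mm>)" for i :: nat
    have "enat 1 \<in> ?A"
    proof (rule mem)
      show "\<forall>i\<le>1. primeideal (P i) (R Quot \<pp>)" using im p(1) max pm by (auto simp: P_def)
      show "\<forall>i<1. P i \<subset> P (Suc i)" using strict[OF p(1) _ max pm] by (simp add: P_def)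
    qed
    then have ge: "1 \<le> Sup ?A" using Sup_upper[of "enat 1" ?A] by (simp add: one_enat_def)
    have "Sup ?A \<le> 1"
    proof (rule Sup_least)
      fix x assume "x \<in> ?A"
      then obtain n P where n: "x = enat n" "\<forall>i\<le>n. primeideal (P i) (R Quot \<pp>)" "\<forall>i<n. P i \<subset> P (Suc i)" by blast
      have "n \<le> 1"
      proof (rule ccontr)
        assume "\<not> n \<le> 1"
        then have P: "primeideal (P 0) (R Quot \<pp>)" "primeideal (P 1) (R Quot \<pp>)" "primeideal (P 2) (R Quot \<pp>)"
          "P 0 \<subset> P 1" "P 1 \<subset> P 2" using n by (auto simp: numeral_2_eq_2)
        define q where "q Q = {r \<in> carrier R. \<pp> +>\<^bsub>R\<^esub> r \<in> Q}" for Q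
        have q: "primeideal (q Q) R" if "primeideal Q (R Quot \<pp>)" for Q
          unfolding q_def using loc by (intro h.primeideal_vimage[OF _ that]) (simp add: local_noetherian_ring_def)
        have qs: "q Q \<subset> q Q'" if "Q \<subset> Q'" "primeideal Q' (R Quot \<pp>)" for Q Q'
        proof -
          obtain x where x: "x \<in> Q'" "x \<notin> Q" using \<open>Q \<subset> Q'\<close> by blast
          have "x \<in> carrier (R Quot \<pp>)" by (rule ideal.Icarr[OF primeideal.axioms(1)[OF that(2)] x(1)])
          then obtain r where "r \<in> carrier R" "x = \<pp> +>\<^bsub>R\<^esub> r" unfolding car by blast
          then have "r \<in> q Q'" "r \<notin> q Q" using x by (simp_all add: q_def)
          moreover have "q Q \<subseteq> q Q'" using that(1) by (auto simp: q_def)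
          ultimately show ?thesis by blast
        qed
        have "\<pp> \<subseteq> q (P 0)"
        proof
          fix r assume r: "r \<in> \<pp>"
          have "\<pp> +>\<^bsub>R\<^esub> r = \<zero>\<^bsub>R Quot \<pp>\<^esub>" by (simp only: p.a_rcos_zero[OF p.is_ideal r] FactRing_def ring.simps)
          also have "\<dots> \<in> P 0"
            using additive_subgroup.zero_closed[OF ideal.axioms(1)[OF primeideal.axioms(1)[OF P(1)]]] .
          finally show "r \<in> q (P 0)" using p.Icarr[OF r] by (simp add: q_def)
        qed
        moreover have "q (P 2) \<subseteq> \<mm>"
          using local_noetherian_ring_proper[OF loc primeideal.axioms(1)[OF q[OF P(3)]]] primeideal.I_notcarr[OF q[OF P(3)]] by blast
        ultimately show False using no q[OF P(2)] qs[OF P(4,2)] qs[OF P(5,3)] by blast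
      qed
      then show "x \<le> 1" using n(1) by (simp add: one_enat_def)
    qed
    then show "krull_dim (R Quot \<pp>) = 1" unfolding dim using ge by (rule antisym)
  qed
qed

section \<open>The Enochs number\<close>

lemma linear_map_add_map:
  assumes "linear_map R M N f" "linear_map R M N g" "module R N"
  shows "linear_map R M N (\<lambda>x. f x \<oplus>\<^bsub>N\<^esub> g x)"
proof -
  interpret N: module R N by fact
  show ?thesis using assms by (auto simp: linear_map_def N.smult_r_distr N.M.a_ac)
qed

lemma Hom_module_simps:
  "carrier (Hom_module R M N) = linear_maps R M N"
  "f \<oplus>\<^bsub>Hom_module R M N\<^esub> g = (\<lambda>x\<in>carrier M. f x \<oplus>\<^bsub>N\<^esub> g x)"
  "r \<odot>\<^bsub>Hom_module R M N\<^esub> f = (\<lambda>x\<in>carrier M. r \<odot>\<^bsub>N\<^esub> f x)"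
  by (simp_all add: Hom_module_def)

lemma Hom_module_add_closed:
  assumes "f \<in> linear_maps R M N" "g \<in> linear_maps R M N" "module R M" "module R N"
  shows "f \<oplus>\<^bsub>Hom_module R M N\<^esub> g \<in> linear_maps R M N"
  unfolding Hom_module_simps(2)
  by (intro linear_map_restrict linear_map_add_map linear_maps_imp_linear_map assms)

lemma Hom_module_smult_closed:
  assumes "r \<in> carrier R" "f \<in> linear_maps R M N" "module R M" "module R N"
  shows "r \<odot>\<^bsub>Hom_module R M N\<^esub> f \<in> linear_maps R M N"
  unfolding Hom_module_simps(3)
  by (intro linear_map_restrict linear_map_smult_map linear_maps_imp_linear_map assms)

lemma linear_maps_eqI:
  assumes "f \<in> linear_maps R M N" "g \<in> linear_maps R M N" "\<And>x. x \<in> carrier M \<Longrightarrow> f x = g x"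
  shows "f = g"
  using assms by (auto simp: linear_maps_def intro: PiE_ext)

text \<open>A map vanishing on the elements killed by \<open>a\<^sub>1, \<dots>, a\<^sub>k\<close> is \<open>a\<^sub>1 g\<^sub>1 + \<dots> + a\<^sub>k g\<^sub>k\<close>: it
  induces a map on the image of \<open>a\<^sub>1\<close> restricted to the elements killed by \<open>a\<^sub>2, \<dots>, a\<^sub>k\<close>, which
  extends by injectivity.\<close>

lemma linear_map_vanishing_on_killed:
  fixes R :: "('a, 'r) ring_scheme" and E :: "('a, 'e, 'k) module_scheme" and F :: "('a, 'f, 'n) module_scheme"
  assumes E: "injective_module R E" and F: "module R F" and as: "set as \<subseteq> carrier R"
    and Z0: "(\<lambda>x\<in>carrier F. \<zero>\<^bsub>E\<^esub>) \<in> Z"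
    and Zadd: "\<And>g h. g \<in> Z \<Longrightarrow> h \<in> Z \<Longrightarrow> g \<in> linear_maps R F E \<Longrightarrow> h \<in> linear_maps R F E \<Longrightarrow>
       g \<oplus>\<^bsub>Hom_module R F E\<^esub> h \<in> Z"
    and Zs: "\<And>a g. a \<in> set as \<Longrightarrow> g \<in> linear_maps R F E \<Longrightarrow> a \<odot>\<^bsub>Hom_module R F E\<^esub> g \<in> Z"
    and h: "h \<in> linear_maps R F E" "\<And>y. y \<in> module.killed F (set as) \<Longrightarrow> h y = \<zero>\<^bsub>E\<^esub>"
  shows "h \<in> Z"
proof -
  interpret E: module R E using E by (simp add: injective_module_def)
  interpret F: module R F by fact
  let ?H = "Hom_module R F E"
  have "h \<in> Z" if "set bs \<subseteq> set as" "h \<in> linear_maps R F E" "\<And>y. y \<in> F.killed (set bs) \<Longrightarrow> h y = \<zero>\<^bsub>E\<^esub>" for bs h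
    using that
  proof (induction bs arbitrary: h)
    case Nil
    have "h \<in> extensional (carrier F)" using Nil(2) by (auto simp: linear_maps_def PiE_def)
    then have eq: "h = (\<lambda>x\<in>carrier F. \<zero>\<^bsub>E\<^esub>)"
      using Nil(3) by (intro extensionalityI[of _ "carrier F"]) (auto simp: F.killed_def)
    show ?case unfolding eq by (rule Z0)
  next
    case (Cons b bs)
    have b: "b \<in> carrier R" "b \<in> set as" and bs: "set bs \<subseteq> carrier R" using Cons.prems(1) as by auto
    have hl: "linear_map R F E h" using Cons.prems(2) by (rule linear_maps_imp_linear_map)
    note hc = linear_map_closed[OF hl]
    note N = F.submodule_killed[OF bs]
    note ND = F.submoduleD[OF N]
    define G where "G = (\<lambda>y. (b \<odot>\<^bsub>F\<^esub> y, h y)) ` F.killed (set bs)"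
    have GI: "(b \<odot>\<^bsub>F\<^esub> y, h y) \<in> G" if "y \<in> F.killed (set bs)" for y using that by (auto simp: G_def)
    obtain g where g: "linear_map R F E g" "\<And>x y. (x, y) \<in> G \<Longrightarrow> g x = y"
    proof (rule injective_extend_graph[OF E F, of G])
      show "G \<subseteq> carrier F \<times> carrier E" using ND(1) hc b by (auto simp: G_def)
      show "(\<zero>\<^bsub>F\<^esub>, \<zero>\<^bsub>E\<^esub>) \<in> G" using GI[OF ND(2)] b linear_map_zero[OF hl F E.module_axioms] by simp
      show "(x \<oplus>\<^bsub>F\<^esub> x', y \<oplus>\<^bsub>E\<^esub> y') \<in> G" if xy: "(x, y) \<in> G" "(x', y') \<in> G" for x y x' y'
      proof -
        obtain e where e: "e \<in> F.killed (set bs)" "x = b \<odot>\<^bsub>F\<^esub> e" "y = h e" using xy by (auto simp: G_def)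
        obtain e' where e': "e' \<in> F.killed (set bs)" "x' = b \<odot>\<^bsub>F\<^esub> e'" "y' = h e'" using xy by (auto simp: G_def)
        show ?thesis using GI[OF ND(3)[OF e(1) e'(1)]] e e' ND(1) b by (simp add: F.smult_r_distr linear_map_add[OF hl])
      qed
      show "(r \<odot>\<^bsub>F\<^esub> x, r \<odot>\<^bsub>E\<^esub> y) \<in> G" if r: "r \<in> carrier R" and xy: "(x, y) \<in> G" for r x y
      proof -
        obtain e where e: "e \<in> F.killed (set bs)" "x = b \<odot>\<^bsub>F\<^esub> e" "y = h e" using xy by (auto simp: G_def)
        show ?thesis using GI[OF ND(4)[OF r e(1)]] e ND(1) b r by (simp add: F.smult_swap[of b r] linear_map_smult[OF hl])
      qed
      show "y = \<zero>\<^bsub>E\<^esub>" if 0: "(\<zero>\<^bsub>F\<^esub>, y) \<in> G" for y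
      proof -
        obtain e where e: "e \<in> F.killed (set bs)" "\<zero>\<^bsub>F\<^esub> = b \<odot>\<^bsub>F\<^esub> e" "y = h e" using 0 by (auto simp: G_def)
        then have "e \<in> F.killed (set (b # bs))" by (auto simp: F.killed_def)
        then show ?thesis using Cons.prems(3) e(3) by blast
      qed
    qed (rule that)
    define k where "k = restrict g (carrier F)"
    have k: "k \<in> linear_maps R F E" unfolding k_def using g(1) F by (rule linear_map_restrict)
    \<comment> \<open>As \<open>k\<close> sends b y to h y for y killed by the remaining generators,
      h - b k vanishes on these y and falls under the induction hypothesis.\<close>
    define t where "t = (\<lambda>x\<in>carrier F. h x \<ominus>\<^bsub>E\<^esub> b \<odot>\<^bsub>E\<^esub> k x)"
    have kl: "linear_map R F E k" using k by (rule linear_maps_imp_linear_map)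
    have t: "t \<in> linear_maps R F E"
      unfolding t_def by (intro linear_map_restrict linear_map_diff_map linear_map_smult_map hl kl b F E.module_axioms)
    have "t y = \<zero>\<^bsub>E\<^esub>" if "y \<in> F.killed (set bs)" for y
    proof -
      have y: "y \<in> carrier F" using ND(1) that .
      have "b \<odot>\<^bsub>E\<^esub> k y = h y" using linear_map_smult[OF g(1) b(1) y] g(2)[OF GI[OF that]] y by (simp add: k_def)
      then show ?thesis using y hc[OF y] by (simp add: t_def E.M.minus_eq_zero)
    qed
    then have "t \<in> Z" using Cons.prems(1) t by (intro Cons.IH) auto
    then have "t \<oplus>\<^bsub>?H\<^esub> (b \<odot>\<^bsub>?H\<^esub> k) \<in> Z"
      by (rule Zadd) (use t Zs b k Hom_module_smult_closed[OF b(1) k F E.module_axioms] in auto)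
    also have "t \<oplus>\<^bsub>?H\<^esub> (b \<odot>\<^bsub>?H\<^esub> k) = h"
    proof (rule linear_maps_eqI[OF _ Cons.prems(2)])
      show "t \<oplus>\<^bsub>?H\<^esub> (b \<odot>\<^bsub>?H\<^esub> k) \<in> linear_maps R F E"
        by (intro Hom_module_add_closed Hom_module_smult_closed t b k F E.module_axioms)
      show "(t \<oplus>\<^bsub>?H\<^esub> (b \<odot>\<^bsub>?H\<^esub> k)) x = h x" if "x \<in> carrier F" for x
        using that hc linear_map_closed[OF kl] b by (simp add: Hom_module_simps t_def E.M.add_minus_cancel)
    qed
    finally show ?case .
  qed
  then show ?thesis using h by blast
qed

text \<open>\<open>K\<close> is taken inside \<open>F\<close> as the elements killed by \<pp>, so
  that maps from \<open>K\<close> to \<open>E\<close> are the restrictions of maps from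
  \<open>F\<close> to \<open>E\<close>, to which Enochs's isomorphism applies.\<close>

locale enochs_module = residue_field_module R E \<mm> e0 "F\<lparr>carrier := module.killed F \<pp>\<rparr>" \<pp> v + F: module R F
  for R (structure) and E (structure) and \<mm> e0 F \<pp> v
begin

lemma restriction_linear:
  assumes "h \<in> linear_maps R F E" shows "linear_map R (F\<lparr>carrier := F.killed \<pp>\<rparr>) E h"
  using linear_maps_imp_linear_map[OF assms] by (auto simp: linear_map_def F.killed_def)

lemma extension_exists:
  assumes g: "linear_map R (F\<lparr>carrier := F.killed \<pp>\<rparr>) E g"
  shows "\<exists>h\<in>linear_maps R F E. \<forall>y\<in>F.killed \<pp>. h y = g y"
proof -
  have pc: "\<pp> \<subseteq> carrier R" using p_carrier by blast
  note ND = F.submoduleD[OF F.submodule_killed[OF pc]]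
  define G where "G = (\<lambda>y. (y, g y)) ` F.killed \<pp>"
  note gD = linear_mapD[OF g, simplified]
  obtain k where k: "linear_map R F E k" "\<And>x y. (x, y) \<in> G \<Longrightarrow> k x = y"
  proof (rule injective_extend_graph[OF injective F.module_axioms, of G])
    have "g \<zero>\<^bsub>F\<^esub> = \<zero>\<^bsub>E\<^esub>" using linear_map_zero[OF g K.module_axioms module_axioms] by simp
    then show "(\<zero>\<^bsub>F\<^esub>, \<zero>\<^bsub>E\<^esub>) \<in> G" "\<And>y. (\<zero>\<^bsub>F\<^esub>, y) \<in> G \<Longrightarrow> y = \<zero>\<^bsub>E\<^esub>" using ND(2) by (auto simp: G_def)
  qed (use ND gD in \<open>auto simp: G_def\<close>)
  show ?thesis
  proof (intro bexI ballI)
    show "restrict k (carrier F) \<in> linear_maps R F E" using k(1) F.module_axioms by (rule linear_map_restrict)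
    show "restrict k (carrier F) y = g y" if "y \<in> F.killed \<pp>" for y using k(2)[of y "g y"] that ND(1)[OF that] by (auto simp: G_def)
  qed
qed

text \<open>Modulo the maps vanishing on \<open>K\<close>, Hom(F, E) is Hom(K, E); modulo the part
  over \<pp>C, the completion is a vector space over the residue field with basis \<open>X\<close>.
  The isomorphism matches the two because both parts divided out are \<pp> times the whole.\<close>

lemma card_enochs_index_set_eq_1_iff:
  fixes X :: "'x set"
  assumes X: "enochs_index_set R \<pp> F E X"
  shows "card X = 1 \<longleftrightarrow> (\<exists>f. dual_generator f)"
proof -
  interpret p: primeideal \<pp> R by (rule prime)
  interpret noetherian_ring R by (rule noetherian)
  let ?L = "localization_at R \<pp>" and ?f = "localization_map R \<pp>" and ?I = "extended_prime R \<pp>"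
  let ?C = "free_module ?L X" and ?H = "Hom_module R F E"
  interpret L: cring ?L by (rule p.cring_localization_at)
  interpret f: ring_hom_cring R ?L ?f
    using p.localization_map_hom by unfold_locales (simp add: ring_hom_def)
  interpret C: module ?L ?C by (rule L.module_free_module)
  let ?Ch = "adic_completion ?L ?I ?C"
  let ?cls = "C.adic_class ?I"
  obtain A where A: "A \<subseteq> carrier R" "finite A" "\<pp> = Idl\<^bsub>R\<^esub> A" using finetely_gen[OF p_ideal] by blast
  obtain as where as: "set as = A" using finite_list[OF A(2)] by blast
  have asR: "set as \<subseteq> carrier R" "\<pp> = Idl\<^bsub>R\<^esub> (set as)" using A as by auto
  have asL: "set (map ?f as) \<subseteq> carrier ?L" using asR(1) by auto
  have Igen: "?I = Idl\<^bsub>?L\<^esub> (set (map ?f as))" using p.extended_prime_generators[OF asR] .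
  have I: "ideal ?I ?L" unfolding Igen using asL by (rule L.genideal_ideal)
  have asp: "set as \<subseteq> \<pp>" using genideal_self[OF asR(1)] asR(2) by blast
  have killed_as: "F.killed (set as) = F.killed \<pp>"
  proof
    show "F.killed \<pp> \<subseteq> F.killed (set as)" using asp by (auto simp: F.killed_def)
    show "F.killed (set as) \<subseteq> F.killed \<pp>"
    proof
      fix y assume y: "y \<in> F.killed (set as)"
      have "ideal {r \<in> carrier R. \<forall>x\<in>{y}. r \<odot>\<^bsub>F\<^esub> x = \<zero>\<^bsub>F\<^esub>} R"
        using y by (intro F.ideal_annihilator) (simp add: F.killed_def)
      then have "\<pp> \<subseteq> {r \<in> carrier R. \<forall>x\<in>{y}. r \<odot>\<^bsub>F\<^esub> x = \<zero>\<^bsub>F\<^esub>}"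
        unfolding asR(2) using y asR(1) by (intro genideal_minimal) (auto simp: F.killed_def)
      then show "y \<in> F.killed \<pp>" using y by (auto simp: F.killed_def)
    qed
  qed
  obtain \<Psi> where \<Psi>: "\<Psi> \<in> linear_maps R ?H (restrict_scalars ?f ?Ch)"
    and bij: "bij_betw \<Psi> (linear_maps R F E) (carrier ?Ch)"
    using X unfolding enochs_index_set_def isomorphic_modules_def
    by (auto simp: Hom_module_simps restrict_scalars_def)
  have \<Psi>c: "\<Psi> h \<in> carrier ?Ch" if "h \<in> linear_maps R F E" for h using bij that by (auto simp: bij_betw_def)
  have \<Psi>add: "\<Psi> (h \<oplus>\<^bsub>?H\<^esub> g) = \<Psi> h \<oplus>\<^bsub>?Ch\<^esub> \<Psi> g" if "h \<in> linear_maps R F E" "g \<in> linear_maps R F E" for h g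
    using \<Psi> that unfolding linear_maps_def[of R ?H] Hom_module_simps(1) by (simp add: restrict_scalars_def)
  have \<Psi>sm: "\<Psi> (r \<odot>\<^bsub>?H\<^esub> h) = ?f r \<odot>\<^bsub>?Ch\<^esub> \<Psi> h" if "r \<in> carrier R" "h \<in> linear_maps R F E" for r h
    using \<Psi> that unfolding linear_maps_def[of R ?H] Hom_module_simps(1) by (simp add: restrict_scalars_def)
  have \<Psi>inj: "h = g" if "\<Psi> h = \<Psi> g" "h \<in> linear_maps R F E" "g \<in> linear_maps R F E" for h g
    using bij that by (auto simp: bij_betw_def dest: inj_onD)
  have \<Psi>surj: "\<exists>h\<in>linear_maps R F E. \<Psi> h = z" if "z \<in> carrier ?Ch" for z
  proof -
    have "z \<in> \<Psi> ` linear_maps R F E" using bij that by (simp add: bij_betw_def)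
    then show ?thesis by blast
  qed
  have Hadd: "h \<oplus>\<^bsub>?H\<^esub> g \<in> linear_maps R F E" if "h \<in> linear_maps R F E" "g \<in> linear_maps R F E" for h g
    using that by (intro Hom_module_add_closed F.module_axioms module_axioms)
  have Hsm: "r \<odot>\<^bsub>?H\<^esub> h \<in> linear_maps R F E" if "r \<in> carrier R" "h \<in> linear_maps R F E" for r h
    using that by (intro Hom_module_smult_closed F.module_axioms module_axioms)
  have ev: "(h \<oplus>\<^bsub>?H\<^esub> g) y = h y \<oplus>\<^bsub>E\<^esub> g y" "(r \<odot>\<^bsub>?H\<^esub> h) y = r \<odot>\<^bsub>E\<^esub> h y" if "y \<in> F.killed \<pp>" for h g r y
    using that by (auto simp: Hom_module_simps F.killed_def)
  have hc: "h y \<in> carrier E" if "h \<in> linear_maps R F E" "y \<in> F.killed \<pp>" for h y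
    using that linear_map_closed[OF linear_maps_imp_linear_map[OF that(1)], of y] by (simp add: F.killed_def)
  have cls: "\<exists>c. C.coherent ?I c \<and> z = ?cls c" if "z \<in> carrier ?Ch" for z
    using that C.carrier_adic_completion[OF I] by blast
  have clsc: "?cls c \<in> carrier ?Ch" if "C.coherent ?I c" for c
    using that C.carrier_adic_completion[OF I] by blast
  note bc = L.basis_vector_closed[of X]
  have bcoh: "C.coherent ?I (\<lambda>n. L.basis_vector X b)" for b by (rule C.coherent_const[OF I bc])
  note sub1 = C.submoduleD[OF C.submodule_adic_submodule[OF I, where n = 1]]
  have cohc: "c n \<in> carrier ?C" if "C.coherent ?I c" for c n using that by (simp add: C.coherent_def)
  show ?thesis
  proof
    assume "card X = 1"
    then obtain b where Xb: "X = {b}" by (auto simp: card_1_singleton_iff)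
    obtain h0 where h0: "h0 \<in> linear_maps R F E" "\<Psi> h0 = ?cls (\<lambda>n. L.basis_vector X b)"
      using \<Psi>surj[OF clsc[OF bcoh]] by blast
    \<comment> \<open>Elements of the completion whose preimage vanishes on \<open>K\<close>. The
      set meets the closure conditions of \<open>completion_lift\<close>, as \<pp> kills all values
      taken on \<open>K\<close>.\<close>
    define Z where "Z = {z \<in> carrier ?Ch. \<forall>h\<in>linear_maps R F E. \<Psi> h = z \<longrightarrow> (\<forall>y\<in>F.killed \<pp>. h y = \<zero>\<^bsub>E\<^esub>)}"
    have lift: "?cls c \<in> Z" if c: "C.coherent ?I c" "c 1 \<in> adic_submodule ?L ?I ?C 1" for c
    proof (rule C.completion_lift[OF asL Igen _ _ _ c])
      have zc: "C.coherent ?I (\<lambda>n. \<zero>\<^bsub>?C\<^esub>)" by (rule C.coherent_const[OF I C.M.zero_closed])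
      have "h y = \<zero>\<^bsub>E\<^esub>" if h: "h \<in> linear_maps R F E" "\<Psi> h = ?cls (\<lambda>n. \<zero>\<^bsub>?C\<^esub>)" and y: "y \<in> F.killed \<pp>" for h y
      proof -
        \<comment> \<open>The zero class is unchanged by the scalar 0, so injectivity of \<Psi>
          gives h = 0 h, which is the zero map.\<close>
        have "\<Psi> (\<zero>\<^bsub>R\<^esub> \<odot>\<^bsub>?H\<^esub> h) = \<Psi> h"
          using \<Psi>sm[OF R.zero_closed h(1)] h(2) C.adic_class_smult[OF I zc, of "?f \<zero>\<^bsub>R\<^esub>"] by simp
        then have "h = \<zero>\<^bsub>R\<^esub> \<odot>\<^bsub>?H\<^esub> h" using \<Psi>inj h(1) Hsm[OF R.zero_closed h(1)] by metis
        then have "h y = \<zero>\<^bsub>R\<^esub> \<odot>\<^bsub>E\<^esub> h y" using ev(2)[OF y, of "\<zero>\<^bsub>R\<^esub>" h] by metis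
        then show ?thesis using hc[OF h(1) y] by simp
      qed
      then show "?cls (\<lambda>n. \<zero>\<^bsub>?C\<^esub>) \<in> Z" using clsc[OF zc] by (simp add: Z_def)
    next
      fix x y assume xy: "x \<in> Z" "y \<in> Z" "x \<in> carrier ?Ch" "y \<in> carrier ?Ch"
      obtain h g where hg: "h \<in> linear_maps R F E" "\<Psi> h = x" "g \<in> linear_maps R F E" "\<Psi> g = y"
        using \<Psi>surj xy(3,4) by meson
      have sum: "\<Psi> (h \<oplus>\<^bsub>?H\<^esub> g) = x \<oplus>\<^bsub>?Ch\<^esub> y" using \<Psi>add[OF hg(1,3)] hg by simp
      have "k w = \<zero>\<^bsub>E\<^esub>" if k: "k \<in> linear_maps R F E" "\<Psi> k = x \<oplus>\<^bsub>?Ch\<^esub> y" "w \<in> F.killed \<pp>" for k w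
      proof -
        have "k = h \<oplus>\<^bsub>?H\<^esub> g" using \<Psi>inj[OF _ k(1) Hadd[OF hg(1,3)]] sum k(2) by simp
        moreover have "h w = \<zero>\<^bsub>E\<^esub>" "g w = \<zero>\<^bsub>E\<^esub>" using xy(1,2) hg k(3) unfolding Z_def by blast+
        ultimately show ?thesis using ev(1)[OF k(3), of h g] by simp
      qed
      moreover have "x \<oplus>\<^bsub>?Ch\<^esub> y \<in> carrier ?Ch" using \<Psi>c[OF Hadd[OF hg(1,3)]] sum by simp
      ultimately show "x \<oplus>\<^bsub>?Ch\<^esub> y \<in> Z" by (simp add: Z_def)
    next
      fix a z assume a: "a \<in> set (map ?f as)" and z: "z \<in> carrier ?Ch"
      obtain a0 where a0: "a0 \<in> \<pp>" "a = ?f a0" using a asp by auto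
      obtain g where g: "g \<in> linear_maps R F E" "\<Psi> g = z" using \<Psi>surj[OF z] by blast
      have ar: "a0 \<in> carrier R" using p_carrier a0 by blast
      have sm: "\<Psi> (a0 \<odot>\<^bsub>?H\<^esub> g) = a \<odot>\<^bsub>?Ch\<^esub> z" using \<Psi>sm[OF ar g(1)] a0 g by simp
      have "k w = \<zero>\<^bsub>E\<^esub>" if k: "k \<in> linear_maps R F E" "\<Psi> k = a \<odot>\<^bsub>?Ch\<^esub> z" "w \<in> F.killed \<pp>" for k w
      proof -
        have "k = a0 \<odot>\<^bsub>?H\<^esub> g" using \<Psi>inj[OF _ k(1) Hsm[OF ar g(1)]] sm k(2) by simp
        moreover have "g w \<in> killed \<pp>" using image_killed[OF restriction_linear[OF g(1)], of w] k(3) by simp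
        ultimately show ?thesis using ev(2)[OF k(3), of a0 g] a0(1) by (simp add: killed_def)
      qed
      moreover have "a \<odot>\<^bsub>?Ch\<^esub> z \<in> carrier ?Ch" using \<Psi>c[OF Hsm[OF ar g(1)]] sm by simp
      ultimately show "a \<odot>\<^bsub>?Ch\<^esub> z \<in> Z" by (simp add: Z_def)
    qed
    have ratio: "\<exists>s\<in>carrier R - \<pp>. \<exists>a\<in>carrier R. \<forall>y\<in>F.killed \<pp>. s \<odot>\<^bsub>E\<^esub> h y = a \<odot>\<^bsub>E\<^esub> h0 y"
      if h: "h \<in> linear_maps R F E" for h
    proof -
      obtain c where c: "C.coherent ?I c" "\<Psi> h = ?cls c" using cls[OF \<Psi>c[OF h]] by blast
      \<comment> \<open>Place 1 of the sequence is its class modulo \<pp>C; its only coordinate is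
        written as a fraction a/s.\<close>
      have c1: "c 1 b \<in> carrier ?L" using cohc[OF c(1), of 1] Xb by (auto simp: free_module_def)
      obtain s a where sa: "s \<in> carrier R - \<pp>" "a \<in> carrier R" "?f s \<otimes>\<^bsub>?L\<^esub> c 1 b = ?f a"
        using p.localization_fraction[OF c1] by blast
      have sR: "s \<in> carrier R" using sa by blast
      \<comment> \<open>This is s h - a h0. The coordinates cancel in place 1, so its class lies
        over \<pp>C and it vanishes on \<open>K\<close>.\<close>
      define t where "t = (s \<odot>\<^bsub>?H\<^esub> h) \<oplus>\<^bsub>?H\<^esub> ((\<ominus>\<^bsub>R\<^esub> a) \<odot>\<^bsub>?H\<^esub> h0)"
      define d where "d n = ?f s \<odot>\<^bsub>?C\<^esub> c n \<oplus>\<^bsub>?C\<^esub> ?f (\<ominus>\<^bsub>R\<^esub> a) \<odot>\<^bsub>?C\<^esub> L.basis_vector X b" for n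
      have fs: "?f s \<in> carrier ?L" "?f (\<ominus>\<^bsub>R\<^esub> a) \<in> carrier ?L" using sR sa(2) by auto
      note coh1 = C.coherent_smult[OF I fs(1) c(1)] and coh2 = C.coherent_smult[OF I fs(2) bcoh]
      have d: "C.coherent ?I d" unfolding d_def by (rule C.coherent_add[OF I coh1 coh2])
      have t: "t \<in> linear_maps R F E" unfolding t_def using h h0 sR sa(2) by (intro Hadd Hsm) auto
      have ma: "\<ominus>\<^bsub>R\<^esub> a \<in> carrier R" using sa(2) by simp
      have \<Psi>t: "\<Psi> t = ?cls d"
        unfolding t_def d_def \<Psi>add[OF Hsm[OF sR h] Hsm[OF ma h0(1)]] \<Psi>sm[OF sR h] \<Psi>sm[OF ma h0(1)] c(2) h0(2)
          C.adic_class_smult[OF I c(1) fs(1)] C.adic_class_smult[OF I bcoh fs(2)] C.adic_class_add[OF I coh1 coh2] ..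
      have "d 1 = \<zero>\<^bsub>?C\<^esub>"
      proof
        fix x
        show "d 1 x = \<zero>\<^bsub>?C\<^esub> x"
        proof (cases "x \<in> X")
          case True
          then have "d 1 x = ?f s \<otimes>\<^bsub>?L\<^esub> c 1 b \<oplus>\<^bsub>?L\<^esub> ?f (\<ominus>\<^bsub>R\<^esub> a) \<otimes>\<^bsub>?L\<^esub> \<one>\<^bsub>?L\<^esub>"
            using Xb by (simp add: d_def L.free_module_apply L.basis_vector_def)
          also have "\<dots> = \<zero>\<^bsub>?L\<^esub>" unfolding sa(3) using sa(2) by (simp add: L.r_neg)
          finally show ?thesis using True by (simp add: free_module_def)
        next
          case False
          have "d 1 \<in> carrier ?C" using cohc[OF d] .
          then show ?thesis using False by (auto simp: free_module_def PiE_def extensional_def)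
        qed
      qed
      then have "d 1 \<in> adic_submodule ?L ?I ?C 1" using sub1(2) by simp
      then have "\<Psi> t \<in> Z" unfolding \<Psi>t by (rule lift[OF d])
      then have t0: "t y = \<zero>\<^bsub>E\<^esub>" if "y \<in> F.killed \<pp>" for y using t that by (simp add: Z_def)
      have "s \<odot>\<^bsub>E\<^esub> h y = a \<odot>\<^bsub>E\<^esub> h0 y" if y: "y \<in> F.killed \<pp>" for y
      proof -
        have "s \<odot>\<^bsub>E\<^esub> h y \<oplus>\<^bsub>E\<^esub> (\<ominus>\<^bsub>R\<^esub> a) \<odot>\<^bsub>E\<^esub> h0 y = \<zero>\<^bsub>E\<^esub>"
          using t0[OF y] by (simp add: t_def ev[OF y])
        then have "s \<odot>\<^bsub>E\<^esub> h y \<ominus>\<^bsub>E\<^esub> a \<odot>\<^bsub>E\<^esub> h0 y = \<zero>\<^bsub>E\<^esub>"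
          using sa(2) hc[OF h0(1) y] by (simp add: smult_l_minus M.minus_eq)
        then show ?thesis using M.minus_eq_zero hc[OF h y] hc[OF h0(1) y] sR sa(2) by simp
      qed
      then show ?thesis using sa(1,2) by blast
    qed
    have "dual_generator h0"
      unfolding dual_generator_def
    proof (intro conjI allI impI)
      show "linear_map R (F\<lparr>carrier := F.killed \<pp>\<rparr>) E h0" by (rule restriction_linear[OF h0(1)])
      have all: "\<exists>s\<in>carrier R - \<pp>. \<exists>a\<in>carrier R. \<forall>y\<in>F.killed \<pp>. s \<odot>\<^bsub>E\<^esub> g y = a \<odot>\<^bsub>E\<^esub> h0 y"
        if g: "linear_map R (F\<lparr>carrier := F.killed \<pp>\<rparr>) E g" for g
      proof -
        obtain h where h: "h \<in> linear_maps R F E" "\<And>y. y \<in> F.killed \<pp> \<Longrightarrow> h y = g y" using extension_exists[OF g] by blast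
        show ?thesis using ratio[OF h(1)] h(2) by simp
      qed
      then show "\<exists>s\<in>carrier R - \<pp>. \<exists>a\<in>carrier R. \<forall>y\<in>carrier (F\<lparr>carrier := F.killed \<pp>\<rparr>). s \<odot>\<^bsub>E\<^esub> g y = a \<odot>\<^bsub>E\<^esub> h0 y"
        if "linear_map R (F\<lparr>carrier := F.killed \<pp>\<rparr>) E g" for g using that by simp
      \<comment> \<open>If h0 vanished on \<open>K\<close>, the nonzero map of
        \<open>dual_nonzero\<close> would be killed by an s outside \<pp>.\<close>
      show "\<exists>y\<in>carrier (F\<lparr>carrier := F.killed \<pp>\<rparr>). h0 y \<noteq> \<zero>\<^bsub>E\<^esub>"
      proof (rule ccontr)
        assume no: "\<not> ?thesis"
        obtain g where g: "linear_map R (F\<lparr>carrier := F.killed \<pp>\<rparr>) E g" "g v = e0" using dual_nonzero by blast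
        obtain s a where sa: "s \<in> carrier R - \<pp>" "a \<in> carrier R" "\<And>y. y \<in> F.killed \<pp> \<Longrightarrow> s \<odot>\<^bsub>E\<^esub> g y = a \<odot>\<^bsub>E\<^esub> h0 y"
          using all[OF g(1)] by blast
        have "s \<in> \<pp>"
          by (rule kernel_zero_of_scalar[OF g(1) u(1)]) (use g(2) e0 sa no in auto)
        then show False using sa(1) by blast
      qed
    qed
    then show "\<exists>f. dual_generator f" by blast
  next
    assume "\<exists>f. dual_generator f"
    then obtain f0 where f0: "dual_generator f0" ..
    note fl = dual_generatorD(1)[OF f0]
    have "X \<noteq> {}"
    proof
      assume "X = {}"
      \<comment> \<open>Over the empty set the free module and its completion have one element each,
        whereas some map in Hom(F, E) is nonzero at v.\<close>
      then have triv: "x = y" if "x \<in> carrier ?C" "y \<in> carrier ?C" for x y using that by (auto simp: free_module_def)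
      have one: "z = z'" if zz: "z \<in> carrier ?Ch" "z' \<in> carrier ?Ch" for z z'
      proof -
        obtain c c' where c: "C.coherent ?I c" "z = ?cls c" "C.coherent ?I c'" "z' = ?cls c'" using cls zz by meson
        have "c = c'" using triv cohc[OF c(1)] cohc[OF c(3)] by blast
        then show ?thesis using c by simp
      qed
      obtain g where g: "linear_map R (F\<lparr>carrier := F.killed \<pp>\<rparr>) E g" "g v = e0" using dual_nonzero by blast
      obtain h where h: "h \<in> linear_maps R F E" "\<And>y. y \<in> F.killed \<pp> \<Longrightarrow> h y = g y" using extension_exists[OF g(1)] by blast
      have vk: "v \<in> F.killed \<pp>" using u(1) by simp
      have "h = \<zero>\<^bsub>R\<^esub> \<odot>\<^bsub>?H\<^esub> h" using one \<Psi>c h(1) Hsm[OF R.zero_closed h(1)] by (intro \<Psi>inj) auto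
      then have "h v = \<zero>\<^bsub>R\<^esub> \<odot>\<^bsub>E\<^esub> h v" using ev(2)[OF vk, of "\<zero>\<^bsub>R\<^esub>" h] by metis
      then show False using hc[OF h(1) vk] h(2)[OF vk] g(2) e0 by simp
    qed
    moreover have "b = b'" if bb: "b \<in> X" "b' \<in> X" for b b'
    proof (rule ccontr)
      assume ne: "b \<noteq> b'"
      obtain h where h: "h \<in> linear_maps R F E" "\<Psi> h = ?cls (\<lambda>n. L.basis_vector X b)" using \<Psi>surj[OF clsc[OF bcoh]] by blast
      obtain h' where h': "h' \<in> linear_maps R F E" "\<Psi> h' = ?cls (\<lambda>n. L.basis_vector X b')" using \<Psi>surj[OF clsc[OF bcoh]] by blast
      obtain s a where sa: "s \<in> carrier R - \<pp>" "a \<in> carrier R" "\<And>y. y \<in> F.killed \<pp> \<Longrightarrow> s \<odot>\<^bsub>E\<^esub> h y = a \<odot>\<^bsub>E\<^esub> f0 y"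
        using dual_generatorD(4)[OF f0 restriction_linear[OF h(1)]] by auto
      obtain s' a' where sa': "s' \<in> carrier R - \<pp>" "a' \<in> carrier R" "\<And>y. y \<in> F.killed \<pp> \<Longrightarrow> s' \<odot>\<^bsub>E\<^esub> h' y = a' \<odot>\<^bsub>E\<^esub> f0 y"
        using dual_generatorD(4)[OF f0 restriction_linear[OF h'(1)]] by auto
      have f0k: "f0 y \<in> killed \<pp>" "f0 y \<in> carrier E" if "y \<in> F.killed \<pp>" for y
        using image_killed[OF fl, of y] linear_map_closed[OF fl, of y] that by auto
      \<comment> \<open>Both maps are multiples of f0 on \<open>K\<close>, hence dependent there. If
        the coefficient a of h vanishes modulo \<pp>, then s h is zero; otherwise f0 is eliminated
        by cross multiplication.\<close>
      have "\<exists>\<alpha>\<in>carrier R. \<exists>\<alpha>'\<in>carrier R. (\<alpha> \<notin> \<pp> \<or> \<alpha>' \<notin> \<pp>) \<and>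
        (\<forall>y\<in>F.killed \<pp>. \<alpha> \<odot>\<^bsub>E\<^esub> h y \<oplus>\<^bsub>E\<^esub> \<alpha>' \<odot>\<^bsub>E\<^esub> h' y = \<zero>\<^bsub>E\<^esub>)"
      proof (cases "a \<in> \<pp>")
        case True
        have "s \<odot>\<^bsub>E\<^esub> h y \<oplus>\<^bsub>E\<^esub> \<zero>\<^bsub>R\<^esub> \<odot>\<^bsub>E\<^esub> h' y = \<zero>\<^bsub>E\<^esub>" if "y \<in> F.killed \<pp>" for y
          using sa(3)[OF that] f0k(1)[OF that] True hc[OF h'(1) that] by (simp add: killed_def)
        then show ?thesis using sa(1) by (intro bexI[of _ s] bexI[of _ "\<zero>\<^bsub>R\<^esub>"]) auto
      next
        case False
        let ?\<alpha> = "a' \<otimes>\<^bsub>R\<^esub> s" and ?\<alpha>' = "\<ominus>\<^bsub>R\<^esub> (a \<otimes>\<^bsub>R\<^esub> s')"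
        have as': "a \<otimes>\<^bsub>R\<^esub> s' \<notin> \<pp>" using p.I_prime[of a s'] False sa sa' by auto
        have "?\<alpha>' \<notin> \<pp>"
        proof
          assume "?\<alpha>' \<in> \<pp>"
          then have "\<ominus>\<^bsub>R\<^esub> ?\<alpha>' \<in> \<pp>" by (rule additive_subgroup.a_inv_closed[OF p.is_additive_subgroup])
          then show False using as' sa(2) sa'(1) by simp
        qed
        moreover have "?\<alpha> \<odot>\<^bsub>E\<^esub> h y \<oplus>\<^bsub>E\<^esub> ?\<alpha>' \<odot>\<^bsub>E\<^esub> h' y = \<zero>\<^bsub>E\<^esub>" if y: "y \<in> F.killed \<pp>" for y
        proof -
          have "?\<alpha> \<odot>\<^bsub>E\<^esub> h y = a' \<odot>\<^bsub>E\<^esub> (a \<odot>\<^bsub>E\<^esub> f0 y)"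
            using sa(1,2) sa'(2) hc[OF h(1) y] by (simp add: smult_assoc1 sa(3)[OF y])
          moreover have "?\<alpha>' \<odot>\<^bsub>E\<^esub> h' y = \<ominus>\<^bsub>E\<^esub> (a \<odot>\<^bsub>E\<^esub> (a' \<odot>\<^bsub>E\<^esub> f0 y))"
            using sa'(1,2) sa(2) hc[OF h'(1) y] by (simp add: smult_l_minus smult_assoc1 sa'(3)[OF y])
          ultimately show ?thesis
            using sa(2) sa'(2) f0k(2)[OF y] smult_swap[of a a' "f0 y"] by (simp add: M.r_neg)
        qed
        ultimately show ?thesis using sa sa' by (intro bexI[of _ ?\<alpha>] bexI[of _ ?\<alpha>']) auto
      qed
      then obtain \<alpha> \<alpha>' where \<alpha>: "\<alpha> \<in> carrier R" "\<alpha>' \<in> carrier R" "\<alpha> \<notin> \<pp> \<or> \<alpha>' \<notin> \<pp>"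
        "\<And>y. y \<in> F.killed \<pp> \<Longrightarrow> \<alpha> \<odot>\<^bsub>E\<^esub> h y \<oplus>\<^bsub>E\<^esub> \<alpha>' \<odot>\<^bsub>E\<^esub> h' y = \<zero>\<^bsub>E\<^esub>" by blast
      define t where "t = (\<alpha> \<odot>\<^bsub>?H\<^esub> h) \<oplus>\<^bsub>?H\<^esub> (\<alpha>' \<odot>\<^bsub>?H\<^esub> h')"
      have t: "t \<in> linear_maps R F E" unfolding t_def using h h' \<alpha> by (intro Hadd Hsm) auto
      have t0: "t y = \<zero>\<^bsub>E\<^esub>" if "y \<in> F.killed \<pp>" for y using \<alpha>(4)[OF that] by (simp add: t_def ev[OF that])
      have fa: "?f \<alpha> \<in> carrier ?L" "?f \<alpha>' \<in> carrier ?L" using \<alpha> by auto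
      note coh1 = C.coherent_smult[OF I fa(1) bcoh] and coh2 = C.coherent_smult[OF I fa(2) bcoh]
      let ?w = "?f \<alpha> \<odot>\<^bsub>?C\<^esub> L.basis_vector X b \<oplus>\<^bsub>?C\<^esub> ?f \<alpha>' \<odot>\<^bsub>?C\<^esub> L.basis_vector X b'"
      have \<Psi>t: "\<Psi> t = ?cls (\<lambda>n. ?w)"
        unfolding t_def \<Psi>add[OF Hsm[OF \<alpha>(1) h(1)] Hsm[OF \<alpha>(2) h'(1)]] \<Psi>sm[OF \<alpha>(1) h(1)] \<Psi>sm[OF \<alpha>(2) h'(1)] h(2) h'(2)
          C.adic_class_smult[OF I bcoh fa(1)] C.adic_class_smult[OF I bcoh fa(2)] C.adic_class_add[OF I coh1 coh2] ..
      have wc: "?w \<in> carrier ?C" using fa bc by simp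
      \<comment> \<open>The maps whose class lies over \<pp>C. They include all multiples by
        generators of \<pp>, hence by \<open>linear_map_vanishing_on_killed\<close> every map that
        vanishes on \<open>K\<close>.\<close>
      define Z where "Z = {k \<in> linear_maps R F E. \<exists>c. C.coherent ?I c \<and> \<Psi> k = ?cls c \<and> c 1 \<in> adic_submodule ?L ?I ?C 1}"
      have Zsm: "r \<odot>\<^bsub>?H\<^esub> g \<in> Z" if r: "r \<in> carrier R" "?f r \<in> ?I" and g: "g \<in> linear_maps R F E" for r g
      proof -
        obtain c where c: "C.coherent ?I c" "\<Psi> g = ?cls c" using cls[OF \<Psi>c[OF g]] by blast
        have fr: "?f r \<in> carrier ?L" using r by simp
        have "?f r \<odot>\<^bsub>?C\<^esub> c 1 \<in> adic_submodule ?L ?I ?C 1"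
          unfolding C.adic_submodule_eq using r(2) L.ideal_pow_1[OF I] cohc[OF c(1)]
          by (intro C.smult_mem_ideal_smult) auto
        then show ?thesis
          using Hsm[OF r(1) g] \<Psi>sm[OF r(1) g] c(2) C.adic_class_smult[OF I c(1) fr] C.coherent_smult[OF I fr c(1)]
          unfolding Z_def by auto
      qed
      have "t \<in> Z"
      proof (rule linear_map_vanishing_on_killed[OF injective F.module_axioms asR(1) _ _ _ t])
        have "?f \<zero>\<^bsub>R\<^esub> \<in> ?I" using additive_subgroup.zero_closed[OF ideal.axioms(1)[OF I]] by simp
        then have "\<zero>\<^bsub>R\<^esub> \<odot>\<^bsub>?H\<^esub> t \<in> Z" using t by (intro Zsm) auto
        also have "\<zero>\<^bsub>R\<^esub> \<odot>\<^bsub>?H\<^esub> t = (\<lambda>x\<in>carrier F. \<zero>\<^bsub>E\<^esub>)"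
          using linear_map_closed[OF linear_maps_imp_linear_map[OF t]] by (auto simp: Hom_module_simps fun_eq_iff)
        finally show "(\<lambda>x\<in>carrier F. \<zero>\<^bsub>E\<^esub>) \<in> Z" .
        show "g \<oplus>\<^bsub>?H\<^esub> k \<in> Z" if gk: "g \<in> Z" "k \<in> Z" for g k
        proof -
          obtain c where c: "g \<in> linear_maps R F E" "C.coherent ?I c" "\<Psi> g = ?cls c" "c 1 \<in> adic_submodule ?L ?I ?C 1"
            using gk(1) by (auto simp: Z_def)
          obtain d where d: "k \<in> linear_maps R F E" "C.coherent ?I d" "\<Psi> k = ?cls d" "d 1 \<in> adic_submodule ?L ?I ?C 1"
            using gk(2) by (auto simp: Z_def)
          show ?thesis
            using Hadd[OF c(1) d(1)] \<Psi>add[OF c(1) d(1)] C.adic_class_add[OF I c(2) d(2)] C.coherent_add[OF I c(2) d(2)]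
              sub1(3)[OF c(4) d(4)] c(3) d(3) unfolding Z_def by auto
        qed
        show "a \<odot>\<^bsub>?H\<^esub> g \<in> Z" if a: "a \<in> set as" and g: "g \<in> linear_maps R F E" for a g
        proof (rule Zsm[OF _ _ g])
          show "a \<in> carrier R" using a asR by blast
          show "?f a \<in> ?I" unfolding Igen using L.genideal_self[OF asL] a by auto
        qed
        show "t y = \<zero>\<^bsub>E\<^esub>" if "y \<in> F.killed (set as)" for y using t0 that killed_as by blast
      qed
      then obtain c where c: "C.coherent ?I c" "?cls (\<lambda>n. ?w) = ?cls c" "c 1 \<in> adic_submodule ?L ?I ?C 1"
        using \<Psi>t by (auto simp: Z_def)
      have "?w \<ominus>\<^bsub>?C\<^esub> c 1 \<in> adic_submodule ?L ?I ?C 1"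
        using C.adic_class_eq_iff[OF I, of "\<lambda>n. ?w" c] wc cohc[OF c(1)] c(2) by simp
      then have "(?w \<ominus>\<^bsub>?C\<^esub> c 1) \<oplus>\<^bsub>?C\<^esub> c 1 \<in> adic_submodule ?L ?I ?C 1" using c(3) by (rule sub1(3))
      then have w1: "?w \<in> adic_submodule ?L ?I ?C 1" unfolding C.M.add_minus_cancel[OF wc cohc[OF c(1)]] .
      have "?w b = ?f \<alpha>" "?w b' = ?f \<alpha>'"
        using bb ne fa by (simp_all add: L.free_module_apply L.basis_vector_def)
      then have "?f \<alpha> \<in> ?I" "?f \<alpha>' \<in> ?I"
        using L.adic_submodule_coordinate[OF I w1 bb(1)] L.adic_submodule_coordinate[OF I w1 bb(2)] by simp_all
      then show False using p.localization_map_extended_prime \<alpha> by blast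
    qed
    ultimately have "\<exists>b. X = {b}" by blast
    then show "card X = 1" by auto
  qed
qed

end

theorem theorem1p3:
  fixes R :: "('a, 'r) ring_scheme"
    and \<mm> \<pp> :: "'a set"
    and E :: "('a, 'e) module"
    and E\<^sub>\<pp> :: "('a, 'f) module"
    and X\<^sub>\<pp> :: "'x set"
  assumes "local_noetherian_ring R \<mm>"
    and "primeideal \<pp> R"
    and "\<pp> \<noteq> \<mm>"
    and "injective_hull R (quot_module (ring_as_module R) \<mm>) E"
    and "injective_hull R (quot_module (ring_as_module R) \<pp>) E\<^sub>\<pp>"
    and "enochs_index_set R \<pp> E\<^sub>\<pp> E X\<^sub>\<pp>"
  shows "card X\<^sub>\<pp> = 1 \<longleftrightarrow>
    krull_dim (R Quot \<pp>) = 1 \<and>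
    adically_complete R \<mm> (quot_module (ring_as_module R) \<pp>)"
proof -
  obtain e0 where hull: "residue_hull R E \<mm> e0"
    using residue_hull_of_injective_hull[OF assms(1,4)] by blast
  obtain v where v: "residue_field_module R E \<mm> e0 (E\<^sub>\<pp>\<lparr>carrier := module.killed E\<^sub>\<pp> \<pp>\<rparr>) \<pp> v"
    using residue_field_module_of_hull[OF hull assms(2,3,5)] by blast
  have F: "module R E\<^sub>\<pp>" using assms(5) by (simp add: injective_hull_def injective_module_def)
  interpret enochs_module R E \<mm> e0 E\<^sub>\<pp> \<pp> v using v F by (rule enochs_module.intro)
  let ?no = "\<not> (\<exists>q. primeideal q R \<and> \<pp> \<subset> q \<and> q \<subset> \<mm>)"
  have "(\<exists>f. dual_generator f) \<longleftrightarrow> ?no \<and> adic_limits R \<mm> \<pp>"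
  proof
    assume "\<exists>f. dual_generator f"
    then show "?no \<and> adic_limits R \<mm> \<pp>"
      using no_intermediate_prime_of_dual_generator adic_limits_of_dual_generator by blast
  next
    assume *: "?no \<and> adic_limits R \<mm> \<pp>"
    have dim: "q = \<pp> \<or> q = \<mm>" if "primeideal q R" "\<pp> \<subseteq> q" for q
      using * that local_noetherian_ring_proper[OF assms(1) primeideal.axioms(1)[OF that(1)]] primeideal.I_notcarr[OF that(1)] by blast
    \<comment> \<open>Any nonzero map will do as a generator, and \<open>dual_nonzero\<close>
      supplies one.\<close>
    obtain f where f: "linear_map R (E\<^sub>\<pp>\<lparr>carrier := module.killed E\<^sub>\<pp> \<pp>\<rparr>) E f" "f v = e0" using dual_nonzero by blast
    have "dual_generator f"
      by (rule dual_generator_of_adic_limits[OF dim _ f(1) u(1)]) (use * f(2) residue_hull.e0(2)[OF hull] in auto)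
    then show "\<exists>f. dual_generator f" by blast
  qed
  then show ?thesis
    using card_enochs_index_set_eq_1_iff[OF assms(6)] krull_dim_quotient_eq_1_iff[OF assms(1-3)]
      adically_complete_iff_adic_limits[OF primeideal.axioms(1)[OF assms(2)]] by blast
qed

end
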